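(* (1) Let $q\in\mathbb C$ with $\Re(q)>0$, let $u$ be an even Maass cusp form on $\mathrm{PSL}(2,\mathbb Z)$ with eigenvalue $q(1-q)$, let $\{c_{n,q}\}_{n\ge1}$ be its Fourier coefficients, and let $\{a_{n,q}\}$ be the sequence associated with $u$ (defined in the context). Then, up to a non-zero multiplicative constant depending only on $q$, for all $n\ge1$, $$c_{n,q}=2\,n^{q-\frac12}\sum_{k=1}^{\infty}\frac{(-1)^k a_{2k,q}}{\Gamma(2k+2q)}(2\pi n)^{2k}.$$ (2) For all integers $n\ge1$ and all $q\in\mathbb C$ with $\Re(q)>0$, $$\sigma_{2q-1}(n)=n^{2q-1}\sum_{k=1}^{\infty}\frac{(-1)^k\tilde A_{2k,q}}{(2k)!}(2\pi n)^{2k},\qquad\text{where}\quad \tilde A_{k,q}:=\frac{1}{k+1}\sum_{i=2}^{k}\binom{k+1}{i}B_i\,\zeta(2q-1+i).$$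
   Context: Let $\mathcal H=\{z=x+iy: y>0\}$ and $\Delta=-y^2(\partial_x^2+\partial_y^2)$. An even Maass cusp form on $\mathrm{PSL}(2,\mathbb Z)$ with eigenvalue $q(1-q)$ is a smooth $\mathrm{PSL}(2,\mathbb Z)$-invariant $u:\mathcal H\to\mathbb C$ with $\Delta u=q(1-q)u$, decaying rapidly at the cusp (vanishing zeroth Fourier coefficient), and $u(-x+iy)=u(x+iy)$. Its Fourier expansion is $$u(x+iy)=y^{\frac12}\sum_{n\ge1}c_{n,q}K_{q-\frac12}(2\pi ny)\cos(2\pi nx),$$ with $K_\nu$ the modified Bessel function of the third kind; the $c_{n,q}$ grow at most polynomially. The sequence $\{a_{n,q}\}$ associated with $u$: set $$\varphi(t):=t^{1-q}\int_0^\infty J_{q-\frac12}(ty)\sqrt{ty}\;u(iy)\,dy,\qquad t>0,$$ with $J_\nu$ the Bessel function of the first kind. Then $\{a_{n,q}\}_{n\ge1}$ (with $a_{0,q}=0$) is the sequence, satisfying $\limsup_n|a_{n,q}|^{1/n}\le1$, determined by $$\varphi(t)=\frac{e^{-t}}{1-e^{-t}}\sum_{n=1}^{\infty}\frac{(-1)^n a_{n,q}\,t^n}{\Gamma(n+2q)}.$$ It is the sequence for which $u(iy)=\sum_{n\ge0}(-1)^na_{n,q}(1+y^2)^{-\frac n2-\frac q2-\frac14}\Big[y^{\frac12}\mathrm P^{-q+\frac12}_{n+q-\frac12}\big((1+y^2)^{-\frac12}\big)+y^{n+q}\mathrm P^{-q+\frac12}_{n+q-\frac12}\big(y(1+y^2)^{-\frac12}\big)\Big]$,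 where $\mathrm P^\mu_\nu$ are the Legendre (Ferrers) functions on $(-1,1)$. $\sigma_\alpha(n)=\sum_{d\mid n}d^\alpha$ is the divisor function, $\zeta$ the Riemann zeta function, $B_i$ the Bernoulli numbers ($\sum_{i\ge0}B_it^i/i!=t/(e^t-1)$). *)

theory Defs
  imports "HOL-Analysis.Analysis"
begin

section \<open>Special functions and numbers\<close>

text \<open>
  Bessel function of the first kind, with the principal branch of \<open>(z/2) powr \<nu>\<close>.
  The entire function \<^const>\<open>rGamma\<close> makes the coefficients with
  \<open>\<nu> + k + 1\<close> a pole of Gamma vanish, as they should.
\<close>

definition bessel_J :: "complex \<Rightarrow> complex \<Rightarrow> complex" where
  "bessel_J \<nu> z =
     (z / 2) powr \<nu> * (\<Sum>k. (-1) ^ k * rGamma (\<nu> + of_nat k + 1) / fact k * (z / 2) ^ (2 * k))"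

text \<open>
  Modified Bessel function of the third kind on the positive half-line, by its standard integral
  representation. It is valid for every complex order, in contrast to
  \<open>\<pi>/2 * (I_(-\<nu>) - I_\<nu>) / sin (\<pi> \<nu>)\<close>, which needs a limit at integer orders.
\<close>

definition bessel_K :: "complex \<Rightarrow> real \<Rightarrow> complex" where
  "bessel_K \<nu> x = (LINT t:{0<..}|lborel. of_real (exp (- x * cosh t)) * cosh (\<nu> * of_real t))"

text \<open>
  The Riemann zeta function is only evaluated in its half-plane of absolute convergence
  \<open>Re s > 1\<close>, where it is given by the Dirichlet series; outside of it the value is irrelevant.
\<close>

definition riemann_zeta :: "complex \<Rightarrow> complex" where
  "riemann_zeta s = (\<Sum>n. 1 / of_nat (Suc n) powr s)"

definition bernoulli_number :: "nat \<Rightarrow> complex" where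
  "bernoulli_number i = fact i * fps_nth (fps_X / (fps_exp 1 - 1)) i"

definition divisor_sigma :: "complex \<Rightarrow> nat \<Rightarrow> complex" where
  "divisor_sigma \<alpha> n = (\<Sum>d | d dvd n. of_nat d powr \<alpha>)"


section \<open>Maass cusp forms for the modular group\<close>

definition upper_half_plane :: "complex set" where
  "upper_half_plane = {z. Im z > 0}"

definition deriv_x :: "(complex \<Rightarrow> complex) \<Rightarrow> complex \<Rightarrow> complex" where
  "deriv_x f z = frechet_derivative f (at z) 1"

definition deriv_y :: "(complex \<Rightarrow> complex) \<Rightarrow> complex \<Rightarrow> complex" where
  "deriv_y f z = frechet_derivative f (at z) \<i>"

text \<open>
  Differentiability is over the reals throughout
  (\<open>differentiable\<close>, not \<open>field_differentiable\<close>); \<open>S\<close> is meant to be open.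
\<close>

primrec C_k_on :: "nat \<Rightarrow> complex set \<Rightarrow> (complex \<Rightarrow> complex) \<Rightarrow> bool" where
  "C_k_on 0 S f \<longleftrightarrow> continuous_on S f"
| "C_k_on (Suc k) S f \<longleftrightarrow>
     (\<forall>z\<in>S. f differentiable (at z)) \<and> C_k_on k S (deriv_x f) \<and> C_k_on k S (deriv_y f)"

definition smooth_on :: "complex set \<Rightarrow> (complex \<Rightarrow> complex) \<Rightarrow> bool" where
  "smooth_on S f \<longleftrightarrow> (\<forall>k. C_k_on k S f)"

definition hyp_laplacian :: "(complex \<Rightarrow> complex) \<Rightarrow> complex \<Rightarrow> complex" where
  "hyp_laplacian u z =
     - (of_real (Im z))\<^sup>2 * (deriv_x (deriv_x u) z + deriv_y (deriv_y u) z)"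

text \<open>
  Functions on the upper half-plane are total functions of which only the values at points
  with positive imaginary part matter. Rapid decay at the cusp means faster than any power of
  \<open>Im z\<close>, uniformly in \<open>Re z\<close>.
\<close>

definition even_maass_cusp_form :: "complex \<Rightarrow> (complex \<Rightarrow> complex) \<Rightarrow> bool" where
  "even_maass_cusp_form q u \<longleftrightarrow>
     smooth_on upper_half_plane u \<and>
     (\<forall>a b c d :: int. a * d - b * c = 1 \<longrightarrow>
        (\<forall>z\<in>upper_half_plane. u ((of_int a * z + of_int b) / (of_int c * z + of_int d)) = u z)) \<and>
     (\<forall>z\<in>upper_half_plane. hyp_laplacian u z = q * (1 - q) * u z) \<and>
     (\<forall>N::nat. \<exists>B. \<forall>z. Im z \<ge> 1 \<longrightarrow> norm (u z) \<le> B / Im z ^ N) \<and>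
     (\<forall>y>0. ((\<lambda>x. u (Complex x y)) has_integral 0) {0..1}) \<and>
     (\<forall>x. \<forall>y>0. u (Complex (- x) y) = u (Complex x y))"

text \<open>The value \<open>c 0\<close> is not constrained.\<close>

definition fourier_coefficients ::
    "complex \<Rightarrow> (complex \<Rightarrow> complex) \<Rightarrow> (nat \<Rightarrow> complex) \<Rightarrow> bool" where
  "fourier_coefficients q u c \<longleftrightarrow>
     (\<forall>x. \<forall>y>0.
        (\<lambda>n. of_real (sqrt y) * (c (Suc n) * bessel_K (q - 1/2) (2 * pi * real (Suc n) * y) *
               of_real (cos (2 * pi * real (Suc n) * x))))
          sums u (Complex x y))"


section \<open>The sequence associated with an even cusp form\<close>

definition phi_transform :: "complex \<Rightarrow> (complex \<Rightarrow> complex) \<Rightarrow> real \<Rightarrow> complex" where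
  "phi_transform q u t =
     of_real t powr (1 - q) *
     (LINT y:{0<..}|lborel. bessel_J (q - 1/2) (of_real (t * y)) * of_real (sqrt (t * y)) *
        u (Complex 0 y))"

text \<open>
  The root condition makes the power series below converge for every \<open>t\<close>. As
  \<open>Gamma (n + 2 q)\<close> is finite and non-zero for \<open>Re q > 0\<close>, the conditions
  determine \<open>a\<close> uniquely.
\<close>

definition associated_sequence ::
    "complex \<Rightarrow> (complex \<Rightarrow> complex) \<Rightarrow> (nat \<Rightarrow> complex) \<Rightarrow> bool" where
  "associated_sequence q u a \<longleftrightarrow>
     a 0 = 0 \<and>
     limsup (\<lambda>n. ereal (root n (norm (a n)))) \<le> 1 \<and>
     (\<forall>t>0. phi_transform q u t =
        of_real (exp (- t) / (1 - exp (- t))) *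
        (\<Sum>n. (-1) ^ Suc n * a (Suc n) * of_real t ^ Suc n / Gamma (of_nat (Suc n) + 2 * q)))"

definition A_tilde :: "nat \<Rightarrow> complex \<Rightarrow> complex" where
  "A_tilde k q =
     1 / of_nat (k + 1) *
     (\<Sum>i = 2..k. of_nat ((k + 1) choose i) * bernoulli_number i *
        riemann_zeta (2 * q - 1 + of_nat i))"

end

theory Submission
  imports Defs "HOL-Complex_Analysis.Complex_Analysis"
begin

text \<open>
  Both parts rest on the same interpolation. The function \<open>2 t (exp t - 1) / (t\<^sup>2 + (2 \<pi> n)\<^sup>2)\<close>
  is entire after removal of its singularities; it takes the value \<open>1\<close> at \<open>\<plusminus> 2 \<pi> i n\<close> and
  \<open>0\<close> at \<open>\<plusminus> 2 \<pi> i m\<close> for all other \<open>m > 0\<close>. So if the power series \<open>F\<close> with the coefficients of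
  the theorem is a sum over \<open>n\<close> of such kernels with weights \<open>w n\<close>, then the even part of \<open>F\<close>
  at \<open>2 \<pi> i n\<close> is \<open>w n\<close>.

  For the divisor function, the partial fractions of \<open>t / (exp t - 1)\<close>, applied to \<open>t / m\<close>, weighted
  by \<open>m powr (1 - 2 q)\<close> and summed over \<open>m\<close>, give
  \<open>\<Sum>i\<ge>2. B i * \<zeta> (2 q - 1 + i) * t ^ i / i! = \<Sum>n. \<sigma> (1 - 2 q) n * 2 t\<^sup>2 / (t\<^sup>2 + (2 \<pi> n)\<^sup>2)\<close>
  near \<open>0\<close>; multiplication by \<open>(exp t - 1) / t\<close> turns the left-hand side into
  \<open>\<Sum>k. A k * t ^ k / k!\<close> and each summand on the right into a kernel.

  For a cusp form, let \<open>\<nu> = q - 1/2\<close> and split the integral defining \<open>\<phi>\<close> at \<open>y = 1\<close>. The part over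
  \<open>(0, 1]\<close> is entire in \<open>t\<close>, since \<open>u (i y) = u (i / y)\<close> is bounded there, and it does not
  contribute at \<open>2 \<pi> i n\<close> because of the factor \<open>exp t - 1\<close>. In the part over \<open>[1, \<infinity>)\<close> the Fourier
  expansion is integrated termwise; Lommel's integral of \<open>y J\<^sub>\<nu>(t y) K\<^sub>\<nu>(2 \<pi> n y)\<close> is an entire function of
  \<open>t\<close> divided by \<open>t\<^sup>2 + (2 \<pi> n)\<^sup>2\<close>, and at \<open>t = \<plusminus> 2 \<pi> i n\<close> the numerator is a Wronskian, hence
  explicit. Thanks to the cut at \<open>1\<close> the exponential bound \<open>c n = O (exp (\<pi> n))\<close>, which is immediate
  from convergence of the Fourier series, suffices.
\<close>

section \<open>An entire kernel\<close>

text \<open>The identity with a kernel series is only accessible far from the nodes: as a power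
  series at 0 for the divisor function, for real \<open>t\<close> in (0, 1) for cusp forms, where
  the expansions converge or are dominated. The nodes have modulus at least 2 pi, so both sides must
  be known to be entire before values there can be compared. The weights of the kernels are allowed
  to be entire functions of \<open>t\<close>, because the Lommel numerators depend on
  \<open>t\<close>. The assumption Re q > 0 acts in two ways: m powr (-1 - 2 Re q) is summable, the
  exponent joining the weight m powr (1 - 2 q) to a quadratic decay; and Re \<nu> > -1/2, which
  controls the Bessel coefficients and y powr q near 0. Interpolation yields sigma (1 - 2 q);
  passing to complementary divisors gives sigma (2 q - 1) and the power of n in front. For cusp
  forms the node value is c n / 2 times (2 pi n) powr (-\<nu>): 2 powr (-\<nu>) stems from the
  normalisation of J, (2 / (2 pi n)) powr \<nu> from the Wronskian, 1/2 from the factor 2 in the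
  kernel. Hence the factor 2 and the constant (2 pi) powr (q - 1/2).\<close>

definition exp_quot :: "complex \<Rightarrow> complex" where
  "exp_quot z = (if z = 0 then 1 else (exp z - 1) / z)"

lemma exp_quot_holomorphic: "exp_quot holomorphic_on UNIV"
proof -
  have *: "(\<lambda>z. if z = 0 then deriv exp 0 else (exp z - exp 0) / (z - 0)) holomorphic_on (UNIV :: complex set)"
    by (rule pole_lemma_open) (auto intro: holomorphic_intros)
  have "deriv exp (0::complex) = 1"
    by (metis DERIV_exp DERIV_imp_deriv exp_zero)
  thus ?thesis
    using * by (simp only: exp_quot_def[abs_def] exp_zero diff_0_right)
qed

lemma exp_quot_mult: "z * exp_quot z = exp z - 1"
  by (simp add: exp_quot_def)

text \<open>By periodicity of exp this is (exp t - 1) * (1 / (t - a) + 1 / (t + a)) with a = 2 pi i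
  n, that is, the kernel of the overview. Written with \<open>exp_quot\<close> it is entire without
  any case distinction at the removable singularities.\<close>

definition exp_kernel :: "nat \<Rightarrow> complex \<Rightarrow> complex" where
  "exp_kernel n t = exp_quot (t - \<i> * (2 * pi * real n)) + exp_quot (t + \<i> * (2 * pi * real n))"

lemma exp_kernel_holomorphic: "exp_kernel n holomorphic_on A"
proof -
  have "(exp_quot \<circ> (\<lambda>t. t - \<i> * (2 * pi * real n))) holomorphic_on A"
       "(exp_quot \<circ> (\<lambda>t. t + \<i> * (2 * pi * real n))) holomorphic_on A"
    by (rule holomorphic_on_compose_gen[OF _ exp_quot_holomorphic]; auto intro!: holomorphic_intros)+
  from holomorphic_on_add[OF this] show ?thesis
    by (simp add: exp_kernel_def[abs_def] o_def)
qed

lemma exp_two_pi_i_nat: "exp (\<i> * (2 * complex_of_real pi * of_nat n)) = 1"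
  using exp_integer_2pi[of "of_nat n"] by (simp add: mult_ac)

lemma exp_kernel_eq:
  "exp_kernel n t * (t\<^sup>2 + of_real ((2 * pi * real n)\<^sup>2)) = 2 * t * (exp t - 1)"
proof -
  define a where "a = \<i> * (2 * complex_of_real pi * of_nat n)"
  have e: "exp a = 1" unfolding a_def by (rule exp_two_pi_i_nat)
  have "exp_kernel n t * (t\<^sup>2 + of_real ((2 * pi * real n)\<^sup>2))
        = (exp_quot (t - a) + exp_quot (t + a)) * ((t - a) * (t + a))"
    by (simp add: exp_kernel_def a_def power2_eq_square algebra_simps)
  also have "\<dots> = ((t - a) * exp_quot (t - a)) * (t + a) + ((t + a) * exp_quot (t + a)) * (t - a)"
    by (simp add: algebra_simps)
  also have "\<dots> = 2 * t * (exp t - 1)"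
    unfolding exp_quot_mult by (simp add: exp_diff exp_add e algebra_simps)
  finally show ?thesis .
qed

lemma exp_kernel_nonpole:
  assumes "t\<^sup>2 + of_real ((2 * pi * real n)\<^sup>2) \<noteq> 0"
  shows "exp_kernel n t = 2 * t * (exp t - 1) / (t\<^sup>2 + of_real ((2 * pi * real n)\<^sup>2))"
  using exp_kernel_eq[of n t] assms by (simp add: field_simps)

lemma exp_quot_at_period:
  "exp_quot (\<i> * of_real (2 * pi * of_int k)) = (if k = 0 then 1 else 0)"
  using exp_integer_2pi[of "of_int k"] by (auto simp: exp_quot_def mult_ac)

text \<open>At a multiple of 2 pi i, \<open>exp_quot\<close> is 1 at the origin and 0 elsewhere, so
  only the translate centred at the node survives. The sign \<open>s\<close> covers the upper and
  the lower node at once.\<close>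

lemma exp_kernel_at_pole:
  assumes "n > 0" "m > 0" "s = 1 \<or> s = - 1"
  shows "exp_kernel n (of_real s * \<i> * of_real (2 * pi * real m)) = (if n = m then 1 else 0)"
proof -
  have 1: "exp_kernel n (\<i> * of_real (2 * pi * of_int k)) =
     (if k = int n then 1 else 0) + (if k = - int n then 1 else 0)" for k
  proof -
    have "\<i> * of_real (2 * pi * of_int k) - \<i> * of_real (2 * pi * real n) =
      \<i> * of_real (2 * pi * of_int (k - int n))" by (simp add: algebra_simps)
    moreover have "\<i> * of_real (2 * pi * of_int k) + \<i> * of_real (2 * pi * real n) =
      \<i> * of_real (2 * pi * of_int (k + int n))" by (simp add: algebra_simps)
    ultimately show ?thesis
      unfolding exp_kernel_def
      by (simp only: exp_quot_at_period eq_neg_iff_add_eq_0 right_minus_eq)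
  qed
  show ?thesis
  proof (rule disjE[OF assms(3)])
    assume s: "s = 1"
    have "of_real s * \<i> * of_real (2 * pi * real m) = \<i> * of_real (2 * pi * of_int (int m))"
      unfolding s by simp
    moreover have "int m \<noteq> - int n" "int m = int n \<longleftrightarrow> n = m" using assms(1) by auto
    ultimately show ?thesis by (simp only: 1) simp
  next
    assume s: "s = - 1"
    have "of_real s * \<i> * of_real (2 * pi * real m) = \<i> * of_real (2 * pi * of_int (- int m))"
      unfolding s by simp
    moreover have "- int m \<noteq> int n" "- int m = - int n \<longleftrightarrow> n = m" using assms(1) by auto
    ultimately show ?thesis by (simp only: 1) simp
  qed
qed

text \<open>(2 pi n)^2 is at least 2 n^2, and \<open>t\<close> takes away at most n^2. This crude
  bound suffices because only the order n^2 matters for the kernel.\<close>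

lemma norm_square_add_period_ge:
  fixes t :: complex
  assumes "norm t \<le> real n"
  shows "norm (t\<^sup>2 + of_real ((2 * pi * real n)\<^sup>2)) \<ge> (real n)\<^sup>2"
proof -
  have "norm (t\<^sup>2) \<le> (real n)\<^sup>2"
    using assms by (simp add: norm_power power_mono)
  moreover have "2 * (real n)\<^sup>2 \<le> (2 * pi * real n)\<^sup>2"
  proof -
    have "2\<^sup>2 \<le> (2 * pi)\<^sup>2" using pi_gt3 by (intro power_mono) auto
    hence "2 \<le> (2 * pi)\<^sup>2" by simp
    thus ?thesis by (simp add: power_mult_distrib mult_right_mono)
  qed
  moreover have "norm (complex_of_real ((2 * pi * real n)\<^sup>2)) = (2 * pi * real n)\<^sup>2"
    by (simp only: norm_of_real) simp
  ultimately show ?thesis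
    using norm_diff_ineq[of "of_real ((2 * pi * real n)\<^sup>2)" "t\<^sup>2"] by (simp add: add.commute)
qed

lemma exp_kernel_bound:
  assumes "norm t \<le> R" "real n \<ge> R" "n > 0"
  shows "norm (exp_kernel n t) \<le> 2 * R * (exp R + 1) / (real n)\<^sup>2"
proof -
  have R: "0 \<le> R" using assms(1) norm_ge_zero order_trans by blast
  have ge: "norm (t\<^sup>2 + of_real ((2 * pi * real n)\<^sup>2)) \<ge> (real n)\<^sup>2"
    using assms by (intro norm_square_add_period_ge) auto
  have n0: "(real n)\<^sup>2 > 0" using assms by simp
  hence nz: "t\<^sup>2 + of_real ((2 * pi * real n)\<^sup>2) \<noteq> 0" using ge by (metis norm_zero not_le)
  have "norm (exp t - 1) \<le> exp R + 1"
    using norm_triangle_ineq4[of "exp t" 1] norm_exp[of t] assms(1) by (smt (verit) exp_le_cancel_iff norm_one)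
  hence "norm (2 * t * (exp t - 1)) \<le> 2 * R * (exp R + 1)"
    using assms(1) R by (simp add: norm_mult mult_mono)
  thus ?thesis
    unfolding exp_kernel_nonpole[OF nz] norm_divide using ge n0 R
    by (intro frac_le) auto
qed

text \<open>The bound holds only eventually: the kernel estimate needs n to exceed the radius of the
  disc, and the finitely many earlier kernels may have nodes inside it.\<close>

lemma exp_kernel_series_bound:
  assumes "\<And>n t. norm t \<le> R \<Longrightarrow> norm (w n t) \<le> M n"
  shows "\<forall>\<^sub>F n in sequentially. \<forall>t\<in>cball 0 R. norm (w n t * exp_kernel (Suc n) t) \<le>
          2 * R * (exp R + 1) * (M n / (real (Suc n))\<^sup>2)"
proof -
  have "\<forall>\<^sub>F n in sequentially. real n \<ge> R"
    by (simp add: eventually_at_top_linorder) (meson le_nat_floor nle_le order_trans real_nat_ceiling_ge of_nat_mono)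
  thus ?thesis
  proof eventually_elim
    case (elim n)
    show ?case
    proof
      fix t :: complex assume t: "t \<in> cball 0 R"
      have "norm (exp_kernel (Suc n) t) \<le> 2 * R * (exp R + 1) / (real (Suc n))\<^sup>2"
        using t elim by (intro exp_kernel_bound) auto
      moreover have "norm (w n t) \<le> M n" using assms t by auto
      ultimately have "norm (w n t * exp_kernel (Suc n) t) \<le> M n * (2 * R * (exp R + 1) / (real (Suc n))\<^sup>2)"
        unfolding norm_mult by (intro mult_mono) (use norm_ge_zero order_trans in blast)+
      thus "norm (w n t * exp_kernel (Suc n) t) \<le> 2 * R * (exp R + 1) * (M n / (real (Suc n))\<^sup>2)"
        by (simp add: mult_ac)
    qed
  qed
qed

text \<open>Weierstrass M-test on discs around 0; the majorant \<open>M\<close> may change with the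
  radius. The kernels decay like 1 / n^2, so weights summable against 1 / n^2 are
  admissible.\<close>

lemma
  fixes w :: "nat \<Rightarrow> complex \<Rightarrow> complex"
  assumes "\<And>n. w n holomorphic_on UNIV"
  assumes "\<And>R. \<exists>M. summable (\<lambda>n. M n / (real (Suc n))\<^sup>2) \<and> (\<forall>n t. norm t \<le> R \<longrightarrow> norm (w n t) \<le> M n)"
  shows exp_kernel_series_holomorphic: "(\<lambda>t. \<Sum>n. w n t * exp_kernel (Suc n) t) holomorphic_on UNIV"
    and exp_kernel_series_summable: "summable (\<lambda>n. w n t * exp_kernel (Suc n) t)"
proof -
  have ev: "\<exists>N. summable N \<and> (\<forall>\<^sub>F n in sequentially. \<forall>t\<in>cball 0 R. norm (w n t * exp_kernel (Suc n) t) \<le> N n)" for R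
  proof -
    from assms(2)[of R] obtain M where M: "summable (\<lambda>n. M n / (real (Suc n))\<^sup>2)"
      "\<And>n t. norm t \<le> R \<Longrightarrow> norm (w n t) \<le> M n" by blast
    from exp_kernel_series_bound[of R w M, OF M(2)] summable_mult[OF M(1), of "2 * R * (exp R + 1)"]
    show ?thesis by blast
  qed
  show "(\<lambda>t. \<Sum>n. w n t * exp_kernel (Suc n) t) holomorphic_on UNIV"
  proof (rule holomorphic_uniform_sequence[of UNIV "\<lambda>n t. \<Sum>i<n. w i t * exp_kernel (Suc i) t"])
    show "(\<lambda>t. \<Sum>i<n. w i t * exp_kernel (Suc i) t) holomorphic_on UNIV" for n
      by (intro holomorphic_intros assms(1) exp_kernel_holomorphic)
  next
    fix x :: complex
    obtain N where N: "summable N" "\<forall>\<^sub>F n in sequentially. \<forall>t\<in>cball 0 (norm x + 1). norm (w n t * exp_kernel (Suc n) t) \<le> N n"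
      using ev by blast
    have "uniform_limit (cball 0 (norm x + 1)) (\<lambda>n t. \<Sum>i<n. w i t * exp_kernel (Suc i) t)
            (\<lambda>t. \<Sum>i. w i t * exp_kernel (Suc i) t) sequentially"
      by (rule Weierstrass_m_test_ev[OF N(2,1)])
    hence "uniform_limit (cball x 1) (\<lambda>n t. \<Sum>i<n. w i t * exp_kernel (Suc i) t)
            (\<lambda>t. \<Sum>i. w i t * exp_kernel (Suc i) t) sequentially"
      by (rule uniform_limit_on_subset) (simp add: cball_subset_cball_iff)
    thus "\<exists>d>0. cball x d \<subseteq> UNIV \<and> uniform_limit (cball x d) (\<lambda>n t. \<Sum>i<n. w i t * exp_kernel (Suc i) t)
            (\<lambda>t. \<Sum>i. w i t * exp_kernel (Suc i) t) sequentially"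
      by (intro exI[of _ 1]) auto
  qed auto
  obtain N where N: "summable N" "\<forall>\<^sub>F n in sequentially. \<forall>s\<in>cball 0 (norm t). norm (w n s * exp_kernel (Suc n) s) \<le> N n"
    using ev by blast
  show "summable (\<lambda>n. w n t * exp_kernel (Suc n) t)"
    by (rule summable_comparison_test_ev[OF eventually_mono[OF N(2)] N(1)]) auto
qed

text \<open>All kernels but one vanish at the node. The term of index n belongs to the node n + 1,
  hence the weight \<open>w (m - 1)\<close>.\<close>

lemma exp_kernel_series_at_pole:
  assumes "m > 0" "s = 1 \<or> s = - 1"
  defines "t \<equiv> of_real s * \<i> * of_real (2 * pi * real m)"
  shows "(\<Sum>n. w n t * exp_kernel (Suc n) t) = w (m - 1) t"
proof -
  have "(\<lambda>n. w n t * exp_kernel (Suc n) t) = (\<lambda>n. if n = m - 1 then w n t else 0)"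
    using assms(1) unfolding t_def by (subst exp_kernel_at_pole) (use assms in \<open>auto simp: fun_eq_iff\<close>)
  thus ?thesis using sums_unique[OF sums_single[of "m-1" "\<lambda>n. w n t"]] by simp
qed

section \<open>The even part of a power series on the imaginary axis\<close>

lemma sums_even_iff:
  fixes f :: "nat \<Rightarrow> 'a :: {t2_space, topological_comm_monoid_add}"
  shows "(\<lambda>n. if even n then f n else 0) sums s \<longleftrightarrow> (\<lambda>k. f (2 * k)) sums s"
proof -
  have "(\<lambda>k. if even (2 * k) then f (2 * k) else 0) sums s \<longleftrightarrow> (\<lambda>n. if even n then f n else 0) sums s"
  proof (rule sums_mono_reindex[where g = "\<lambda>k. 2 * k" and f = "\<lambda>n. if even n then f n else 0"])
    show "strict_mono (\<lambda>k::nat. 2 * k)" by (rule strict_monoI) simp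
    show "(if even n then f n else 0) = 0" if "n \<notin> range (\<lambda>k. 2 * k)" for n
      using that by (auto elim!: evenE)
  qed
  thus ?thesis by simp
qed

text \<open>Averaging over the two conjugate points kills the odd powers, since \<i>^n + (-\<i>)^n
  is 0 for odd n and 2 (-1)^(n/2) for even n. With \<open>b 0 = 0\<close> the sum may start at index
  2, which is the indexing of the theorem.\<close>

lemma power_series_even_part:
  fixes b :: "nat \<Rightarrow> complex" and x :: real
  assumes "\<And>z. (\<lambda>n. b n * z ^ n) sums F z" and b0: "b 0 = 0"
  shows "(\<lambda>k. (- 1) ^ Suc k * b (2 * Suc k) * of_real x ^ (2 * Suc k)) sums
           ((F (\<i> * of_real x) + F (- \<i> * of_real x)) / 2)"
proof -
  have i: "\<i> ^ n + (- \<i>) ^ n = (if even n then 2 * (- 1) ^ (n div 2) else 0)" for n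
  proof (cases "even n")
    case True then show ?thesis by (auto elim!: evenE simp: power_mult)
  next
    case False then show ?thesis by simp
  qed
  have "(\<lambda>n. b n * (\<i> * of_real x) ^ n + b n * (- \<i> * of_real x) ^ n) sums
          (F (\<i> * of_real x) + F (- \<i> * of_real x))"
    by (intro sums_add assms)
  also have "(\<lambda>n. b n * (\<i> * of_real x) ^ n + b n * (- \<i> * of_real x) ^ n) =
             (\<lambda>n. b n * of_real x ^ n * (\<i> ^ n + (- \<i>) ^ n))"
    by (simp only: power_mult_distrib) (simp add: fun_eq_iff algebra_simps)
  finally have "(\<lambda>n. b n * of_real x ^ n * (\<i> ^ n + (- \<i>) ^ n)) sums
          (F (\<i> * of_real x) + F (- \<i> * of_real x))" .
  hence "(\<lambda>n. if even n then 2 * (b n * of_real x ^ n * (- 1) ^ (n div 2)) else 0) sums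
          (F (\<i> * of_real x) + F (- \<i> * of_real x))"
    by (rule sums_cong[THEN iffD1, rotated]) (simp add: i)
  hence "(\<lambda>k. 2 * (b (2 * k) * of_real x ^ (2 * k) * (- 1) ^ k)) sums
          (F (\<i> * of_real x) + F (- \<i> * of_real x))"
    unfolding sums_even_iff by simp
  from sums_divide[OF this, of 2] have "(\<lambda>k. b (2 * k) * of_real x ^ (2 * k) * (- 1) ^ k) sums
          ((F (\<i> * of_real x) + F (- \<i> * of_real x)) / 2)"
    by simp
  hence "(\<lambda>k. b (2 * Suc k) * of_real x ^ (2 * Suc k) * (- 1) ^ Suc k) sums
          ((F (\<i> * of_real x) + F (- \<i> * of_real x)) / 2)"
    by (subst sums_Suc_iff) (simp add: b0)
  thus ?thesis by (simp add: mult_ac)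
qed

section \<open>Partial fractions and Bernoulli numbers\<close>

text \<open>Differentiate rGamma z * rGamma (1 - z) = sin (pi z) / pi in two ways and
  compare.\<close>

lemma Digamma_reflection:
  fixes z :: complex
  assumes "z \<notin> \<int>"
  shows "Digamma (1 - z) - Digamma z = of_real pi * cot (of_real pi * z)"
proof -
  have z1: "z \<notin> \<int>\<^sub>\<le>\<^sub>0" "1 - z \<notin> \<int>\<^sub>\<le>\<^sub>0"
    using assms nonpos_Ints_Int[of z] nonpos_Ints_Int[of "1-z"] Ints_diff[of 1 "1 - z"] by auto
  have nz: "rGamma z * rGamma (1 - z) \<noteq> 0"
    using z1 by (simp add: rGamma_eq_zero_iff)
  have "((\<lambda>z. rGamma z * rGamma (1 - z)) has_field_derivative
          (rGamma z * rGamma (1 - z)) * (Digamma (1 - z) - Digamma z)) (at z)"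
  proof -
    have "((\<lambda>z. rGamma (1 - z)) has_field_derivative (- rGamma (1 - z) * Digamma (1 - z)) * (0 - 1)) (at z)"
      by (rule DERIV_chain2[of rGamma]) (use z1 in \<open>auto intro!: derivative_eq_intros\<close>)
    from DERIV_mult'[OF has_field_derivative_rGamma_no_nonpos_int[OF z1(1)] this] show ?thesis
      by (rule DERIV_cong) (simp add: algebra_simps)
  qed
  moreover have "((\<lambda>z. rGamma z * rGamma (1 - z)) has_field_derivative cos (of_real pi * z)) (at z)"
    unfolding rGamma_reflection_complex by (auto intro!: derivative_eq_intros)
  ultimately have "(rGamma z * rGamma (1 - z)) * (Digamma (1 - z) - Digamma z) = cos (of_real pi * z)"
    by (rule DERIV_unique)
  thus ?thesis using nz unfolding rGamma_reflection_complex
    by (simp add: cot_def field_simps)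
qed

text \<open>Subtract the defining series of Digamma at 1 + z from the one at 1 - z; the constants
  cancel and the terms combine pairwise. The left side is then evaluated by the reflection formula,
  and the shift from 1 + z to z produces 1 / z.\<close>

lemma cot_partial_fractions:
  fixes z :: complex
  assumes z: "z \<notin> \<int>"
  shows "(\<lambda>k. 2 * z / (z\<^sup>2 - (of_nat (Suc k))\<^sup>2)) sums (of_real pi * cot (of_real pi * z) - 1 / z)"
proof -
  have z0: "z \<noteq> 0" "1 + z \<noteq> 0" "1 - z \<noteq> 0"
    using z by (auto simp: add_eq_0_iff)
  have sq: "(of_nat (Suc k))\<^sup>2 \<noteq> z\<^sup>2" for k
    using z by (metis Ints_minus Ints_of_nat minus_minus power2_eq_iff)
  have nz: "1 + z + of_nat k \<noteq> 0" "1 - z + of_nat k \<noteq> 0" for k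
  proof -
    have "(of_nat (Suc k))\<^sup>2 - z\<^sup>2 = (1 + z + of_nat k) * (1 - z + of_nat k)"
      by (simp add: power2_eq_square algebra_simps)
    thus "1 + z + of_nat k \<noteq> 0" "1 - z + of_nat k \<noteq> 0" using sq[of k] by auto
  qed
  have "(\<lambda>k. (inverse (of_nat (Suc k)) - inverse (1 - z + of_nat k)) -
             (inverse (of_nat (Suc k)) - inverse (1 + z + of_nat k))) sums
        ((Digamma (1 - z) + euler_mascheroni) - (Digamma (1 + z) + euler_mascheroni))"
    using summable_sums[OF summable_Digamma[OF z0(3)]] summable_sums[OF summable_Digamma[OF z0(2)]]
    unfolding Digamma_def diff_add_cancel by (intro sums_diff)
  also have "(\<lambda>k. (inverse (of_nat (Suc k)) - inverse (1 - z + of_nat k)) -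
             (inverse (of_nat (Suc k)) - inverse (1 + z + of_nat k))) =
             (\<lambda>k. 2 * z / (z\<^sup>2 - (of_nat (Suc k))\<^sup>2))"
  proof
    fix k
    define A where "A = 1 + z + of_nat k"
    define B where "B = 1 - z + of_nat k"
    have AB: "A \<noteq> 0" "B \<noteq> 0" using nz[of k] by (simp_all add: A_def B_def)
    have eqs: "z\<^sup>2 - (of_nat (Suc k))\<^sup>2 = - (A * B)" "2 * z = A - B"
      by (simp_all add: power2_eq_square algebra_simps A_def B_def)
    show "(inverse (of_nat (Suc k)) - inverse (1 - z + of_nat k)) -
             (inverse (of_nat (Suc k)) - inverse (1 + z + of_nat k)) = 2 * z / (z\<^sup>2 - (of_nat (Suc k))\<^sup>2)"
      unfolding eqs unfolding A_def[symmetric] B_def[symmetric] using AB by (simp add: field_simps)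
  qed
  also have "(Digamma (1 - z) + euler_mascheroni) - (Digamma (1 + z) + euler_mascheroni) =
      of_real pi * cot (of_real pi * z) - 1 / z"
    using Digamma_reflection[OF z] Digamma_plus1[OF z0(1)] by (simp add: algebra_simps)
  finally show ?thesis .
qed

text \<open>The cotangent expansion at z = s / (2 pi \<i>), multiplied by z. The right-hand side is
  s / (exp s - 1) without its Bernoulli terms of index 0 and 1; the bound on s ensures that z is not
  an integer.\<close>

lemma coth_partial_fractions:
  fixes s :: complex
  assumes "s \<noteq> 0" "norm s < 1"
  shows "(\<lambda>k. 2 * s\<^sup>2 / (s\<^sup>2 + of_real ((2 * pi * real (Suc k))\<^sup>2))) sums (inverse (exp_quot s) - 1 + s / 2)"
proof -
  define z where "z = s / (2 * of_real pi * \<i>)"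
  have s: "s = 2 * of_real pi * \<i> * z" by (simp add: z_def)
  have z0: "z \<noteq> 0" using assms by (simp add: z_def)
  have zn: "norm z < 1"
    using assms(2) pi_gt3 by (simp add: z_def norm_divide norm_mult divide_simps)
  have z: "z \<notin> \<int>"
  proof
    assume "z \<in> \<int>"
    then obtain i where "z = of_int i" by (auto elim: Ints_cases)
    with zn z0 show False by simp
  qed
  have e: "exp s = exp (\<i> * (of_real pi * z)) / exp (- (\<i> * (of_real pi * z)))"
    by (simp add: s exp_diff[symmetric] algebra_simps)
  have ne: "exp s \<noteq> 1"
  proof
    assume "exp s = 1"
    then obtain n :: int where "Im s = of_int (2 * n) * pi" "Re s = 0" by (auto simp: exp_eq_1)
    hence "s = 2 * of_real pi * \<i> * of_int n" by (simp add: complex_eq_iff)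
    hence "z = of_int n" by (simp add: s)
    with z show False by auto
  qed
  have cot: "of_real pi * cot (of_real pi * z) = of_real pi * \<i> * (exp s + 1) / (exp s - 1)"
  proof -
    define E where "E = exp (\<i> * (of_real pi * z))"
    have E: "E \<noteq> 0" "exp (- (\<i> * (of_real pi * z))) = inverse E"
      by (simp_all add: E_def exp_minus)
    have eE: "exp s = E\<^sup>2" unfolding e E(2) E_def[symmetric] using E(1) by (simp add: field_simps power2_eq_square)
    have "cot (of_real pi * z) = ((E + inverse E) / 2) / ((E - inverse E) / (2 * \<i>))"
      unfolding cot_def cos_exp_eq sin_exp_eq by (simp only: E(2) E_def[symmetric] mult_minus_left)
    also have "\<dots> = \<i> * (exp s + 1) / (exp s - 1)"
      using E(1) ne unfolding eE
      by (simp add: divide_simps power2_eq_square)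
    finally show ?thesis by simp
  qed
  have "(\<lambda>k. z * (2 * z / (z\<^sup>2 - (of_nat (Suc k))\<^sup>2))) sums (z * (of_real pi * cot (of_real pi * z) - 1 / z))"
    by (intro sums_mult cot_partial_fractions z)
  also have "(\<lambda>k. z * (2 * z / (z\<^sup>2 - (of_nat (Suc k))\<^sup>2))) =
             (\<lambda>k. 2 * s\<^sup>2 / (s\<^sup>2 + of_real ((2 * pi * real (Suc k))\<^sup>2)))"
  proof
    fix k
    have s2: "s\<^sup>2 = - (4 * of_real pi ^ 2) * z\<^sup>2" by (simp add: s power_mult_distrib)
    have "2 * s\<^sup>2 / (s\<^sup>2 + of_real ((2 * pi * real (Suc k))\<^sup>2)) =
        ((- (4 * of_real pi ^ 2)) * (2 * z\<^sup>2)) / ((- (4 * of_real pi ^ 2)) * (z\<^sup>2 - (of_nat (Suc k))\<^sup>2))"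
      unfolding s2 of_real_power of_real_mult of_real_of_nat_eq power_mult_distrib
      by (simp add: algebra_simps)
    also have "\<dots> = (2 * z\<^sup>2) / (z\<^sup>2 - (of_nat (Suc k))\<^sup>2)"
      by (rule mult_divide_mult_cancel_left) simp
    finally show "z * (2 * z / (z\<^sup>2 - (of_nat (Suc k))\<^sup>2)) = 2 * s\<^sup>2 / (s\<^sup>2 + of_real ((2 * pi * real (Suc k))\<^sup>2))"
      by (simp add: power2_eq_square)
  qed
  also have "z * (of_real pi * cot (of_real pi * z) - 1 / z) = inverse (exp_quot s) - 1 + s / 2"
  proof -
    have "z * (of_real pi * cot (of_real pi * z) - 1 / z) = s / 2 * ((exp s + 1) / (exp s - 1)) - 1"
      unfolding cot right_diff_distrib using z0 by (simp add: s mult_ac)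
    also have "\<dots> = s / (exp s - 1) - 1 + s / 2"
      using ne by (simp add: field_simps)
    finally show ?thesis using assms(1) by (simp add: exp_quot_def)
  qed
  finally show ?thesis .
qed

lemma bernoulli_number_fact: "bernoulli_number i / fact i = fps_nth (fps_X / (fps_exp 1 - 1)) i"
  by (simp add: bernoulli_number_def)

text \<open>Both follow by cancelling \<open>fps_X\<close> from
  \<open>fps_X * F = fps_exp 1 - 1\<close>. The quotient defining the Bernoulli numbers becomes a
  true inverse, so it is the expansion of \<open>inverse (exp_quot s)\<close>.\<close>

lemma exp_quot_fps: "exp_quot has_fps_expansion Abs_fps (\<lambda>n. 1 / fact (Suc n))"
  and bernoulli_fps: "fps_X / (fps_exp 1 - 1) = inverse (Abs_fps (\<lambda>n. 1 / fact (Suc n)) :: complex fps)"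
proof -
  let ?F = "Abs_fps (\<lambda>n. 1 / fact (Suc n)) :: complex fps"
  have XF: "fps_X * ?F = fps_exp 1 - 1"
    by (rule fps_ext) (auto simp: fps_X_mult_nth gr0_conv_Suc)
  have F0: "?F $ 0 \<noteq> 0" by simp
  let ?G = "fps_expansion exp_quot 0"
  have G: "exp_quot has_fps_expansion ?G"
    by (rule has_fps_expansion_fps_expansion[OF _ _ exp_quot_holomorphic]) auto
  have "(\<lambda>z. z * exp_quot z) has_fps_expansion fps_X * ?G"
    by (intro fps_expansion_intros G)
  moreover have "(\<lambda>z. exp z - 1) has_fps_expansion fps_exp (1::complex) - 1"
    using has_fps_expansion_exp[of "1::complex"] by (auto intro!: fps_expansion_intros)
  ultimately have "fps_X * ?G = fps_X * ?F"
    unfolding XF by (simp add: exp_quot_mult fps_expansion_unique_complex)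
  hence "?G = ?F" by simp
  with G show "exp_quot has_fps_expansion ?F" by simp
  have "fps_X = inverse ?F * (fps_X * ?F)"
    using inverse_mult_eq_1[OF F0] by (metis mult.assoc mult.commute mult_1)
  moreover have "fps_X * ?F \<noteq> 0" using F0 by (metis fps_nonzeroI fps_X_neq_zero mult_eq_0_iff fps_zero_nth)
  ultimately show "fps_X / (fps_exp 1 - 1) = inverse ?F"
    unfolding XF[symmetric] by (metis nonzero_mult_div_cancel_right)
qed

lemma bernoulli_number_0: "bernoulli_number 0 = 1"
  and bernoulli_number_1: "bernoulli_number 1 = - 1 / 2"
proof -
  let ?F = "Abs_fps (\<lambda>n. 1 / fact (Suc n)) :: complex fps"
  show "bernoulli_number 0 = 1" by (simp add: bernoulli_number_def bernoulli_fps)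
  show "bernoulli_number 1 = - 1 / 2"
    by (simp add: bernoulli_number_def bernoulli_fps fps_inverse_def)
qed

text \<open>The radius is not made explicit; it is only small enough for absolute convergence on the
  closed disc and for the partial fractions of \<open>coth_partial_fractions\<close>, which require
  modulus below 1. Absolute summability at \<open>r\<close> later dominates a double series.\<close>

lemma bernoulli_series:
  obtains r where "r > 0" "r < 1" "summable (\<lambda>i. norm (bernoulli_number i / fact i) * r ^ i)"
    "\<And>s. norm s \<le> r \<Longrightarrow> (\<lambda>i. bernoulli_number (i + 2) / fact (i + 2) * s ^ (i + 2)) sums
           (inverse (exp_quot s) - 1 + s / 2)"
proof -
  let ?F = "Abs_fps (\<lambda>n. 1 / fact (Suc n)) :: complex fps"
  let ?B = "fps_X / (fps_exp 1 - 1) :: complex fps"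
  have e: "(\<lambda>s. inverse (exp_quot s)) has_fps_expansion ?B"
    unfolding bernoulli_fps by (intro fps_expansion_intros exp_quot_fps) simp
  then obtain d where d: "d > 0" "\<And>s. norm s < d \<Longrightarrow> eval_fps ?B s = inverse (exp_quot s)"
    and c: "fps_conv_radius ?B > 0"
    unfolding has_fps_expansion_def eventually_nhds_metric by (auto simp: dist_norm)
  obtain r0 where r0: "0 < ereal r0" "ereal r0 < fps_conv_radius ?B"
    using c by (metis ereal_dense2 zero_ereal_def)
  define r where "r = min (min (d/2) (1/2)) r0"
  have r: "r > 0" "r < 1" "r < d" "ereal r < fps_conv_radius ?B"
    using d r0 by (auto simp: r_def min_def intro: le_less_trans[of _ "ereal r0"])
  have "summable (\<lambda>i. norm (fps_nth ?B i * of_real r ^ i))"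
    by (rule abs_summable_in_conv_radius) (use r in \<open>simp add: fps_conv_radius_def\<close>)
  hence sm: "summable (\<lambda>i. norm (bernoulli_number i / fact i) * r ^ i)"
    using r(1) by (simp add: bernoulli_number_fact norm_mult norm_power)
  have "(\<lambda>i. bernoulli_number (i + 2) / fact (i + 2) * s ^ (i + 2)) sums (inverse (exp_quot s) - 1 + s / 2)"
    if s: "norm s \<le> r" for s
  proof -
    have "ereal (norm s) < fps_conv_radius ?B" using s r(4) by (metis ereal_less_eq(3) le_less_trans)
    hence "(\<lambda>i. fps_nth ?B i * s ^ i) sums eval_fps ?B s"
      by (rule sums_eval_fps)
    also have "eval_fps ?B s = inverse (exp_quot s)" using d(2) s r(3) by simp
    finally have "(\<lambda>i. bernoulli_number i / fact i * s ^ i) sums inverse (exp_quot s)"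
      by (simp only: bernoulli_number_fact)
    hence "(\<lambda>i. bernoulli_number (i + 2) / fact (i + 2) * s ^ (i + 2)) sums
       (inverse (exp_quot s) - (\<Sum>i<2. bernoulli_number i / fact i * s ^ i))"
      by (rule sums_split_initial_segment)
    moreover have "inverse (exp_quot s) - (\<Sum>i<2. bernoulli_number i / fact i * s ^ i) = inverse (exp_quot s) - 1 + s / 2"
      by (simp add: numeral_2_eq_2 bernoulli_number_0 bernoulli_number_1[simplified])
    ultimately show ?thesis by (simp only:)
  qed
  with r sm show ?thesis using that by blast
qed

section \<open>Absolutely convergent double series\<close>

lemma double_series_summable:
  fixes f :: "nat \<times> nat \<Rightarrow> complex" and u v :: "nat \<Rightarrow> real"
  assumes "summable u" "summable v"
    and bound: "\<And>m n. norm (f (m, n)) \<le> u m * v n" and nonneg: "\<And>m. u m \<ge> 0" "\<And>n. v n \<ge> 0"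
  shows "f summable_on UNIV"
proof -
  have u: "u summable_on UNIV" and v: "v summable_on UNIV"
    using assms by (simp_all add: summable_on_UNIV_nonneg_real_iff)
  have "(\<lambda>(m, n). u m * v n) summable_on Sigma UNIV (\<lambda>_. UNIV)"
    using summable_on_SigmaI[where A = UNIV and B = "\<lambda>_. UNIV" and f = "\<lambda>(m, n). u m * v n" and g = "\<lambda>m. u m * infsum v UNIV"]
      has_sum_cmult_right[OF has_sum_infsum[OF v]] summable_on_cmult_left[OF u] nonneg by auto
  hence "(\<lambda>(m, n). u m * v n) summable_on UNIV" by simp
  hence "(\<lambda>x. norm (f x)) summable_on UNIV"
    by (rule summable_on_comparison_test) (use bound in auto)
  thus ?thesis by (rule abs_summable_summable)
qed

lemma double_series_rows:
  fixes f :: "nat \<times> nat \<Rightarrow> complex"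
  assumes "(f has_sum S) UNIV" "\<And>m. summable (\<lambda>n. norm (f (m, n)))" "\<And>m. (\<lambda>n. f (m, n)) sums g m"
  shows "g sums S"
proof -
  have "(f has_sum S) (Sigma UNIV (\<lambda>_. UNIV))" using assms(1) by simp
  hence "(g has_sum S) UNIV"
    by (rule has_sum_SigmaD) (use assms in \<open>auto intro: norm_summable_imp_has_sum\<close>)
  thus ?thesis by (rule has_sum_imp_sums)
qed

lemma double_series_columns:
  fixes f :: "nat \<times> nat \<Rightarrow> complex"
  assumes "(f has_sum S) UNIV" "\<And>n. summable (\<lambda>m. norm (f (m, n)))" "\<And>n. (\<lambda>m. f (m, n)) sums h n"
  shows "h sums S"
proof (rule double_series_rows)
  have "((\<lambda>(n, m). f (m, n)) has_sum S) (UNIV \<times> UNIV)"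
    using assms(1) by (subst has_sum_swap) simp
  thus "((\<lambda>(n, m). f (m, n)) has_sum S) UNIV" by simp
qed (use assms in auto)

text \<open>Group the pairs by their product N; the first factor then runs over the divisors of
  N.\<close>

lemma double_series_divisors:
  fixes w r :: "nat \<Rightarrow> complex"
  assumes "((\<lambda>(m, j). w (Suc m) * r (Suc m * Suc j)) has_sum S) UNIV"
  shows "(\<lambda>n. (\<Sum>d | d dvd Suc n. w d) * r (Suc n)) sums S"
proof -
  have "((\<lambda>(m, j). w (Suc m) * r (Suc m * Suc j)) has_sum S) UNIV \<longleftrightarrow>
        ((\<lambda>(n, d). w d * r (Suc n)) has_sum S) (Sigma UNIV (\<lambda>n. {d. d dvd Suc n}))"
  \<comment> \<open>All indices are shifted by one: the pair (m, j) goes to n = m * Suc j + j, for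
    which Suc n = Suc m * Suc j, together with the divisor Suc m.\<close>
  proof (rule has_sum_reindex_bij_witness[of _ "\<lambda>(n, d). (d - 1, Suc n div d - 1)" "\<lambda>(m, j). (m * Suc j + j, Suc m)"])
    have Suc_eq: "Suc (m * Suc j + j) = Suc m * Suc j" for m j by simp
    fix a :: "nat \<times> nat"
    obtain m j where a: "a = (m, j)" by force
    have "Suc m * Suc j div Suc m = Suc j" by (rule nonzero_mult_div_cancel_left) simp
    thus "(case case a of (m, j) \<Rightarrow> (m * Suc j + j, Suc m) of (n, d) \<Rightarrow> (d - 1, Suc n div d - 1)) = a"
      unfolding a prod.case Suc_eq by simp
    show "(case a of (m, j) \<Rightarrow> (m * Suc j + j, Suc m)) \<in> Sigma UNIV (\<lambda>n. {d. d dvd Suc n})"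
      unfolding a prod.case mem_Sigma_iff mem_Collect_eq Suc_eq by (intro conjI UNIV_I dvd_triv_left)
    show "(case case a of (m, j) \<Rightarrow> (m * Suc j + j, Suc m) of (n, d) \<Rightarrow> w d * r (Suc n)) =
       (case a of (m, j) \<Rightarrow> w (Suc m) * r (Suc m * Suc j))"
      unfolding a prod.case Suc_eq ..
  next
    fix b :: "nat \<times> nat" assume b: "b \<in> Sigma UNIV (\<lambda>n. {d. d dvd Suc n})"
    then obtain n d where nd: "b = (n, d)" "d dvd Suc n" by auto
    then obtain e where e: "Suc n = d * e" by (elim dvdE)
    have "d \<noteq> 0" "e \<noteq> 0" using e by (metis mult_0 nat.distinct(1)) (metis e mult_0_right nat.distinct(1))
    then obtain d' e' where de: "d = Suc d'" "e = Suc e'" by (metis not0_implies_Suc)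
    have "Suc n div d = Suc e'" unfolding e de by (rule nonzero_mult_div_cancel_left) simp
    thus "(case case b of (n, d) \<Rightarrow> (d - 1, Suc n div d - 1) of (m, j) \<Rightarrow> (m * Suc j + j, Suc m)) = b"
      unfolding nd(1) prod.case using e de by simp
  qed auto
  with assms have "((\<lambda>(n, d). w d * r (Suc n)) has_sum S) (Sigma UNIV (\<lambda>n. {d. d dvd Suc n}))"
    by simp
  hence "((\<lambda>n. \<Sum>d | d dvd Suc n. w d * r (Suc n)) has_sum S) UNIV"
    by (rule has_sum_SigmaD) (auto intro!: has_sum_finite)
  from has_sum_imp_sums[OF this] show ?thesis by (simp add: sum_distrib_right)
qed

lemma norm_nat_powr: "norm (of_nat (Suc m) powr a :: complex) = real (Suc m) powr Re a"
  by (subst norm_powr_real_powr) auto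

lemma summable_Suc_powr: "a < -1 \<Longrightarrow> summable (\<lambda>m. real (Suc m) powr a)"
  using summable_real_powr_iff[of a] summable_Suc_iff[of "\<lambda>m. real m powr a"] by simp

lemma summable_inverse_squares: "summable (\<lambda>j. 1 / (real (Suc j))\<^sup>2)"
  using inverse_power_summable[of 2, where 'a = real] summable_Suc_iff[of "\<lambda>j. inverse ((real j)\<^sup>2)"]
  by (simp add: divide_inverse)

lemma partial_fraction_bound:
  fixes t :: complex
  assumes "norm t \<le> 1" "n > 0"
  shows "norm (2 * t\<^sup>2 / (t\<^sup>2 + of_real ((2 * pi * real n)\<^sup>2))) \<le> 2 / (real n)\<^sup>2"
proof -
  have n: "real n \<ge> 1" using assms by simp
  have t2: "norm (t\<^sup>2) \<le> 1"
    using assms by (simp add: norm_power power_le_one)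
  have ge: "norm (t\<^sup>2 + of_real ((2 * pi * real n)\<^sup>2)) \<ge> (real n)\<^sup>2"
    using assms(1) n by (intro norm_square_add_period_ge) linarith
  show ?thesis unfolding norm_divide using ge n t2
    by (intro frac_le) (auto simp: norm_mult)
qed

text \<open>Two double series share the row sums \<open>w (Suc m) * g (t / Suc m)\<close> with g s =
  s / (exp s - 1) - 1 + s / 2: \<open>f\<close> expands g into partial fractions, \<open>h\<close>
  into its power series. Regrouping \<open>f\<close> by divisors gives the sigma series; summing
  \<open>h\<close> by columns gives the zeta values. Starting at i = 2 makes g vanish to second
  order, which compensates the weights m powr (1 - 2 q).\<close>

lemma zeta_power_series_eq_partial_fractions:
  fixes q t :: complex
  assumes q: "Re q > 0"
  shows "\<exists>r>0. \<forall>t. t \<noteq> 0 \<longrightarrow> norm t < r \<longrightarrow> (\<exists>S.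
     (\<lambda>n. divisor_sigma (1 - 2 * q) (Suc n) * (2 * t\<^sup>2 / (t\<^sup>2 + of_real ((2 * pi * real (Suc n))\<^sup>2)))) sums S \<and>
     (\<lambda>i. bernoulli_number (i + 2) / fact (i + 2) * riemann_zeta (2 * q - 1 + of_nat (i + 2)) * t ^ (i + 2)) sums S)"
proof -
  obtain r where r: "r > 0" "r < 1" "summable (\<lambda>i. norm (bernoulli_number i / fact i) * r ^ i)"
    and B: "\<And>s. norm s \<le> r \<Longrightarrow> (\<lambda>i. bernoulli_number (i + 2) / fact (i + 2) * s ^ (i + 2)) sums
           (inverse (exp_quot s) - 1 + s / 2)"
    using bernoulli_series by blast
  define b where "b i = bernoulli_number i / fact i" for i
  \<comment> \<open>The norm of the weight m powr (1 - 2 q) divided by m^2; the square is supplied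
    by the quadratic decay of the summands in t / m.\<close>
  define u where "u m = real (Suc m) powr (- 1 - 2 * Re q)" for m
  have u: "summable u" "\<And>m. u m \<ge> 0"
    unfolding u_def using q summable_Suc_powr[of "- 1 - 2 * Re q"] by auto
  define w where "w n = of_nat n powr (1 - 2 * q)" for n :: nat
  have w: "norm (w (Suc m)) = u m * real (Suc m) ^ 2" for m
  proof -
    have "real (Suc m) powr (1 - 2 * Re q) = real (Suc m) powr ((- 1 - 2 * Re q) + 2)" by simp
    also have "\<dots> = u m * real (Suc m) powr 2" unfolding u_def by (rule powr_add)
    also have "real (Suc m) powr 2 = real (Suc m) ^ 2" by (subst powr_numeral) auto
    finally show ?thesis unfolding w_def norm_nat_powr by simp
  qed
  show ?thesis
  proof (intro exI[of _ r] conjI allI impI)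
    fix t :: complex assume t: "t \<noteq> 0" "norm t < r"
    define p where "p n = 2 * t\<^sup>2 / (t\<^sup>2 + of_real ((2 * pi * real n)\<^sup>2))" for n :: nat
    define f where "f = (\<lambda>(m, j). w (Suc m) * p (Suc m * Suc j))"
    define g where "g s = inverse (exp_quot s) - 1 + s / 2" for s
    define h where "h = (\<lambda>(m, i). w (Suc m) * (b (i + 2) * (t / of_nat (Suc m)) ^ (i + 2)))"
    define v where "v j = 2 / (real (Suc j))\<^sup>2" for j
    have v: "summable v" "\<And>j. v j \<ge> 0"
      using summable_mult[OF summable_inverse_squares, of 2] by (simp_all add: v_def[abs_def])
    have fb: "norm (f (m, j)) \<le> u m * v j" for m j
    proof -
      have "norm (p (Suc m * Suc j)) \<le> 2 / (real (Suc m * Suc j))\<^sup>2"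
        unfolding p_def using t r(2) by (intro partial_fraction_bound) auto
      hence "norm (f (m, j)) \<le> u m * real (Suc m) ^ 2 * (2 / (real (Suc m * Suc j))\<^sup>2)"
        unfolding f_def prod.case norm_mult w using u(2)[of m] by (intro mult_left_mono mult_nonneg_nonneg) auto
      also have "\<dots> = u m * v j" unfolding v_def of_nat_mult power_mult_distrib
        by (simp add: field_simps del: of_nat_Suc)
      finally show ?thesis .
    qed
    have "f summable_on UNIV" by (rule double_series_summable[OF u(1) v(1) fb u(2) v(2)])
    then obtain S where S: "(f has_sum S) UNIV" by (auto simp: summable_on_def)
    have 1: "(\<lambda>n. divisor_sigma (1 - 2 * q) (Suc n) * p (Suc n)) sums S"
      using double_series_divisors[of w p S] S by (simp add: f_def divisor_sigma_def w_def)
    have small: "t / of_nat (Suc m) \<noteq> 0" "norm (t / of_nat (Suc m)) \<le> norm t" for m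
      using t divide_left_mono[of 1 "real (Suc m)" "norm t"] by (auto simp: norm_divide simp del: of_nat_Suc)
    have row: "(\<lambda>j. f (m, j)) sums (w (Suc m) * g (t / of_nat (Suc m)))" for m
    proof -
      have "p (Suc m * Suc j) = 2 * (t / of_nat (Suc m))\<^sup>2 / ((t / of_nat (Suc m))\<^sup>2 + of_real ((2 * pi * real (Suc j))\<^sup>2))" for j
      proof -
        define M :: complex where "M = of_nat (Suc m)"
        have M: "M \<noteq> 0" unfolding M_def by (simp only: of_nat_eq_0_iff)
        have "2 * (t / M)\<^sup>2 / ((t / M)\<^sup>2 + of_real ((2 * pi * real (Suc j))\<^sup>2)) =
              (M\<^sup>2 * (2 * (t / M)\<^sup>2)) / (M\<^sup>2 * ((t / M)\<^sup>2 + of_real ((2 * pi * real (Suc j))\<^sup>2)))"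
          using M by simp
        also have "\<dots> = 2 * t\<^sup>2 / (t\<^sup>2 + M\<^sup>2 * of_real ((2 * pi * real (Suc j))\<^sup>2))"
          using M by (simp add: power_divide ring_distribs)
        finally show ?thesis unfolding p_def M_def[symmetric] of_nat_mult
          unfolding M_def of_real_power of_real_mult of_real_of_nat_eq power_mult_distrib
          by (simp only: mult_ac)
      qed
      moreover have "(\<lambda>j. 2 * (t / of_nat (Suc m))\<^sup>2 / ((t / of_nat (Suc m))\<^sup>2 + of_real ((2 * pi * real (Suc j))\<^sup>2))) sums g (t / of_nat (Suc m))"
        unfolding g_def using small[of m] t(2) r(2) by (intro coth_partial_fractions) linarith+
      ultimately show ?thesis unfolding f_def by (simp only: prod.case) (rule sums_mult)
    qed
    have 2: "(\<lambda>m. w (Suc m) * g (t / of_nat (Suc m))) sums S"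
      by (rule double_series_rows[OF S _ row])
         (rule summable_comparison_test'[OF summable_mult[OF v(1)]], use fb in auto)
    define v' where "v' i = norm (b (i + 2)) * r ^ (i + 2)" for i
    have v': "summable v'" "\<And>i. v' i \<ge> 0"
      using summable_ignore_initial_segment[OF r(3), of 2] r(1)
      by (simp_all only: v'_def[abs_def] b_def) simp
    have hb: "norm (h (m, i)) \<le> u m * v' i" for m i
    proof -
      \<comment> \<open>Only two of the i + 2 factors 1 / m are kept, so that the majorant splits
        into a product of a term in m and a term in i.\<close>
      have "norm ((t / of_nat (Suc m)) ^ (i + 2)) \<le> r ^ (i + 2) / (real (Suc m))\<^sup>2"
      proof -
        have "norm ((t / of_nat (Suc m)) ^ (i + 2)) = norm (t / of_nat (Suc m)) ^ i * (norm t / real (Suc m))^2"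
          by (simp add: norm_power norm_divide norm_mult power_add power2_eq_square del: of_nat_Suc)
        also have "\<dots> \<le> r ^ i * (r / real (Suc m))^2"
          using small(2)[of m] t(2) r(1) by (intro mult_mono power_mono divide_right_mono) auto
        also have "\<dots> = r ^ (i + 2) / (real (Suc m))\<^sup>2" by (simp only: power_divide power_add times_divide_eq_right)
        finally show ?thesis .
      qed
      hence "norm (h (m, i)) \<le> u m * real (Suc m) ^ 2 * (norm (b (i + 2)) * (r ^ (i + 2) / (real (Suc m))\<^sup>2))"
        unfolding h_def using u(2)[of m] by (simp only: prod.case norm_mult w) (intro mult_left_mono; simp)
      also have "\<dots> = u m * v' i" by (simp add: v'_def del: of_nat_Suc)
      finally show ?thesis .
    qed
    have "h summable_on UNIV" by (rule double_series_summable[OF u(1) v'(1) hb u(2) v'(2)])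
    then obtain S' where S': "(h has_sum S') UNIV" by (auto simp: summable_on_def)
    have "(\<lambda>m. w (Suc m) * g (t / of_nat (Suc m))) sums S'"
    proof (rule double_series_rows[OF S'])
      show "summable (\<lambda>i. norm (h (m, i)))" for m
        by (rule summable_comparison_test'[OF summable_mult[OF v'(1)]]) (use hb in auto)
      show "(\<lambda>i. h (m, i)) sums (w (Suc m) * g (t / of_nat (Suc m)))" for m
        unfolding h_def g_def b_def prod.case
        using B[of "t / of_nat (Suc m)"] small(2)[of m] t(2) by (intro sums_mult B) linarith
    qed
    with 2 have S'_eq: "S' = S" by (rule sums_unique2[symmetric])
    have wsum: "summable (\<lambda>m. w (Suc m) / of_nat (Suc m) ^ (i + 2))" and
      zeta: "(\<Sum>m. w (Suc m) / of_nat (Suc m) ^ (i + 2)) = riemann_zeta (2 * q - 1 + of_nat (i + 2))" for i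
    proof -
      have "norm (w (Suc m) / of_nat (Suc m) ^ (i + 2)) \<le> u m" for m
      proof -
        have "norm (w (Suc m) / of_nat (Suc m) ^ (i + 2)) = u m / real (Suc m) ^ i"
          by (simp add: norm_divide norm_mult norm_power w power_add power2_eq_square del: of_nat_Suc)
        also have "\<dots> \<le> u m / 1" by (intro divide_left_mono) (use u(2) in auto)
        finally show ?thesis by simp
      qed
      thus "summable (\<lambda>m. w (Suc m) / of_nat (Suc m) ^ (i + 2))"
        by (intro summable_comparison_test'[OF u(1)])
      have "w (Suc m) / of_nat (Suc m) ^ (i + 2) = 1 / of_nat (Suc m) powr (2 * q - 1 + of_nat (i + 2))" for m
      proof -
        have "w (Suc m) / of_nat (Suc m) ^ (i + 2) = w (Suc m) / of_nat (Suc m) powr of_nat (i + 2)"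
          by (subst powr_nat') simp_all
        also have "\<dots> = of_nat (Suc m) powr ((1 - 2 * q) - of_nat (i + 2))"
          unfolding w_def by (rule powr_diff[symmetric])
        also have "(1 - 2 * q) - of_nat (i + 2) = - (2 * q - 1 + of_nat (i + 2))" by simp
        finally show ?thesis by (simp only: powr_minus divide_inverse mult_1)
      qed
      thus "(\<Sum>m. w (Suc m) / of_nat (Suc m) ^ (i + 2)) = riemann_zeta (2 * q - 1 + of_nat (i + 2))"
        unfolding riemann_zeta_def by simp
    qed
    have 3: "(\<lambda>i. b (i + 2) * riemann_zeta (2 * q - 1 + of_nat (i + 2)) * t ^ (i + 2)) sums S'"
    proof (rule double_series_columns[OF S'])
      show "summable (\<lambda>m. norm (h (m, i)))" for i
        by (rule summable_comparison_test'[OF summable_mult2[OF u(1)]]) (use hb in auto)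
      show "(\<lambda>m. h (m, i)) sums (b (i + 2) * riemann_zeta (2 * q - 1 + of_nat (i + 2)) * t ^ (i + 2))" for i
        using sums_mult[OF summable_sums[OF wsum[of i]], of "b (i + 2) * t ^ (i + 2)"]
        by (simp only: zeta h_def prod.case power_divide) (simp only: mult_ac times_divide_eq_right)
    qed
    show "\<exists>S. (\<lambda>n. divisor_sigma (1 - 2 * q) (Suc n) * (2 * t\<^sup>2 / (t\<^sup>2 + of_real ((2 * pi * real (Suc n))\<^sup>2)))) sums S \<and>
     (\<lambda>i. bernoulli_number (i + 2) / fact (i + 2) * riemann_zeta (2 * q - 1 + of_nat (i + 2)) * t ^ (i + 2)) sums S"
      using 1 3 unfolding S'_eq p_def b_def by blast
  qed (rule r(1))
qed

section \<open>The divisor function\<close>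

text \<open>As a Dirichlet series, the sum of sigma \<alpha> n / n^2 is the product of the sums of m
  powr (\<alpha> - 2) and of 1 / j^2. The real powers are embedded in the complex numbers only to
  reuse \<open>double_series_divisors\<close>.\<close>

lemma divisor_sigma_summable:
  assumes "Re \<alpha> < 1"
  shows "summable (\<lambda>n. norm (divisor_sigma \<alpha> (Suc n)) / (real (Suc n))\<^sup>2)"
proof -
  define w where "w d = complex_of_real (real d powr Re \<alpha>)" for d :: nat
  define r where "r n = complex_of_real (1 / (real n)\<^sup>2)" for n :: nat
  have r_mult: "r (m * n) = r m * r n" for m n
    by (simp add: r_def power_mult_distrib)
  define f where "f = (\<lambda>(m, j). w (Suc m) * r (Suc m * Suc j))"
  have "f summable_on UNIV"
  proof (rule double_series_summable)
    show "summable (\<lambda>m. real (Suc m) powr (Re \<alpha> - 2))"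
      using assms by (intro summable_Suc_powr) simp
    show "summable (\<lambda>j. 1 / (real (Suc j))\<^sup>2)" by (rule summable_inverse_squares)
    fix m j
    have "real (Suc m) powr (Re \<alpha> - 2) = real (Suc m) powr Re \<alpha> / (real (Suc m))\<^sup>2"
      by (subst powr_diff, subst powr_numeral) auto
    thus "norm (f (m, j)) \<le> real (Suc m) powr (Re \<alpha> - 2) * (1 / (real (Suc j))\<^sup>2)"
      unfolding f_def prod.case r_mult norm_mult unfolding w_def r_def norm_of_real by simp
  qed auto
  then obtain S where "(f has_sum S) UNIV" by (auto simp: summable_on_def)
  hence "(\<lambda>n. (\<Sum>d | d dvd Suc n. w d) * r (Suc n)) sums S"
    unfolding f_def by (rule double_series_divisors)
  hence "summable (\<lambda>n. complex_of_real ((\<Sum>d | d dvd Suc n. real d powr Re \<alpha>) * (1 / (real (Suc n))\<^sup>2)))"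
    by (auto simp: sums_iff w_def r_def)
  hence "summable (\<lambda>n. (\<Sum>d | d dvd Suc n. real d powr Re \<alpha>) * (1 / (real (Suc n))\<^sup>2))"
    by (simp only: summable_complex_of_real)
  thus ?thesis
  proof (rule summable_comparison_test'[where N = 0])
    fix n
    have "norm (divisor_sigma \<alpha> (Suc n)) \<le> (\<Sum>d | d dvd Suc n. real d powr Re \<alpha>)"
      unfolding divisor_sigma_def by (rule order_trans[OF norm_sum sum_mono]) (simp add: norm_powr_real_powr)
    thus "norm (norm (divisor_sigma \<alpha> (Suc n)) / (real (Suc n))\<^sup>2) \<le> (\<Sum>d | d dvd Suc n. real d powr Re \<alpha>) * (1 / (real (Suc n))\<^sup>2)"
      by (simp add: divide_right_mono)
  qed
qed

text \<open>The involution sending a divisor d to n / d.\<close>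

lemma divisor_sigma_uminus:
  assumes "n > 0"
  shows "divisor_sigma \<alpha> n = of_nat n powr \<alpha> * divisor_sigma (- \<alpha>) n"
proof -
  have "divisor_sigma \<alpha> n = (\<Sum>d | d dvd n. of_nat (n div d) powr \<alpha>)"
    unfolding divisor_sigma_def
    by (rule sum.reindex_bij_witness[of _ "\<lambda>d. n div d" "\<lambda>d. n div d"]) (use assms in auto)
  also have "\<dots> = (\<Sum>d | d dvd n. of_nat n powr \<alpha> * of_nat d powr (- \<alpha>))"
  proof (rule sum.cong)
    fix d assume "d \<in> {d. d dvd n}"
    then obtain e where e: "n = d * e" by (auto elim: dvdE)
    with assms have d: "d > 0" "e > 0" by auto
    have "of_nat n powr \<alpha> = (of_nat d powr \<alpha> * of_nat e powr \<alpha> :: complex)"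
      unfolding e of_nat_mult
      using powr_times_real[of "of_nat d" "of_nat e" \<alpha>] by simp
    thus "of_nat (n div d) powr \<alpha> = of_nat n powr \<alpha> * (of_nat d powr (- \<alpha>) :: complex)"
      using d by (simp add: e powr_minus field_simps)
  qed simp
  finally show ?thesis by (simp add: sum_distrib_left divisor_sigma_def)
qed

definition divisor_entire :: "complex \<Rightarrow> complex \<Rightarrow> complex" where
  "divisor_entire q t = (\<Sum>n. divisor_sigma (1 - 2 * q) (Suc n) * exp_kernel (Suc n) t)"

lemma divisor_entire_hyp:
  assumes "Re q > 0"
  shows "\<exists>M. summable (\<lambda>n. M n / (real (Suc n))\<^sup>2) \<and>
     (\<forall>n t. norm t \<le> R \<longrightarrow> norm (divisor_sigma (1 - 2 * q) (Suc n)) \<le> M n)"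
  using divisor_sigma_summable[of "1 - 2 * q"] assms
  by (intro exI[of _ "\<lambda>n. norm (divisor_sigma (1 - 2 * q) (Suc n))"]) auto

lemma divisor_entire_holomorphic: "Re q > 0 \<Longrightarrow> divisor_entire q holomorphic_on UNIV"
  unfolding divisor_entire_def[abs_def]
  by (rule exp_kernel_series_holomorphic[OF holomorphic_on_const divisor_entire_hyp])

text \<open>Near 0, t times the kernel series equals (exp t - 1) times the zeta-weighted Bernoulli
  series \<open>Z\<close>. Comparing coefficients of t^(k + 1) gives a Cauchy product in which 1 /
  (i! (k + 1 - i)!) is a binomial coefficient over (k + 1)!, as in \<open>A_tilde\<close>.\<close>

lemma divisor_entire_coeff:
  assumes q: "Re q > 0"
  shows "fps_nth (fps_expansion (divisor_entire q) 0) k = A_tilde k q / fact k"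
proof -
  obtain r where r: "r > 0" and S: "\<forall>t. t \<noteq> 0 \<longrightarrow> norm t < r \<longrightarrow> (\<exists>S.
     (\<lambda>n. divisor_sigma (1 - 2 * q) (Suc n) * (2 * t\<^sup>2 / (t\<^sup>2 + of_real ((2 * pi * real (Suc n))\<^sup>2)))) sums S \<and>
     (\<lambda>i. bernoulli_number (i + 2) / fact (i + 2) * riemann_zeta (2 * q - 1 + of_nat (i + 2)) * t ^ (i + 2)) sums S)"
    using zeta_power_series_eq_partial_fractions[OF q] by (elim exE conjE)
  define Z where "Z = Abs_fps (\<lambda>i. if i < 2 then 0 else bernoulli_number i / fact i * riemann_zeta (2 * q - 1 + of_nat i))"
  have Z: "(\<lambda>i. fps_nth Z i * t ^ i) sums s \<longleftrightarrow>
     (\<lambda>i. bernoulli_number (i + 2) / fact (i + 2) * riemann_zeta (2 * q - 1 + of_nat (i + 2)) * t ^ (i + 2)) sums s" for t s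
    by (subst sums_iff_shift'[where n = 2, symmetric]) (simp add: Z_def numeral_2_eq_2)
  \<comment> \<open>Convergence at the single nonzero point r / 2 bounds the radius of convergence
    from below.\<close>
  have Zr: "fps_conv_radius Z > 0"
  proof -
    have "complex_of_real (r / 2) \<noteq> 0" "norm (complex_of_real (r / 2)) < r" using r by auto
    from S[rule_format, OF this] obtain s where "(\<lambda>i. fps_nth Z i * of_real (r / 2) ^ i) sums s" unfolding Z by blast
    hence "summable (\<lambda>i. fps_nth Z i * of_real (r / 2) ^ i)" by (rule sums_summable)
    from conv_radius_geI[OF this] have "fps_conv_radius Z \<ge> ereal (r / 2)"
      using r by (simp add: fps_conv_radius_def)
    with r show ?thesis by (metis ereal_less(2) half_gt_zero less_le_trans)
  qed
  have G: "divisor_entire q has_fps_expansion fps_expansion (divisor_entire q) 0"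
    by (rule has_fps_expansion_fps_expansion[OF _ _ divisor_entire_holomorphic[OF q]]) auto
  hence "(\<lambda>t. t * divisor_entire q t) has_fps_expansion fps_X * fps_expansion (divisor_entire q) 0"
    by (intro fps_expansion_intros)
  moreover have "(\<lambda>t. t * divisor_entire q t) has_fps_expansion Z * (fps_exp 1 - 1)"
  proof -
    have eq: "eval_fps Z t * (exp t - 1) = t * divisor_entire q t" if t: "norm t < min r 1" for t
    proof (cases "t = 0")
      case True thus ?thesis by simp
    next
      case False
      from t have t': "norm t < r" "norm t < 1" by auto
      from S[rule_format, OF False t'(1)] obtain s where s: "(\<lambda>n. divisor_sigma (1 - 2 * q) (Suc n) * (2 * t\<^sup>2 / (t\<^sup>2 + of_real ((2 * pi * real (Suc n))\<^sup>2)))) sums s"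
        "(\<lambda>i. fps_nth Z i * t ^ i) sums s" unfolding Z by blast
      have kern: "t * exp_kernel (Suc n) t = (exp t - 1) * (2 * t\<^sup>2 / (t\<^sup>2 + of_real ((2 * pi * real (Suc n))\<^sup>2)))" for n
      proof -
        \<comment> \<open>In the unit disc there is no node: all of them have modulus at least 2
          pi.\<close>
        have "t\<^sup>2 + of_real ((2 * pi * real (Suc n))\<^sup>2) \<noteq> 0"
        proof
          assume "t\<^sup>2 + of_real ((2 * pi * real (Suc n))\<^sup>2) = 0"
          hence "norm (t\<^sup>2) = norm (complex_of_real ((2 * pi * real (Suc n))\<^sup>2))"
            by (metis add_eq_0_iff norm_minus_cancel)
          hence "norm (t\<^sup>2) = (2 * pi * real (Suc n))\<^sup>2" by (simp only: norm_of_real) simp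
          hence "(norm t)\<^sup>2 = (2 * pi * real (Suc n))\<^sup>2" by (simp only: norm_power)
          hence "norm t = 2 * pi * real (Suc n)" by (rule power2_eq_imp_eq) auto
          moreover have "2 * pi * real (Suc n) \<ge> 2 * pi * 1" by (intro mult_left_mono) auto
          ultimately show False using t' pi_gt3 by linarith
        qed
        thus ?thesis by (subst exp_kernel_nonpole) (auto simp: power2_eq_square)
      qed
      have "t * (divisor_sigma (1 - 2 * q) (Suc n) * exp_kernel (Suc n) t) =
        (exp t - 1) * (divisor_sigma (1 - 2 * q) (Suc n) * (2 * t\<^sup>2 / (t\<^sup>2 + of_real ((2 * pi * real (Suc n))\<^sup>2))))" for n
        unfolding mult.left_commute[of t] mult.left_commute[of "exp t - 1"] kern ..
      with sums_mult[OF s(1), of "exp t - 1"]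
      have "(\<lambda>n. t * (divisor_sigma (1 - 2 * q) (Suc n) * exp_kernel (Suc n) t)) sums ((exp t - 1) * s)"
        by (simp only:)
      moreover have "(\<lambda>n. t * (divisor_sigma (1 - 2 * q) (Suc n) * exp_kernel (Suc n) t)) sums (t * divisor_entire q t)"
        unfolding divisor_entire_def using q
        by (intro sums_mult summable_sums exp_kernel_series_summable[OF holomorphic_on_const divisor_entire_hyp])
      ultimately have "t * divisor_entire q t = (exp t - 1) * s" by (rule sums_unique2[symmetric])
      moreover have "eval_fps Z t = s" using s(2) by (simp add: eval_fps_def sums_iff)
      ultimately show ?thesis by (simp add: mult.commute)
    qed
    have e: "(\<lambda>t. eval_fps Z t * (exp t - 1)) has_fps_expansion Z * (fps_exp 1 - 1)"
      using has_fps_expansion_exp[of "1::complex"]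
      by (intro has_fps_expansion_mult has_fps_expansion_diff eval_fps_has_fps_expansion Zr) auto
    have "eventually (\<lambda>t. eval_fps Z t * (exp t - 1) = t * divisor_entire q t) (nhds 0)"
      unfolding eventually_nhds_metric using r by (intro exI[of _ "min r 1"]) (auto simp: dist_norm intro!: eq)
    from has_fps_expansion_cong[OF this refl] e show ?thesis by simp
  qed
  ultimately have "fps_X * fps_expansion (divisor_entire q) 0 = Z * (fps_exp 1 - 1)"
    by (rule fps_expansion_unique_complex)
  hence "fps_nth (fps_X * fps_expansion (divisor_entire q) 0) (Suc k) = fps_nth (Z * (fps_exp 1 - 1)) (Suc k)" by simp
  hence "fps_nth (fps_expansion (divisor_entire q) 0) k = (\<Sum>i = 0..Suc k. fps_nth Z i * fps_nth (fps_exp 1 - 1) (Suc k - i))"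
    by (simp only: fps_mult_nth[of Z] fps_X_mult_nth) simp
  \<comment> \<open>The terms i = 0, 1 vanish because \<open>Z\<close> starts at 2; the term i = Suc
    k meets the zero constant coefficient of exp - 1.\<close>
  also have "\<dots> = (\<Sum>i = 2..k. fps_nth Z i * fps_nth (fps_exp 1 - 1) (Suc k - i))"
    by (rule sum.mono_neutral_right) (auto simp: Z_def)
  also have "\<dots> = (\<Sum>i = 2..k. of_nat ((k + 1) choose i) * bernoulli_number i *
        riemann_zeta (2 * q - 1 + of_nat i) / (of_nat (k + 1) * fact k))"
  proof (rule sum.cong)
    fix i assume "i \<in> {2..k}"
    hence i: "2 \<le> i" "i \<le> k" by auto
    have "of_nat ((k + 1) choose i) = (fact (k + 1) / (fact i * fact (k + 1 - i)) :: complex)"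
      using i by (intro binomial_fact) simp
    moreover have fk: "of_nat (k + 1) * fact k = (fact (k + 1) :: complex)" by simp
    ultimately have "of_nat ((k + 1) choose i) / (of_nat (k + 1) * fact k) = (1 / (fact i * fact (k + 1 - i)) :: complex)"
      unfolding fk using fact_nonzero[of "k + 1", where 'a = complex] by (metis divide_divide_eq_left divide_self mult.commute)
    thus "fps_nth Z i * fps_nth (fps_exp 1 - 1) (Suc k - i) = of_nat ((k + 1) choose i) * bernoulli_number i *
        riemann_zeta (2 * q - 1 + of_nat i) / (of_nat (k + 1) * fact k)"
      unfolding fk using i by (simp add: Z_def divide_inverse mult_ac)
  qed simp
  also have "\<dots> = A_tilde k q / fact k"
    by (simp add: A_tilde_def sum_divide_distrib)
  finally show ?thesis .
qed

text \<open>Both nodes 2 pi \<i> n and -2 pi \<i> n give sigma (1 - 2 q) n, so this is also their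
  mean, the value of the even part; \<open>divisor_sigma_uminus\<close> changes the sign of the
  exponent.\<close>

lemma divisor_sigma_series:
  fixes q :: complex and n :: nat
  assumes q: "Re q > 0" and n: "n \<ge> 1"
  defines "b \<equiv> (\<lambda>k. (-1) ^ Suc k * A_tilde (2 * Suc k) q / fact (2 * Suc k) * of_real (2 * pi * real n) ^ (2 * Suc k))"
  shows "summable b" and "divisor_sigma (2 * q - 1) n = of_nat n powr (2 * q - 1) * suminf b"
proof -
  have sums: "(\<lambda>k. A_tilde k q / fact k * z ^ k) sums divisor_entire q z" for z
  proof -
    have h: "divisor_entire q holomorphic_on eball 0 \<infinity>"
      using divisor_entire_holomorphic[OF q] by (rule holomorphic_on_subset) auto
    have "fps_conv_radius (fps_expansion (divisor_entire q) 0) \<ge> \<infinity>"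
      by (rule conv_radius_fps_expansion[OF h])
    hence "(\<lambda>k. fps_nth (fps_expansion (divisor_entire q) 0) k * z ^ k) sums eval_fps (fps_expansion (divisor_entire q) 0) z"
      by (intro sums_eval_fps) auto
    also have "eval_fps (fps_expansion (divisor_entire q) 0) z = divisor_entire q z"
      using eval_fps_expansion[OF h, of z] by simp
    finally show ?thesis by (simp only: divisor_entire_coeff[OF q])
  qed
  have "A_tilde 0 q / fact 0 = 0" by (simp add: A_tilde_def)
  from power_series_even_part[of "\<lambda>k. A_tilde k q / fact k", OF sums this, of "2 * pi * real n"]
  have "b sums ((divisor_entire q (\<i> * of_real (2 * pi * real n)) + divisor_entire q (- \<i> * of_real (2 * pi * real n))) / 2)"
    unfolding b_def times_divide_eq_right .
  moreover have "divisor_entire q (\<i> * of_real (2 * pi * real n)) = divisor_sigma (1 - 2 * q) n"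
                "divisor_entire q (- \<i> * of_real (2 * pi * real n)) = divisor_sigma (1 - 2 * q) n"
    using exp_kernel_series_at_pole[of n 1 "\<lambda>n _. divisor_sigma (1 - 2 * q) (Suc n)"]
     exp_kernel_series_at_pole[of n "-1" "\<lambda>n _. divisor_sigma (1 - 2 * q) (Suc n)"] n
    by (simp_all add: divisor_entire_def)
  ultimately have "b sums divisor_sigma (1 - 2 * q) n" by simp
  moreover have "divisor_sigma (2 * q - 1) n = of_nat n powr (2 * q - 1) * divisor_sigma (1 - 2 * q) n"
    using divisor_sigma_uminus[of n "2 * q - 1"] n by simp
  ultimately show "summable b" "divisor_sigma (2 * q - 1) n = of_nat n powr (2 * q - 1) * suminf b"
    by (auto simp: sums_iff)
qed

section \<open>The modified Bessel function\<close>

text \<open>\<open>absolutely_integrable_on\<close> refers to the completed measure, the Bessel and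
  phi integrals to \<open>lborel\<close>; Borel measurability is what allows the descent.\<close>

lemma set_integrable_lborel_of_absolutely:
  fixes f :: "real \<Rightarrow> 'a :: euclidean_space"
  assumes "f absolutely_integrable_on S" "set_borel_measurable borel S f"
  shows "set_integrable lborel S f"
proof -
  have "integrable (completion lborel) (\<lambda>x. indicator S x *\<^sub>R f x)"
    using assms(1) by (simp add: set_integrable_def)
  thus ?thesis
    using assms(2) by (subst (asm) integrable_completion) (auto simp: set_integrable_def set_borel_measurable_def)
qed

lemma set_integrable_exp_mult_minus:
  assumes "a > 0"
  shows "set_integrable lborel {0<..} (\<lambda>t::real. exp (- a * t))"
proof (rule set_integrable_subset)
  show "set_integrable lborel {0..} (\<lambda>t::real. exp (- a * t))"
  proof (rule set_integrable_lborel_of_absolutely)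
    show "(\<lambda>t::real. exp (- a * t)) absolutely_integrable_on {0..}"
      using integrable_on_exp_minus_to_infinity[OF assms, of 0] by (intro nonnegative_absolutely_integrable_1) auto
  qed (auto simp: set_borel_measurable_def)
qed auto

lemma set_integrable_exp_minus: "set_integrable lborel {0<..} (\<lambda>t::real. exp (- t))"
  using set_integrable_exp_mult_minus[of 1] by simp

lemma set_borel_measurable_continuous_greaterThan:
  fixes f :: "real \<Rightarrow> 'a :: {real_normed_vector, second_countable_topology}"
  assumes "continuous_on {a<..} f"
  shows "set_borel_measurable lborel {a<..} f"
  using borel_measurable_continuous_on_indicator[OF _ assms] by (simp add: set_borel_measurable_def)

lemma set_dominated_convergence_at_top:
  fixes s :: "real \<Rightarrow> real \<Rightarrow> 'a :: {banach, second_countable_topology}" and w :: "real \<Rightarrow> real"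
  assumes "\<And>y. set_borel_measurable lborel A (s y)" "set_borel_measurable lborel A f"
    and "set_integrable lborel A w"
    and "\<And>x. x \<in> A \<Longrightarrow> ((\<lambda>y. s y x) \<longlongrightarrow> f x) at_top"
    and "\<forall>\<^sub>F y in at_top. \<forall>x\<in>A. norm (s y x) \<le> w x"
  shows "((\<lambda>y. LINT x:A|lborel. s y x) \<longlongrightarrow> (LINT x:A|lborel. f x)) at_top"
  unfolding set_lebesgue_integral_def
proof (rule integral_dominated_convergence_at_top)
  show "integrable lborel (\<lambda>x. indicator A x *\<^sub>R w x)" using assms(3) by (simp add: set_integrable_def)
  show "\<forall>\<^sub>F y in at_top. AE x in lborel. norm (indicator A x *\<^sub>R s y x) \<le> indicator A x *\<^sub>R w x"
    using assms(5) by eventually_elim (auto simp: indicator_def)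
  show "AE x in lborel. ((\<lambda>y. indicator A x *\<^sub>R s y x) \<longlongrightarrow> indicator A x *\<^sub>R f x) at_top"
    using assms(4) by (auto simp: indicator_def)
qed (use assms in \<open>auto simp: set_borel_measurable_def\<close>)

section \<open>Integrals against exp (- x * cosh t)\<close>

lemma sinh_real_ge: "x \<ge> 0 \<Longrightarrow> sinh x \<ge> (x :: real)"
proof -
  assume x: "x \<ge> 0"
  have "sinh 0 - 0 \<le> sinh x - x"
    by (rule DERIV_nonneg_imp_nondecreasing[OF x, of "\<lambda>x. sinh x - x"])
       (auto intro!: exI derivative_eq_intros simp: cosh_real_ge_1)
  thus ?thesis by simp
qed

lemma cosh_minus_one: "cosh x - 1 = 2 * (sinh (x / 2))\<^sup>2" for x :: real
  using cosh_double[of "x/2"] cosh_square_eq[of "x/2"] by simp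

lemma cosh_real_ge: "cosh x \<ge> 1 + x\<^sup>2 / 2" for x :: real
proof -
  have "(\<bar>x\<bar> / 2)\<^sup>2 \<le> (sinh (\<bar>x\<bar> / 2))\<^sup>2" by (intro power_mono sinh_real_ge) auto
  thus ?thesis using cosh_minus_one[of "\<bar>x\<bar>"] by (simp add: power_divide)
qed

lemma norm_cosh_le_cosh: "norm (cosh z) \<le> cosh (Re z)"
  and norm_sinh_le_cosh: "norm (sinh z) \<le> cosh (Re z)" for z :: complex
  using norm_triangle_ineq[of "exp z" "exp (- z)"] norm_triangle_ineq4[of "exp z" "exp (- z)"]
  by (simp_all add: cosh_field_def sinh_field_def norm_divide)

lemma cosh_le_exp_abs: "cosh x \<le> exp \<bar>x\<bar>" for x :: real
  by (simp add: cosh_field_def abs_if)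

text \<open>From cosh t >= 1 + t^2 / 2 by completing the square. The shift from m to m + 1 leaves a
  factor exp (- t) over, which makes the bound integrable.\<close>

lemma exp_cosh_le:
  fixes x m t :: real
  assumes "x > 0" "t \<ge> 0"
  shows "exp (- x * cosh t) * exp (m * t) \<le> exp ((m + 1)\<^sup>2 / (2 * x)) * exp (- t)"
proof -
  have "x * cosh t \<ge> x * (1 + t\<^sup>2 / 2)" using assms cosh_real_ge by (intro mult_left_mono) auto
  moreover have "x * t\<^sup>2 / 2 - (m + 1) * t + (m + 1)\<^sup>2 / (2 * x) = (x * t - (m + 1))\<^sup>2 / (2 * x)"
    using assms by (simp add: power2_eq_square field_simps)
  moreover have "(x * t - (m + 1))\<^sup>2 / (2 * x) \<ge> 0" using assms by simp
  moreover have "(m + 1) * t = m * t + t" "x * (1 + t\<^sup>2 / 2) = x + x * t\<^sup>2 / 2" by (simp_all add: algebra_simps)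
  ultimately have "- x * cosh t + m * t \<le> (m + 1)\<^sup>2 / (2 * x) - t"
    using assms by linarith
  thus ?thesis by (simp flip: exp_add exp_diff)
qed

lemma exp_cosh_integrable:
  fixes p :: "real \<Rightarrow> complex"
  assumes "x > 0" "continuous_on {0<..} p" "\<And>t. t > 0 \<Longrightarrow> norm (p t) \<le> B * exp (m * t)"
  shows "set_integrable lborel {0<..} (\<lambda>t. of_real (exp (- x * cosh t)) * p t)"
proof (rule set_integrable_bound)
  show "set_integrable lborel {0<..} (\<lambda>t::real. (B * exp ((m + 1)\<^sup>2 / (2 * x))) * exp (- t))"
    using set_integrable_exp_minus by (rule set_integrable_mult_right)
  show "set_borel_measurable lborel {0<..} (\<lambda>t. of_real (exp (- x * cosh t)) * p t)"
    by (intro set_borel_measurable_continuous_greaterThan continuous_intros assms)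
  show "AE t in lborel. t \<in> {0<..} \<longrightarrow> norm (of_real (exp (- x * cosh t)) * p t) \<le> norm (B * exp ((m + 1)\<^sup>2 / (2 * x)) * exp (- t))"
  proof (intro AE_I2 impI)
    fix t :: real assume "t \<in> {0<..}"
    hence t: "t > 0" by simp
    have "B \<ge> 0" using order_trans[OF norm_ge_zero assms(3)[OF t]] by (simp add: zero_le_mult_iff)
    have "norm (of_real (exp (- x * cosh t)) * p t) \<le> exp (- x * cosh t) * (B * exp (m * t))"
      using assms(3)[OF t] by (simp add: norm_mult)
    also have "\<dots> = B * (exp (- x * cosh t) * exp (m * t))" by simp
    also have "\<dots> \<le> B * (exp ((m + 1)\<^sup>2 / (2 * x)) * exp (- t))"
      using \<open>B \<ge> 0\<close> t by (intro mult_left_mono exp_cosh_le assms) auto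
    finally show "norm (of_real (exp (- x * cosh t)) * p t) \<le> norm (B * exp ((m + 1)\<^sup>2 / (2 * x)) * exp (- t))"
      using \<open>B \<ge> 0\<close> by (simp add: abs_mult)
  qed
qed

text \<open>Differentiation under the integral sign by a direct estimate: the remainder of the
  first-order expansion in x is at most a constant times h^2.\<close>

lemma exp_cosh_integral_deriv:
  fixes p :: "real \<Rightarrow> complex"
  assumes "x > 0" "continuous_on {0<..} p" "\<And>t. t > 0 \<Longrightarrow> norm (p t) \<le> B * exp (m * t)"
  shows "((\<lambda>x. LINT t:{0<..}|lborel. of_real (exp (- x * cosh t)) * p t) has_vector_derivative
           - (LINT t:{0<..}|lborel. of_real (exp (- x * cosh t)) * (of_real (cosh t) * p t))) (at x)"
proof -
  let ?I = "\<lambda>x p. LINT t:{0<..}|lborel. of_real (exp (- x * cosh t)) * p t"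
  have pc: "norm (of_real (cosh t) * p t) \<le> B * exp ((m + 1) * t)"
           "norm (of_real ((cosh t)\<^sup>2) * p t) \<le> B * exp ((m + 2) * t)" if "t > 0" for t
  proof -
    have "norm (of_real (cosh t) * p t) \<le> exp t * (B * exp (m * t))"
      using assms(3)[OF that] cosh_le_exp_abs[of t] that by (auto simp: norm_mult intro!: mult_mono)
    also have "exp t * (B * exp (m * t)) = B * exp ((m + 1) * t)"
      by (simp add: distrib_right exp_add)
    finally show "norm (of_real (cosh t) * p t) \<le> B * exp ((m + 1) * t)" .
    have "norm (of_real ((cosh t)\<^sup>2) * p t) \<le> (exp t)\<^sup>2 * (B * exp (m * t))"
      using assms(3)[OF that] cosh_le_exp_abs[of t] that by (auto simp: norm_mult norm_power intro!: mult_mono power_mono)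
    also have "(exp t)\<^sup>2 * (B * exp (m * t)) = B * exp ((m + 2) * t)"
      by (simp add: distrib_right exp_add exp_double)
    finally show "norm (of_real ((cosh t)\<^sup>2) * p t) \<le> B * exp ((m + 2) * t)" .
  qed
  have int: "set_integrable lborel {0<..} (\<lambda>t. of_real (exp (- y * cosh t)) * p t)"
    "set_integrable lborel {0<..} (\<lambda>t. of_real (exp (- y * cosh t)) * (of_real (cosh t) * p t))"
    "set_integrable lborel {0<..} (\<lambda>t. of_real (exp (- y * cosh t)) * (of_real ((cosh t)\<^sup>2) * p t))" if "y > 0" for y
    by (rule exp_cosh_integrable[OF that assms(2,3)], assumption,
        rule exp_cosh_integrable[OF that _ pc(1)], intro continuous_intros assms, assumption,
        rule exp_cosh_integrable[OF that _ pc(2)], intro continuous_intros assms, assumption)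
  \<comment> \<open>Half of x is held back: with u = - h * cosh t the Taylor remainder is at most
    exp |u| * u^2, and for |h| <= x / 2 the factor exp |u| is absorbed by the other half.\<close>
  let ?g = "\<lambda>t. norm (of_real (exp (- (x / 2) * cosh t)) * (of_real ((cosh t)\<^sup>2) * p t))"
  define M where "M = (LINT t:{0<..}|lborel. ?g t)"
  have M: "set_integrable lborel {0<..} (\<lambda>t. ?g t)"
    using assms(1) by (intro set_integrable_norm int) simp
  have bound: "norm (?I (x + h) p - ?I x p - h *\<^sub>R (- ?I x (\<lambda>t. of_real (cosh t) * p t))) \<le> M * h\<^sup>2"
    if h: "\<bar>h\<bar> \<le> x / 2" for h
  proof -
    define D where "D t = of_real (exp (- (x + h) * cosh t)) * p t - of_real (exp (- x * cosh t)) * p t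
       + h *\<^sub>R (of_real (exp (- x * cosh t)) * (of_real (cosh t) * p t))" for t
    have xh: "x + h > 0" using h assms(1) by linarith
    note i1 = set_integral_diff[OF int(1)[OF xh] int(1)[OF assms(1)]]
    have i2: "set_integrable lborel {0<..} (\<lambda>t. h *\<^sub>R (of_real (exp (- x * cosh t)) * (of_real (cosh t) * p t)))"
      by (rule set_integrable_scaleR_right) (rule int(2)[OF assms(1)])
    note i3 = set_integral_add[OF i1(1) i2]
    have "?I (x + h) p - ?I x p - h *\<^sub>R (- ?I x (\<lambda>t. of_real (cosh t) * p t)) = (LINT t:{0<..}|lborel. D t)"
      unfolding D_def i3(2) i1(2) set_integral_scaleR_right by simp
    also have "norm \<dots> \<le> (LINT t:{0<..}|lborel. h\<^sup>2 * ?g t)"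
      unfolding set_lebesgue_integral_def
    proof (rule Bochner_Integration.integral_norm_bound_integral)
      show "integrable lborel (\<lambda>t. indicator {0<..} t *\<^sub>R D t)"
        using i3(1) by (simp add: set_integrable_def D_def)
      show "integrable lborel (\<lambda>t. indicator {0<..} t *\<^sub>R (h\<^sup>2 * ?g t))"
        unfolding set_integrable_def[symmetric] by (intro set_integrable_mult_right M)
      fix t
      have "norm (D t) \<le> h\<^sup>2 * ?g t" if "t > 0"
      proof -
        define u where "u = - h * cosh t"
        have "exp (- (x + h) * cosh t) = exp (- x * cosh t) * exp u"
          by (simp add: u_def algebra_simps flip: exp_add)
        hence "D t = of_real (exp (- x * cosh t) * (exp u - 1 - u)) * p t"
          by (simp add: D_def u_def scaleR_conv_of_real algebra_simps)
        hence "norm (D t) = exp (- x * cosh t) * \<bar>exp u - 1 - u\<bar> * norm (p t)"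
          by (simp only: norm_mult norm_of_real abs_mult abs_exp_cancel)
        also have "\<bar>exp u - 1 - u\<bar> \<le> exp \<bar>u\<bar> * u\<^sup>2"
          using Taylor_exp_field[of u 1] by (simp add: power2_eq_square diff_diff_add)
        also have "exp \<bar>u\<bar> \<le> exp (x / 2 * cosh t)"
          unfolding exp_le_cancel_iff using mult_right_mono[OF h, of "cosh t"] by (simp add: u_def abs_mult)
        finally have "norm (D t) \<le> exp (- x * cosh t) * (exp (x / 2 * cosh t) * u\<^sup>2) * norm (p t)"
          by (simp add: mult_left_mono mult_right_mono)
        also have "\<dots> = h\<^sup>2 * ?g t"
          by (simp add: u_def norm_mult power_mult_distrib norm_power flip: exp_add)
        finally show ?thesis .
      qed
      thus "norm (indicator {0<..} t *\<^sub>R D t) \<le> indicator {0<..} t *\<^sub>R (h\<^sup>2 * ?g t)"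
        by (simp add: indicator_def)
    qed
    also have "\<dots> = M * h\<^sup>2" by (simp add: M_def mult.commute)
    finally show ?thesis .
  qed
  show ?thesis
    unfolding has_vector_derivative_def has_derivative_at
  proof (intro conjI bounded_linear_scaleR_left)
    show "(\<lambda>h. norm (?I (x + h) p - ?I x p - h *\<^sub>R (- ?I x (\<lambda>t. of_real (cosh t) * p t))) / norm h) \<midarrow>0\<rightarrow> 0"
    proof (rule Lim_null_comparison)
      have "\<forall>\<^sub>F h in at 0. \<bar>h\<bar> < x / 2"
        using assms(1) by (auto simp: eventually_at intro!: exI[of _ "x / 2"])
      thus "\<forall>\<^sub>F h in at 0. norm (norm (?I (x + h) p - ?I x p - h *\<^sub>R (- ?I x (\<lambda>t. of_real (cosh t) * p t))) / norm h) \<le> M * \<bar>h\<bar>"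
      proof eventually_elim
        case (elim h)
        thus ?case using bound[of h] by (cases "h = 0") (auto simp: divide_simps power2_eq_square abs_mult)
      qed
      show "(\<lambda>h. M * \<bar>h\<bar>) \<midarrow>0\<rightarrow> 0" by (auto intro!: tendsto_eq_intros)
    qed
  qed
qed

section \<open>Derivative and recurrence of K\<close>

lemma cosh_complex_of_real: "cosh (complex_of_real t) = of_real (cosh t)"
  and sinh_complex_of_real: "sinh (complex_of_real t) = of_real (sinh t)"
  by (simp_all add: cosh_field_def sinh_field_def exp_of_real flip: of_real_minus)

lemma norm_cosh_le: "norm (cosh z) \<le> exp \<bar>Re z\<bar>"
  and norm_sinh_le: "norm (sinh z) \<le> exp \<bar>Re z\<bar>" for z :: complex
  using norm_cosh_le_cosh[of z] norm_sinh_le_cosh[of z] cosh_le_exp_abs[of "Re z"] by linarith+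

lemma bessel_K_integrand_bound:
  fixes \<nu> :: complex
  shows "t > 0 \<Longrightarrow> norm (cosh (\<nu> * of_real t)) \<le> 1 * exp (\<bar>Re \<nu>\<bar> * t)"
  using norm_cosh_le[of "\<nu> * of_real t"] by (simp add: abs_mult)

lemma bessel_K_integrable:
  fixes \<nu> :: complex
  shows "x > 0 \<Longrightarrow> set_integrable lborel {0<..} (\<lambda>t. of_real (exp (- x * cosh t)) * cosh (\<nu> * of_real t))"
  by (rule exp_cosh_integrable[OF _ _ bessel_K_integrand_bound]) (auto intro!: continuous_intros)

text \<open>2 cosh t cosh (\<nu> t) = cosh ((\<nu> + 1) t) + cosh ((\<nu> - 1) t) under the
  integral.\<close>

lemma bessel_K_deriv_symmetric:
  assumes "x > 0"
  shows "(bessel_K \<nu> has_vector_derivative - ((bessel_K (\<nu> + 1) x + bessel_K (\<nu> - 1) x) / 2)) (at x)"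
proof -
  have "(LINT t:{0<..}|lborel. of_real (exp (- x * cosh t)) * (of_real (cosh t) * cosh (\<nu> * of_real t))) =
        (LINT t:{0<..}|lborel. (of_real (exp (- x * cosh t)) * cosh ((\<nu> + 1) * of_real t)
          + of_real (exp (- x * cosh t)) * cosh ((\<nu> - 1) * of_real t)) / 2)"
  proof (rule set_lebesgue_integral_cong)
    show "\<forall>t. t \<in> {0<..} \<longrightarrow> of_real (exp (- x * cosh t)) * (of_real (cosh t) * cosh (\<nu> * of_real t)) =
        (of_real (exp (- x * cosh t)) * cosh ((\<nu> + 1) * of_real t)
          + of_real (exp (- x * cosh t)) * cosh ((\<nu> - 1) * of_real t)) / 2"
      by (simp add: distrib_right left_diff_distrib cosh_add cosh_diff cosh_complex_of_real sinh_complex_of_real field_simps)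
  qed simp
  also have "\<dots> = (bessel_K (\<nu> + 1) x + bessel_K (\<nu> - 1) x) / 2"
    using set_integral_add(2)[OF bessel_K_integrable[OF assms] bessel_K_integrable[OF assms], of "\<nu> + 1" "\<nu> - 1"]
    by (simp add: bessel_K_def)
  finally have eq: "(LINT t:{0<..}|lborel. of_real (exp (- x * cosh t)) * (of_real (cosh t) * cosh (\<nu> * of_real t))) =
    (bessel_K (\<nu> + 1) x + bessel_K (\<nu> - 1) x) / 2" .
  have "continuous_on {0<..} (\<lambda>t. cosh (\<nu> * complex_of_real t))" by (intro continuous_intros)
  from exp_cosh_integral_deriv[OF assms this bessel_K_integrand_bound]
  have "((\<lambda>x. LINT t:{0<..}|lborel. of_real (exp (- x * cosh t)) * cosh (\<nu> * of_real t)) has_vector_derivative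
    - ((bessel_K (\<nu> + 1) x + bessel_K (\<nu> - 1) x) / 2)) (at x)"
    by (simp only: eq)
  moreover have "bessel_K \<nu> = (\<lambda>x. LINT t:{0<..}|lborel. of_real (exp (- x * cosh t)) * cosh (\<nu> * of_real t))"
    by (simp add: bessel_K_def fun_eq_iff)
  ultimately show ?thesis by (simp only:)
qed

text \<open>The derivative of exp (- x cosh t) * sinh (\<nu> t) integrates to 0 over the half-line,
  as the function vanishes at both ends; the product sinh t * sinh (\<nu> t) is then split by the
  addition theorem for cosh.\<close>

lemma bessel_K_recurrence:
  assumes x: "x > 0"
  shows "bessel_K (\<nu> + 1) x - bessel_K (\<nu> - 1) x = 2 * \<nu> / of_real x * bessel_K \<nu> x"
proof -
  define F where "F t = of_real (exp (- x * cosh t)) * sinh (\<nu> * of_real t)" for t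
  define p where "p t = \<nu> * cosh (\<nu> * of_real t) - of_real x * (of_real (sinh t) * sinh (\<nu> * of_real t))" for t
  define f where "f t = of_real (exp (- x * cosh t)) * p t" for t
  have F: "(F has_vector_derivative f t) (at t)" for t
  proof -
    have e: "((\<lambda>t. exp (- x * cosh t)) has_real_derivative (- x * sinh t * exp (- x * cosh t))) (at t)"
      by (auto intro!: derivative_eq_intros)
    have s: "((\<lambda>t. sinh (\<nu> * of_real t)) has_vector_derivative (\<nu> * cosh (\<nu> * of_real t))) (at t)"
    proof -
      have "((\<lambda>z. sinh (\<nu> * z)) has_field_derivative (\<nu> * cosh (\<nu> * of_real t))) (at (of_real t))"
        by (auto intro!: derivative_eq_intros)
      thus ?thesis by (rule has_vector_derivative_real_field)
    qed
    show ?thesis unfolding F_def f_def p_def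
      by (rule has_vector_derivative_eq_rhs[OF has_vector_derivative_mult[OF has_vector_derivative_of_real[OF e] s]])
         (simp add: algebra_simps)
  qed
  have pc: "continuous_on A p" for A unfolding p_def by (intro continuous_intros)
  have pb: "norm (p t) \<le> (norm \<nu> + x) * exp ((\<bar>Re \<nu>\<bar> + 1) * t)" if t: "t > 0" for t
  proof -
    have "norm (p t) \<le> norm \<nu> * exp (\<bar>Re \<nu>\<bar> * t) + x * (exp t * exp (\<bar>Re \<nu>\<bar> * t))"
      unfolding p_def
    proof (rule order_trans[OF norm_triangle_ineq4], rule add_mono)
      show "norm (\<nu> * cosh (\<nu> * of_real t)) \<le> norm \<nu> * exp (\<bar>Re \<nu>\<bar> * t)"
        using bessel_K_integrand_bound[OF t, of \<nu>] by (simp add: norm_mult mult_left_mono)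
      have "norm (sinh (\<nu> * of_real t)) \<le> exp (\<bar>Re \<nu>\<bar> * t)"
        using norm_sinh_le[of "\<nu> * of_real t"] t by (simp add: abs_mult)
      moreover have "norm (complex_of_real (sinh t)) \<le> exp t"
        using norm_sinh_le[of "of_real t"] t by (simp add: sinh_complex_of_real)
      ultimately show "norm (of_real x * (of_real (sinh t) * sinh (\<nu> * of_real t))) \<le> x * (exp t * exp (\<bar>Re \<nu>\<bar> * t))"
        unfolding norm_mult using x by (intro mult_mono) auto
    qed
    also have "\<dots> \<le> norm \<nu> * exp ((\<bar>Re \<nu>\<bar> + 1) * t) + x * exp ((\<bar>Re \<nu>\<bar> + 1) * t)"
      using t x by (intro add_mono mult_left_mono) (auto simp: algebra_simps simp flip: exp_add)
    finally show ?thesis by (simp add: distrib_right)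
  qed
  have fi: "set_integrable lborel {0<..} f"
    unfolding f_def by (rule exp_cosh_integrable[OF x pc pb])
  have "(LBINT t=0..\<infinity>. f t) = 0 - 0"
  proof (rule interval_integral_FTC_integrable[OF _ F])
    show "isCont f t" for t
      unfolding f_def using pc[of UNIV] by (intro continuous_intros) (simp add: continuous_on_eq_continuous_at)
    show "set_integrable lborel (einterval 0 \<infinity>) f" using fi unfolding zero_ereal_def by simp
    have "isCont F 0" using F[of 0] by (rule has_vector_derivative_continuous)
    hence "(F \<longlongrightarrow> 0) (at_right 0)"
      by (auto simp: isCont_def F_def filterlim_at_split)
    thus "((F \<circ> real_of_ereal) \<longlongrightarrow> 0) (at_right 0)"
      unfolding zero_ereal_def by (simp add: ereal_tendsto_simps1)
    have "(F \<longlongrightarrow> 0) at_top"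
    proof (rule Lim_null_comparison)
      show "\<forall>\<^sub>F t in at_top. norm (F t) \<le> exp ((\<bar>Re \<nu>\<bar> + 1)\<^sup>2 / (2 * x)) * exp (- t)"
        using eventually_gt_at_top[of 0]
      proof eventually_elim
        case (elim t)
        have "norm (F t) \<le> exp (- x * cosh t) * exp (\<bar>Re \<nu>\<bar> * t)"
          using norm_sinh_le[of "\<nu> * of_real t"] elim by (simp add: F_def norm_mult abs_mult)
        also have "\<dots> \<le> exp ((\<bar>Re \<nu>\<bar> + 1)\<^sup>2 / (2 * x)) * exp (- t)"
          using elim by (intro exp_cosh_le x) simp
        finally show ?case .
      qed
      have "((\<lambda>t::real. exp (- t)) \<longlongrightarrow> 0) at_top"
        by (rule filterlim_compose[OF exp_at_bot filterlim_uminus_at_bot_at_top])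
      thus "((\<lambda>t. exp ((\<bar>Re \<nu>\<bar> + 1)\<^sup>2 / (2 * x)) * exp (- t)) \<longlongrightarrow> 0) at_top"
        by (rule tendsto_mult_right_zero)
    qed
    thus "((F \<circ> real_of_ereal) \<longlongrightarrow> 0) (at_left \<infinity>)"
      by (simp add: ereal_tendsto_simps1)
  qed simp
  hence 0: "(LINT t:{0<..}|lborel. f t) = 0"
    by (simp add: interval_lebesgue_integral_0_infty)
  have "f t = \<nu> * (of_real (exp (- x * cosh t)) * cosh (\<nu> * of_real t)) -
     of_real x / 2 * (of_real (exp (- x * cosh t)) * cosh ((\<nu> + 1) * of_real t) - of_real (exp (- x * cosh t)) * cosh ((\<nu> - 1) * of_real t))" for t
    by (simp add: f_def p_def distrib_right left_diff_distrib cosh_add cosh_diff cosh_complex_of_real sinh_complex_of_real algebra_simps)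
  hence "(LINT t:{0<..}|lborel. f t) = \<nu> * bessel_K \<nu> x - of_real x / 2 * (bessel_K (\<nu> + 1) x - bessel_K (\<nu> - 1) x)"
    using bessel_K_integrable[OF x, of \<nu>] bessel_K_integrable[OF x, of "\<nu> + 1"] bessel_K_integrable[OF x, of "\<nu> - 1"]
    by (simp add: bessel_K_def set_integral_diff set_integrable_mult_right)
  with 0 show ?thesis using x by (simp add: field_simps)
qed

text \<open>The recurrence eliminates the orders \<nu> - 1 and \<nu> + 2, leaving a closed
  first-order system for the orders \<nu> and \<nu> + 1, which are the ones in
  \<open>lommel\<close>.\<close>

lemma bessel_K_deriv:
  assumes x: "x > 0"
  shows "(bessel_K \<nu> has_vector_derivative (\<nu> / of_real x * bessel_K \<nu> x - bessel_K (\<nu> + 1) x)) (at x)"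
    and "(bessel_K (\<nu> + 1) has_vector_derivative (- bessel_K \<nu> x - (\<nu> + 1) / of_real x * bessel_K (\<nu> + 1) x)) (at x)"
proof -
  have 1: "bessel_K (\<nu> - 1) x = bessel_K (\<nu> + 1) x - 2 * (\<nu> / of_real x * bessel_K \<nu> x)"
    using bessel_K_recurrence[OF x, of \<nu>] by (simp add: algebra_simps)
  show "(bessel_K \<nu> has_vector_derivative (\<nu> / of_real x * bessel_K \<nu> x - bessel_K (\<nu> + 1) x)) (at x)"
    by (rule has_vector_derivative_eq_rhs[OF bessel_K_deriv_symmetric[OF x]]) (simp add: 1 diff_divide_distrib)
  have 2: "bessel_K (\<nu> + 1 + 1) x = bessel_K \<nu> x + 2 * ((\<nu> + 1) / of_real x * bessel_K (\<nu> + 1) x)"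
    using bessel_K_recurrence[OF x, of "\<nu> + 1"] by (simp add: algebra_simps)
  have 3: "\<nu> + 1 - 1 = \<nu>" by simp
  show "(bessel_K (\<nu> + 1) has_vector_derivative (- bessel_K \<nu> x - (\<nu> + 1) / of_real x * bessel_K (\<nu> + 1) x)) (at x)"
    by (rule has_vector_derivative_eq_rhs[OF bessel_K_deriv_symmetric[OF x]]) (unfold 2 3, simp add: add_divide_distrib)
qed

lemma continuous_on_bessel_K: "continuous_on {0<..} (bessel_K \<nu>)"
  by (rule continuous_at_imp_continuous_on) (auto intro!: has_vector_derivative_continuous[OF bessel_K_deriv(1)])

text \<open>|cosh (\<nu> t)| <= cosh (Re \<nu> * t), which is monotone in |Re \<nu>|. The comparison
  with a positive real order transfers the behaviour at 0 to orders for which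
  \<open>bessel_K_at_0\<close> says nothing.\<close>

lemma bessel_K_le:
  assumes "x > 0" "\<bar>Re \<nu>\<bar> \<le> \<sigma>"
  shows "norm (bessel_K \<nu> x) \<le> norm (bessel_K (of_real \<sigma>) x)"
proof -
  have eq: "of_real (exp (- x * cosh t)) * cosh (of_real \<sigma> * of_real t) = complex_of_real (exp (- x * cosh t) * cosh (\<sigma> * t))" for t
    by (simp flip: cosh_complex_of_real)
  have r: "set_integrable lborel {0<..} (\<lambda>t. exp (- x * cosh t) * cosh (\<sigma> * t))"
    using bessel_K_integrable[OF assms(1), of "of_real \<sigma>"] unfolding eq
    unfolding set_integrable_def by (auto dest: integrable_Re)
  have "norm (bessel_K \<nu> x) \<le> (LINT t:{0<..}|lborel. norm (of_real (exp (- x * cosh t)) * cosh (\<nu> * of_real t)))"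
    unfolding bessel_K_def by (rule set_integral_norm_bound[OF bessel_K_integrable[OF assms(1)]])
  also have "\<dots> \<le> (LINT t:{0<..}|lborel. exp (- x * cosh t) * cosh (\<sigma> * t))"
  proof (rule set_integral_mono)
    show "set_integrable lborel {0<..} (\<lambda>t. norm (of_real (exp (- x * cosh t)) * cosh (\<nu> * of_real t)))"
      by (rule set_integrable_norm[OF bessel_K_integrable[OF assms(1)]])
    fix t :: real assume "t \<in> {0<..}"
    hence t: "t > 0" by simp
    have "norm (cosh (\<nu> * of_real t)) \<le> cosh (\<bar>Re \<nu>\<bar> * t)"
    proof -
      have "cosh (\<bar>Re \<nu>\<bar> * t) = cosh (Re \<nu> * t)"
        using t by (metis abs_mult abs_of_pos cosh_real_abs)
      moreover have "norm (cosh (\<nu> * of_real t)) \<le> cosh (Re \<nu> * t)"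
        using norm_cosh_le_cosh[of "\<nu> * of_real t"] by simp
      ultimately show ?thesis by (simp only:)
    qed
    also have "\<dots> \<le> cosh (\<sigma> * t)"
      using t assms(2) by (subst cosh_real_nonneg_le_iff) (auto intro!: mult_right_mono)
    finally show "norm (of_real (exp (- x * cosh t)) * cosh (\<nu> * of_real t)) \<le> exp (- x * cosh t) * cosh (\<sigma> * t)"
      by (simp add: norm_mult)
  qed (rule r)
  also have "\<dots> \<le> norm (complex_of_real (LINT t:{0<..}|lborel. exp (- x * cosh t) * cosh (\<sigma> * t)))" by simp
  also have "complex_of_real (LINT t:{0<..}|lborel. exp (- x * cosh t) * cosh (\<sigma> * t)) = bessel_K (of_real \<sigma>) x"
    unfolding bessel_K_def eq by (rule set_integral_complex_of_real[symmetric])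
  finally show ?thesis .
qed

text \<open>For x >= 1, cosh t >= 1 gives exp (- x cosh t) <= exp (1 - x) * exp (- cosh t).\<close>

lemma bessel_K_exp_bound:
  obtains M where "M \<ge> 0" "\<And>x. x \<ge> 1 \<Longrightarrow> norm (bessel_K \<nu> x) \<le> M * exp (- x)"
proof -
  define I where "I = (LINT t:{0<..}|lborel. norm (of_real (exp (- 1 * cosh t)) * cosh (\<nu> * of_real t)))"
  have "norm (bessel_K \<nu> x) \<le> exp 1 * I * exp (- x)" if x: "x \<ge> 1" for x
  proof -
    have "norm (bessel_K \<nu> x) \<le> (LINT t:{0<..}|lborel. norm (of_real (exp (- x * cosh t)) * cosh (\<nu> * of_real t)))"
      unfolding bessel_K_def using x by (intro set_integral_norm_bound[OF bessel_K_integrable]) simp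
    also have "\<dots> \<le> (LINT t:{0<..}|lborel. exp (1 - x) * norm (of_real (exp (- 1 * cosh t)) * cosh (\<nu> * of_real t)))"
    proof (rule set_integral_mono)
      fix t :: real
      have "1 * (x - 1) \<le> cosh t * (x - 1)" using x by (intro mult_right_mono cosh_real_ge_1) auto
      hence "exp (- x * cosh t) \<le> exp (1 - x) * exp (- 1 * cosh t)"
        unfolding exp_add[symmetric] exp_le_cancel_iff by (simp add: algebra_simps)
      hence "exp (- x * cosh t) * norm (cosh (\<nu> * of_real t)) \<le> exp (1 - x) * exp (- 1 * cosh t) * norm (cosh (\<nu> * of_real t))"
        by (rule mult_right_mono) simp
      thus "norm (of_real (exp (- x * cosh t)) * cosh (\<nu> * of_real t)) \<le> exp (1 - x) * norm (of_real (exp (- 1 * cosh t)) * cosh (\<nu> * of_real t))"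
        by (simp add: norm_mult mult_ac)
    next
      show "set_integrable lborel {0<..} (\<lambda>t. norm (of_real (exp (- x * cosh t)) * cosh (\<nu> * of_real t)))"
        by (intro set_integrable_norm bessel_K_integrable) (use x in simp)
      show "set_integrable lborel {0<..} (\<lambda>t. exp (1 - x) * norm (of_real (exp (- 1 * cosh t)) * cosh (\<nu> * of_real t)))"
        by (intro set_integrable_mult_right set_integrable_norm bessel_K_integrable) simp
    qed
    also have "\<dots> = exp (1 - x) * I" unfolding I_def by (rule set_integral_mult_right)
    finally show ?thesis by (simp add: exp_diff exp_minus field_simps)
  qed
  moreover have "exp 1 * I \<ge> 0" unfolding I_def set_lebesgue_integral_def
    by (intro mult_nonneg_nonneg Bochner_Integration.integral_nonneg) auto
  ultimately show ?thesis using that by blast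
qed

text \<open>Substitute w = (x / 2) exp t: then x cosh t = w + x^2 / (4 w), and t = 0 corresponds to
  w = x / 2. As x tends to 0 the right-hand side turns into the Gamma integral, whose integrability
  is the second claim.\<close>

lemma bessel_K_exp_integral:
  fixes \<mu> :: complex
  assumes x: "x > 0" and mu: "Re \<mu> > 0"
  shows "(of_real (x / 2)) powr \<mu> * (LINT t:{0<..}|lborel. of_real (exp (- x * cosh t)) * exp (\<mu> * of_real t)) =
     (LINT w:{x / 2<..}|lborel. of_real (exp (- w - x\<^sup>2 / (4 * w))) * of_real w powr (\<mu> - 1))"
    and "set_integrable lborel {0<..} (\<lambda>w. of_real (exp (- w)) * complex_of_real w powr (\<mu> - 1))"
proof -
  define g where "g t = (x / 2) * exp t" for t :: real
  define f where "f w = of_real (exp (- w - x\<^sup>2 / (4 * w))) * complex_of_real w powr (\<mu> - 1)" for w :: real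
  have g_pos: "g t > 0" for t using x by (simp add: g_def)
  have gamma: "set_integrable lborel {0<..} (\<lambda>t. complex_of_real t powr (\<mu> - 1) / of_real (exp t))"
  proof (rule set_integrable_lborel_of_absolutely[OF absolutely_integrable_Gamma_integral'[OF mu]])
    have "set_borel_measurable lborel {0<..} (\<lambda>t. complex_of_real t powr (\<mu> - 1) / of_real (exp t))"
      by (intro set_borel_measurable_continuous_greaterThan continuous_intros) auto
    thus "set_borel_measurable borel {0<..} (\<lambda>t. complex_of_real t powr (\<mu> - 1) / of_real (exp t))"
      by (simp add: set_borel_measurable_def)
  qed
  thus int: "set_integrable lborel {0<..} (\<lambda>w. of_real (exp (- w)) * complex_of_real w powr (\<mu> - 1))"
    by (simp add: exp_minus divide_inverse mult.commute)
  have gf: "g t *\<^sub>R f (g t) = (of_real (x / 2)) powr \<mu> * (of_real (exp (- x * cosh t)) * exp (\<mu> * of_real t))" for t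
  proof -
    have "- g t - x\<^sup>2 / (4 * g t) = - x * cosh t"
      using x by (simp add: g_def cosh_field_def exp_minus field_simps power2_eq_square)
    moreover have "of_real (g t) * of_real (g t) powr (\<mu> - 1) = of_real (g t) powr \<mu>"
      using g_pos[of t] by (simp add: powr_diff)
    moreover have "of_real (g t) powr \<mu> = of_real (x / 2) powr \<mu> * of_real (exp t) powr \<mu>"
      unfolding g_def of_real_mult using x powr_times_real[of "of_real (x / 2)" "of_real (exp t)" \<mu>] by simp
    moreover have "of_real (exp t) powr \<mu> = exp (\<mu> * of_real t)"
      by (simp add: powr_def Ln_of_real)
    ultimately show ?thesis
      unfolding f_def scaleR_conv_of_real by (simp add: mult.left_commute mult.assoc)
  qed
  have "(LBINT w=ereal (x / 2)..\<infinity>. f w) = (LBINT t=0..\<infinity>. g t *\<^sub>R f (g t))"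
  proof (rule interval_integral_substitution_integrable)
    show "DERIV g t :> g t" for t unfolding g_def by (auto intro!: derivative_eq_intros)
    show "isCont f (g t)" for t
      unfolding f_def using g_pos[of t] by (intro continuous_intros) auto
    show "isCont g t" for t unfolding g_def by (intro continuous_intros)
    show "0 \<le> g t" for t using g_pos[of t] by simp
    have "(g \<longlongrightarrow> x / 2) (at_right 0)" unfolding g_def by (auto intro!: tendsto_eq_intros)
    thus "((ereal \<circ> g \<circ> real_of_ereal) \<longlongrightarrow> ereal (x / 2)) (at_right 0)"
      unfolding zero_ereal_def ereal_tendsto_simps1 by (simp add: ereal_tendsto_simps2)
    have "filterlim g at_top at_top"
      unfolding g_def by (rule filterlim_tendsto_pos_mult_at_top[OF tendsto_const _ exp_at_top]) (use x in simp)
    thus "((ereal \<circ> g \<circ> real_of_ereal) \<longlongrightarrow> \<infinity>) (at_left \<infinity>)"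
      unfolding ereal_tendsto_simps1 by (simp add: ereal_tendsto_simps2)
    have "set_integrable lborel {0<..} (\<lambda>t. of_real (exp (- x * cosh t)) * exp (\<mu> * of_real t))"
      by (rule exp_cosh_integrable[OF x, where B = 1 and m = "Re \<mu>"]) (auto intro!: continuous_intros)
    hence "set_integrable lborel {0<..} (\<lambda>t. g t *\<^sub>R f (g t))"
      unfolding gf by (rule set_integrable_mult_right)
    thus "set_integrable lborel (einterval 0 \<infinity>) (\<lambda>t. g t *\<^sub>R f (g t))" unfolding zero_ereal_def by simp
    have "set_integrable lborel {x/2<..} f"
    proof (rule set_integrable_bound)
      show "set_integrable lborel {x/2<..} (\<lambda>w. of_real (exp (- w)) * complex_of_real w powr (\<mu> - 1))"
        by (rule set_integrable_subset[OF int]) (use x in auto)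
      show "set_borel_measurable lborel {x / 2<..} f"
        unfolding f_def using x by (intro set_borel_measurable_continuous_greaterThan continuous_intros) auto
      show "AE w in lborel. w \<in> {x / 2<..} \<longrightarrow> norm (f w) \<le> norm (of_real (exp (- w)) * complex_of_real w powr (\<mu> - 1))"
        using x by (intro AE_I2 impI) (auto simp: f_def norm_mult intro!: mult_right_mono)
    qed
    thus "set_integrable lborel (einterval (ereal (x / 2)) \<infinity>) f" by simp
  qed simp
  hence "(LINT w:{x / 2<..}|lborel. f w) = (LINT t:{0<..}|lborel. g t *\<^sub>R f (g t))"
    by (simp add: interval_lebesgue_integral_0_infty) (simp add: interval_lebesgue_integral_def)
  also have "\<dots> = (of_real (x / 2)) powr \<mu> * (LINT t:{0<..}|lborel. of_real (exp (- x * cosh t)) * exp (\<mu> * of_real t))"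
    unfolding gf by (rule set_integral_mult_right)
  finally show "(of_real (x / 2)) powr \<mu> * (LINT t:{0<..}|lborel. of_real (exp (- x * cosh t)) * exp (\<mu> * of_real t)) =
     (LINT w:{x / 2<..}|lborel. of_real (exp (- w - x\<^sup>2 / (4 * w))) * of_real w powr (\<mu> - 1))"
    by (simp only: f_def)
qed

text \<open>Split cosh into two exponentials. The growing half tends to Gamma by dominated
  convergence after the substitution above; the decaying half stays bounded and is killed by the
  factor (x / 2) powr \<mu>.\<close>

lemma bessel_K_at_0:
  assumes mu: "Re \<mu> > 0"
  shows "((\<lambda>x. of_real (x / 2) powr \<mu> * bessel_K \<mu> x) \<longlongrightarrow> Gamma \<mu> / 2) (at_right 0)"
proof -
  define I where "I s x = (LINT t:{0<..}|lborel. of_real (exp (- x * cosh t)) * exp (s * of_real t))" for s :: complex and x :: real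
  have intI: "set_integrable lborel {0<..} (\<lambda>t. of_real (exp (- x * cosh t)) * exp (s * of_real t))" if "x > 0" for x and s :: complex
    by (rule exp_cosh_integrable[OF that, where B = 1 and m = "Re s"]) (auto intro!: continuous_intros)
  have K: "bessel_K \<mu> x = (I \<mu> x + I (- \<mu>) x) / 2" if "x > 0" for x
  proof -
    have "bessel_K \<mu> x = (LINT t:{0<..}|lborel. (of_real (exp (- x * cosh t)) * exp (\<mu> * of_real t) + of_real (exp (- x * cosh t)) * exp (- \<mu> * of_real t)) / 2)"
      unfolding bessel_K_def by (simp add: cosh_field_def distrib_left add_divide_distrib)
    also have "\<dots> = (I \<mu> x + I (- \<mu>) x) / 2"
      unfolding I_def using set_integral_add(2)[OF intI[OF that] intI[OF that], of \<mu> "- \<mu>"] by simp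
    finally show ?thesis .
  qed
  \<comment> \<open>y = 1 / x moves the limit to infinity, and the moving endpoint x / 2 becomes a
    case distinction so that the domain of integration stays fixed.\<close>
  have "((\<lambda>y. LINT w:{0<..}|lborel. (if w > inverse y / 2 then of_real (exp (- w - (inverse y)\<^sup>2 / (4 * w))) * of_real w powr (\<mu> - 1) else 0))
      \<longlongrightarrow> (LINT w:{0<..}|lborel. of_real (exp (- w)) * complex_of_real w powr (\<mu> - 1))) at_top"
  proof (rule set_dominated_convergence_at_top)
    have m: "set_borel_measurable lborel {0<..} (\<lambda>w. of_real (exp (- w - c / (4 * w))) * complex_of_real w powr (\<mu> - 1))" for c
      by (intro set_borel_measurable_continuous_greaterThan continuous_intros) auto
    from m[of 0] show "set_borel_measurable lborel {0<..} (\<lambda>w. of_real (exp (- w)) * complex_of_real w powr (\<mu> - 1))" by simp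
    show "set_borel_measurable lborel {0<..} (\<lambda>w. if w > inverse y / 2 then of_real (exp (- w - (inverse y)\<^sup>2 / (4 * w))) * complex_of_real w powr (\<mu> - 1) else 0)" for y
    proof -
      have "(\<lambda>w. indicator {inverse y / 2<..} w *\<^sub>R (indicator {0<..} w *\<^sub>R (of_real (exp (- w - (inverse y)\<^sup>2 / (4 * w))) * complex_of_real w powr (\<mu> - 1)))) \<in> borel_measurable lborel"
        by (intro borel_measurable_scaleR) (use m[of "(inverse y)\<^sup>2"] in \<open>auto simp: set_borel_measurable_def\<close>)
      thus ?thesis unfolding set_borel_measurable_def
        by (rule measurable_cong[THEN iffD1, rotated]) (auto simp: indicator_def)
    qed
    show "set_integrable lborel {0<..} (\<lambda>w. norm (of_real (exp (- w)) * complex_of_real w powr (\<mu> - 1)))"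
      using bessel_K_exp_integral(2)[OF zero_less_one mu] by (rule set_integrable_norm)
    fix w :: real assume "w \<in> {0<..}"
    hence w: "w > 0" by simp
    have iv: "(inverse \<longlongrightarrow> 0) (at_top :: real filter)" by (rule tendsto_inverse_0_at_top[OF filterlim_ident])
    have "((\<lambda>y. of_real (exp (- w - (inverse y)\<^sup>2 / (4 * w))) * complex_of_real w powr (\<mu> - 1)) \<longlongrightarrow> of_real (exp (- w - 0\<^sup>2 / (4 * w))) * complex_of_real w powr (\<mu> - 1)) at_top"
      by (intro tendsto_intros iv) (use w in auto)
    moreover have "\<forall>\<^sub>F y in at_top. inverse y / 2 < w"
      using order_tendstoD(2)[OF tendsto_divide[OF iv tendsto_const[of 2]], of w] w by simp
    ultimately show "((\<lambda>y. if w > inverse y / 2 then of_real (exp (- w - (inverse y)\<^sup>2 / (4 * w))) * complex_of_real w powr (\<mu> - 1) else 0) \<longlongrightarrow> of_real (exp (- w)) * complex_of_real w powr (\<mu> - 1)) at_top"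
      by (auto elim!: Lim_transform_eventually elim: eventually_mono)
  next
    show "\<forall>\<^sub>F y in at_top. \<forall>w\<in>{0<..}. norm (if w > inverse y / 2 then of_real (exp (- w - (inverse y)\<^sup>2 / (4 * w))) * complex_of_real w powr (\<mu> - 1) else 0) \<le> norm (of_real (exp (- w)) * complex_of_real w powr (\<mu> - 1))"
      by (intro always_eventually allI ballI) (auto simp: norm_mult intro!: mult_right_mono)
  qed
  also have "(LINT w:{0<..}|lborel. of_real (exp (- w)) * complex_of_real w powr (\<mu> - 1)) = Gamma \<mu>"
  proof -
    have "((\<lambda>w. of_real (exp (- w)) * complex_of_real w powr (\<mu> - 1)) has_integral Gamma \<mu>) {0<..}"
      using Gamma_integral_complex'[OF mu] by (simp add: exp_minus divide_inverse mult.commute)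
    thus ?thesis
      using set_borel_integral_eq_integral(2)[OF bessel_K_exp_integral(2)[OF zero_less_one mu]]
      by (simp add: integral_unique)
  qed
  finally have "((\<lambda>y. of_real (inverse y / 2) powr \<mu> * I \<mu> (inverse y)) \<longlongrightarrow> Gamma \<mu>) at_top"
  proof (rule Lim_transform_eventually)
    show "\<forall>\<^sub>F y in at_top. (LINT w:{0<..}|lborel. (if w > inverse y / 2 then of_real (exp (- w - (inverse y)\<^sup>2 / (4 * w))) * of_real w powr (\<mu> - 1) else 0)) = of_real (inverse y / 2) powr \<mu> * I \<mu> (inverse y)"
      using eventually_gt_at_top[of 0]
    proof eventually_elim
      case (elim y)
      hence y: "inverse y > 0" by simp
      show ?case unfolding I_def bessel_K_exp_integral(1)[OF y mu] unfolding set_lebesgue_integral_def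
        by (rule Bochner_Integration.integral_cong) (use elim in \<open>auto simp: indicator_def intro: less_trans[of 0 "inverse y / 2"]\<close>)
    qed
  qed
  hence 1: "((\<lambda>x. of_real (x / 2) powr \<mu> * I \<mu> x) \<longlongrightarrow> Gamma \<mu>) (at_right 0)"
    by (simp add: filterlim_at_right_to_top)
  have 2: "((\<lambda>x. of_real (x / 2) powr \<mu> * I (- \<mu>) x) \<longlongrightarrow> 0) (at_right 0)"
  proof (rule Lim_null_comparison)
    define C where "C = (LINT t:{0<..}|lborel. exp (- Re \<mu> * t))"
    show "\<forall>\<^sub>F x in at_right 0. norm (of_real (x / 2) powr \<mu> * I (- \<mu>) x) \<le> (x / 2) powr Re \<mu> * C"
      using eventually_at_right_less[of 0]
    proof eventually_elim
      case (elim x)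
      have "norm (I (- \<mu>) x) \<le> (LINT t:{0<..}|lborel. norm (of_real (exp (- x * cosh t)) * exp (- \<mu> * of_real t)))"
        unfolding I_def by (rule set_integral_norm_bound[OF intI[OF elim]])
      also have "\<dots> \<le> C" unfolding C_def
      proof (rule set_integral_mono[OF set_integrable_norm[OF intI[OF elim]] set_integrable_exp_mult_minus[OF mu]])
        fix t :: real
        have "exp (- x * cosh t) \<le> 1" using elim by (simp add: mult_nonneg_nonneg)
        thus "norm (of_real (exp (- x * cosh t)) * exp (- \<mu> * of_real t)) \<le> exp (- Re \<mu> * t)"
          by (simp add: norm_mult mult_left_le_one_le)
      qed
      finally show ?case
        using elim by (simp add: norm_mult norm_powr_real_powr mult_left_mono)
    qed
    have "((\<lambda>x::real. (x / 2) powr Re \<mu>) \<longlongrightarrow> (0 / 2) powr Re \<mu>) (at_right 0)"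
      using mu by (intro tendsto_intros tendsto_powr'[OF _ tendsto_const]) (auto simp: eventually_at_right_less intro!: eventually_mono[OF eventually_at_right_less] tendsto_intros)
    thus "((\<lambda>x. (x / 2) powr Re \<mu> * C) \<longlongrightarrow> 0) (at_right 0)"
      by (intro tendsto_mult_left_zero) simp
  qed
  have "((\<lambda>x. (of_real (x / 2) powr \<mu> * I \<mu> x + of_real (x / 2) powr \<mu> * I (- \<mu>) x) / 2) \<longlongrightarrow> (Gamma \<mu> + 0) / 2) (at_right 0)"
    by (intro tendsto_intros 1 2) simp
  hence "((\<lambda>x. of_real (x / 2) powr \<mu> * bessel_K \<mu> x) \<longlongrightarrow> (Gamma \<mu> + 0) / 2) (at_right 0)"
  proof (rule Lim_transform_eventually)
    show "\<forall>\<^sub>F x in at_right 0. (of_real (x / 2) powr \<mu> * I \<mu> x + of_real (x / 2) powr \<mu> * I (- \<mu>) x) / 2 = of_real (x / 2) powr \<mu> * bessel_K \<mu> x"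
      using eventually_at_right_less[of 0] by eventually_elim (simp add: K distrib_left)
  qed
  thus ?thesis by simp
qed

section \<open>Behaviour of K at infinity\<close>

lemma sinh_over_tendsto: "((\<lambda>v. sinh v / v) \<longlongrightarrow> (1::real)) (at 0)"
proof -
  have "(sinh has_real_derivative 1) (at 0)" by (auto intro!: derivative_eq_intros)
  thus ?thesis by (simp add: DERIV_def)
qed

text \<open>Laplace's method: with t = s / sqrt x the exponent x (cosh t - 1) tends to s^2 / 2. The
  Gaussian integral is left unevaluated; \<open>bessel_K_lower_bound\<close> uses its
  positivity.\<close>

lemma bessel_K_asymptotics:
  "((\<lambda>x. of_real (sqrt x * exp x) * bessel_K \<nu> x) \<longlongrightarrow> of_real (LINT s:{0<..}|lborel. exp (- (s\<^sup>2) / 2))) at_top"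
proof -
  define S where "S x s = of_real (exp (- x * (cosh (s / sqrt x) - 1))) * cosh (\<nu> * of_real (s / sqrt x))" for x s
  define m where "m = \<bar>Re \<nu>\<bar>"
  have "((\<lambda>x. LINT s:{0<..}|lborel. S x s) \<longlongrightarrow> (LINT s:{0<..}|lborel. complex_of_real (exp (- (s\<^sup>2) / 2)))) at_top"
  proof (rule set_dominated_convergence_at_top)
    show "set_borel_measurable lborel {0<..} (S x)" for x
    \<comment> \<open>Measurability is demanded for every x. At x = 0 the quotient s / sqrt x is 0
      by convention and the integrand is constant.\<close>
    proof (cases "x = 0")
      case True
      thus ?thesis unfolding S_def by (intro set_borel_measurable_continuous_greaterThan) (simp add: continuous_intros)
    next
      case False
      thus ?thesis unfolding S_def by (intro set_borel_measurable_continuous_greaterThan continuous_intros) auto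
    qed
    show "set_borel_measurable lborel {0<..} (\<lambda>s. complex_of_real (exp (- (s\<^sup>2) / 2)))"
      by (intro set_borel_measurable_continuous_greaterThan continuous_intros) auto
    show "set_integrable lborel {0<..} (\<lambda>s::real. exp ((m + 1)\<^sup>2 / 2) * exp (- s))"
      by (intro set_integrable_mult_right set_integrable_exp_minus)
    show "\<forall>\<^sub>F x in at_top. \<forall>s\<in>{0<..}. norm (S x s) \<le> exp ((m + 1)\<^sup>2 / 2) * exp (- s)"
      using eventually_ge_at_top[of 1]
    proof eventually_elim
      case (elim x)
      show ?case
      proof
        fix s :: real assume "s \<in> {0<..}"
        hence s: "s > 0" by simp
        have "x * ((s / sqrt x)\<^sup>2 / 2) \<le> x * (cosh (s / sqrt x) - 1)"
          using elim cosh_real_ge[of "s / sqrt x"] by (intro mult_left_mono) auto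
        also have "x * ((s / sqrt x)\<^sup>2 / 2) = s\<^sup>2 / 2" using elim by (simp add: power_divide)
        finally have 1: "exp (- x * (cosh (s / sqrt x) - 1)) \<le> exp (- (s\<^sup>2 / 2))" by simp
        have "norm (cosh (\<nu> * of_real (s / sqrt x))) \<le> exp (m * (s / sqrt x))"
          using bessel_K_integrand_bound[of "s / sqrt x" \<nu>] elim s by (simp add: m_def)
        also have "s / sqrt x \<le> s / 1" using elim s by (intro divide_left_mono) auto
        hence "exp (m * (s / sqrt x)) \<le> exp (m * s)"
          unfolding exp_le_cancel_iff div_by_1 by (rule mult_left_mono) (simp add: m_def)
        finally have "norm (S x s) \<le> exp (- (s\<^sup>2 / 2)) * exp (m * s)"
          unfolding S_def norm_mult using 1 by (intro mult_mono) auto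
        also have "\<dots> = exp (m * s - s\<^sup>2 / 2)" by (simp flip: exp_add)
        also have "\<dots> \<le> exp ((m + 1)\<^sup>2 / 2 - s)"
        proof -
          have "(s - (m + 1))\<^sup>2 \<ge> 0" by simp
          thus ?thesis by (simp add: power2_eq_square field_simps)
        qed
        also have "\<dots> = exp ((m + 1)\<^sup>2 / 2) * exp (- s)" by (simp flip: exp_add)
        finally show "norm (S x s) \<le> exp ((m + 1)\<^sup>2 / 2) * exp (- s)" .
      qed
    qed
    fix s :: real assume "s \<in> {0<..}"
    hence s: "s > 0" by simp
    have sq: "filterlim sqrt at_top at_top" by (rule sqrt_at_top)
    have 0: "((\<lambda>x. s / sqrt x) \<longlongrightarrow> 0) at_top"
      by (rule tendsto_divide_0[OF tendsto_const]) (rule filterlim_at_top_imp_at_infinity[OF sq])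
    have "filterlim (\<lambda>x. s / sqrt x / 2) (at 0) at_top"
      unfolding filterlim_at
    proof
      show "((\<lambda>x. s / sqrt x / 2) \<longlongrightarrow> 0) at_top" using tendsto_divide[OF 0 tendsto_const[of 2]] by simp
      show "\<forall>\<^sub>F x in at_top. s / sqrt x / 2 \<in> UNIV \<and> s / sqrt x / 2 \<noteq> 0"
        using eventually_gt_at_top[of 0] by eventually_elim (use s in auto)
    qed
    \<comment> \<open>By cosh v - 1 = 2 (sinh (v / 2))^2 the exponent reduces to the limit of sinh v
      / v at 0.\<close>
    from filterlim_compose[OF sinh_over_tendsto this]
    have "((\<lambda>x. - (s\<^sup>2 / 2) * (sinh (s / sqrt x / 2) / (s / sqrt x / 2))\<^sup>2) \<longlongrightarrow> - (s\<^sup>2 / 2) * 1\<^sup>2) at_top"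
      by (intro tendsto_intros)
    hence "((\<lambda>x. - x * (cosh (s / sqrt x) - 1)) \<longlongrightarrow> - (s\<^sup>2 / 2) * 1\<^sup>2) at_top"
    proof (rule Lim_transform_eventually)
      show "\<forall>\<^sub>F x in at_top. - (s\<^sup>2 / 2) * (sinh (s / sqrt x / 2) / (s / sqrt x / 2))\<^sup>2 = - x * (cosh (s / sqrt x) - 1)"
        using eventually_gt_at_top[of 0]
        by eventually_elim (use s in \<open>simp add: cosh_minus_one power_divide field_simps\<close>)
    qed
    from tendsto_of_real[OF tendsto_exp[OF this], where 'a = complex]
    have 1: "((\<lambda>x. of_real (exp (- x * (cosh (s / sqrt x) - 1)))) \<longlongrightarrow> complex_of_real (exp (- (s\<^sup>2) / 2))) at_top"
      by simp
    have "((\<lambda>x. cosh (\<nu> * of_real (s / sqrt x))) \<longlongrightarrow> cosh (\<nu> * of_real 0)) at_top"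
      by (intro tendsto_intros 0)
    from tendsto_mult[OF 1 this] show "((\<lambda>x. S x s) \<longlongrightarrow> complex_of_real (exp (- (s\<^sup>2) / 2))) at_top"
      unfolding S_def by simp
  qed
  also have "(LINT s:{0<..}|lborel. complex_of_real (exp (- (s\<^sup>2) / 2))) = of_real (LINT s:{0<..}|lborel. exp (- (s\<^sup>2) / 2))"
    by (rule set_integral_complex_of_real)
  finally show ?thesis
  proof (rule Lim_transform_eventually)
    show "\<forall>\<^sub>F x in at_top. (LINT s:{0<..}|lborel. S x s) = of_real (sqrt x * exp x) * bessel_K \<nu> x"
      using eventually_gt_at_top[of 0]
    proof eventually_elim
      case (elim x)
      have "bessel_K \<nu> x = \<bar>1 / sqrt x\<bar> *\<^sub>R (LINT s|lborel. indicator {0<..} (0 + 1 / sqrt x * s) *\<^sub>R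
          (of_real (exp (- x * cosh (0 + 1 / sqrt x * s))) * cosh (\<nu> * of_real (0 + 1 / sqrt x * s))))"
        unfolding bessel_K_def set_lebesgue_integral_def using elim by (intro lborel_integral_real_affine) simp
      also have "(LINT s|lborel. indicator {0<..} (0 + 1 / sqrt x * s) *\<^sub>R
          (of_real (exp (- x * cosh (0 + 1 / sqrt x * s))) * cosh (\<nu> * of_real (0 + 1 / sqrt x * s)))) =
          (LINT s:{0<..}|lborel. of_real (exp (- x)) * S x s)"
        unfolding set_lebesgue_integral_def
        by (rule Bochner_Integration.integral_cong)
           (use elim in \<open>auto simp: indicator_def S_def zero_less_divide_iff algebra_simps simp flip: of_real_mult exp_add\<close>)
      also have "\<dots> = of_real (exp (- x)) * (LINT s:{0<..}|lborel. S x s)" by (rule set_integral_mult_right)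
      finally show ?case using elim by (simp add: scaleR_conv_of_real exp_minus field_simps)
    qed
  qed
qed

text \<open>The true order exp (- x) / sqrt x is weakened by sqrt x <= exp x to a pure exponential.
  It is applied at x = pi n / 2, where exp (- 2 x) = exp (- pi n).\<close>

lemma bessel_K_lower_bound:
  obtains c X where "c > 0" "\<And>x. x \<ge> X \<Longrightarrow> norm (bessel_K \<nu> x) \<ge> c * exp (- 2 * x)"
proof -
  define J where "J = (LINT s:{0<..}|lborel. exp (- (s\<^sup>2) / 2) :: real)"
  have ind: "(\<lambda>s::real. indicator {0<..} s *\<^sub>R indicator {0<..<1} s) = (indicator {0<..<1} :: real \<Rightarrow> real)"
    by (auto simp: indicator_def fun_eq_iff)
  have i1: "set_integrable lborel {0<..} (\<lambda>s::real. exp (- (s\<^sup>2) / 2))"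
  proof (rule set_integrable_bound)
    show "set_integrable lborel {0<..} (\<lambda>s::real. exp (1 / 2) * exp (- s))"
      by (intro set_integrable_mult_right set_integrable_exp_minus)
    have "- (s\<^sup>2) / 2 \<le> 1 / 2 + - s" for s :: real
      using zero_le_power2[of "s - 1"] by (simp add: power2_eq_square field_simps)
    thus "AE s in lborel. s \<in> {0<..} \<longrightarrow> norm (exp (- (s\<^sup>2) / 2)) \<le> norm (exp (1 / 2) * exp (- s) :: real)"
      by (simp flip: exp_add)
  qed (intro set_borel_measurable_continuous_greaterThan continuous_intros, auto)
  have i2: "set_integrable lborel {0<..} (\<lambda>s::real. exp (- 1 / 2) * indicator {0<..<1} s :: real)"
    by (intro set_integrable_mult_right) (simp only: set_integrable_def ind, simp)
  \<comment> \<open>Positivity of \<open>J\<close>: on (0, 1) the Gaussian is at least exp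
    (-1/2).\<close>
  have "(LINT s:{0<..}|lborel. exp (- 1 / 2) * indicator {0<..<1::real} s) \<le> J"
    unfolding J_def using i2 i1
  proof (rule set_integral_mono)
    fix s :: real assume "s \<in> {0<..}"
    thus "exp (- 1 / 2) * indicator {0<..<1} s \<le> exp (- (s\<^sup>2) / 2)"
      using power_le_one[of s 2] by (auto simp: indicator_def)
  qed
  also have "(LINT s:{0<..}|lborel. exp (- 1 / 2) * indicator {0<..<1::real} s) = exp (- 1 / 2 :: real)"
  proof -
    have "(LINT s:{0<..}|lborel. indicator {0<..<1::real} s) = (1 :: real)"
      unfolding set_lebesgue_integral_def ind by simp
    thus ?thesis by simp
  qed
  finally have J: "J > 0" by (rule less_le_trans[rotated]) simp
  have "((\<lambda>x. norm (of_real (sqrt x * exp x) * bessel_K \<nu> x)) \<longlongrightarrow> norm (complex_of_real J)) at_top"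
    unfolding J_def by (intro tendsto_norm bessel_K_asymptotics)
  hence "\<forall>\<^sub>F x in at_top. norm (of_real (sqrt x * exp x) * bessel_K \<nu> x) > J / 2"
    by (rule order_tendstoD) (use J in simp)
  hence "\<forall>\<^sub>F x in at_top. norm (bessel_K \<nu> x) \<ge> J / 2 * exp (- 2 * x)"
    using eventually_gt_at_top[of 0]
  proof eventually_elim
    case (elim x)
    have "sqrt x \<le> exp x"
    proof -
      have "1 * x \<le> exp x * exp x"
      proof (intro mult_mono)
        show "x \<le> exp x" using exp_ge_add_one_self[of x] by linarith
      qed (use elim(2) in auto)
      hence "sqrt x \<le> sqrt ((exp x)\<^sup>2)"
        by (intro real_sqrt_le_mono) (simp add: power2_eq_square)
      thus ?thesis by simp
    qed
    hence "sqrt x * exp x * norm (bessel_K \<nu> x) \<le> exp x * exp x * norm (bessel_K \<nu> x)"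
      by (intro mult_right_mono) auto
    moreover have "norm (of_real (sqrt x * exp x) * bessel_K \<nu> x) = sqrt x * exp x * norm (bessel_K \<nu> x)"
      using elim by (simp add: norm_mult)
    ultimately have "J / 2 \<le> exp x * exp x * norm (bessel_K \<nu> x)" using elim(1) by linarith
    hence "J / 2 * exp (- 2 * x) \<le> exp x * exp x * norm (bessel_K \<nu> x) * exp (- 2 * x)" by (rule mult_right_mono) simp
    also have "\<dots> = norm (bessel_K \<nu> x)" by (simp add: mult.commute[of _ "exp (- (2 * x))"] flip: exp_add mult.assoc)
    finally show ?case .
  qed
  then obtain X where "\<And>x. x \<ge> X \<Longrightarrow> norm (bessel_K \<nu> x) \<ge> J / 2 * exp (- 2 * x)"
    by (auto simp: eventually_at_top_linorder)
  with J show ?thesis using that[of "J / 2" X] by auto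
qed

section \<open>Lommel's integral\<close>

definition bessel_coeff :: "complex \<Rightarrow> nat \<Rightarrow> complex" where
  "bessel_coeff \<mu> k = (-1) ^ k * rGamma (\<mu> + of_nat k + 1) / fact k"

text \<open>The Bessel-Clifford function of order \<mu> at - z: J without its branched power, as a
  function of the squared half-argument. In this form it is entire and only even powers of t enter
  the integrals.\<close>

definition bessel_series :: "complex \<Rightarrow> complex \<Rightarrow> complex" where
  "bessel_series \<mu> z = (\<Sum>k. bessel_coeff \<mu> k * z ^ k)"

lemma bessel_J_eq: "bessel_J \<nu> z = (z / 2) powr \<nu> * bessel_series \<nu> ((z / 2)\<^sup>2)"
  by (simp add: bessel_J_def bessel_series_def bessel_coeff_def power_mult)

lemma bessel_coeff_shift: "bessel_coeff \<mu> k = (\<mu> + of_nat k + 1) * bessel_coeff (\<mu> + 1) k"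
proof -
  have "\<mu> + 1 + of_nat k + 1 = \<mu> + of_nat k + 1 + 1" by simp
  thus ?thesis unfolding bessel_coeff_def by (simp only: rGamma_plus1[symmetric, of "\<mu> + of_nat k + 1"]) simp
qed

lemma bessel_coeff_Suc: "of_nat (Suc k) * bessel_coeff \<mu> (Suc k) = - bessel_coeff (\<mu> + 1) k"
proof -
  have "\<mu> + of_nat (Suc k) + 1 = \<mu> + 1 + of_nat k + 1" by simp
  moreover have "of_nat (Suc k) * ((-1) ^ Suc k * r / fact (Suc k)) = - ((-1) ^ k * r / (fact k :: complex))" for r
    unfolding fact_Suc by (simp del: of_nat_Suc)
  ultimately show ?thesis unfolding bessel_coeff_def by (simp only:)
qed

text \<open>Consecutive coefficients have a ratio of modulus at most 1 / ((k + 1/2) (k + 1)) = 4 /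
  ((2 k + 1) (2 k + 2)), the ratio of the coefficients of cosh (2 sqrt z).\<close>

lemma norm_bessel_coeff_le:
  assumes "Re \<mu> > - 1 / 2"
  shows "norm (bessel_coeff \<mu> k) \<le> norm (rGamma (\<mu> + 1)) * 4 ^ k / fact (2 * k)"
proof (induction k)
  case 0
  show ?case by (simp add: bessel_coeff_def)
next
  case (Suc k)
  have r: "norm (\<mu> + of_nat k + 1) \<ge> real k + 1 / 2"
    using complex_Re_le_cmod[of "\<mu> + of_nat k + 1"] assms by simp
  have "norm (bessel_coeff \<mu> k) = norm (\<mu> + of_nat k + 1) * (real k + 1) * norm (bessel_coeff \<mu> (Suc k))"
  proof -
    have "bessel_coeff \<mu> k = - ((\<mu> + of_nat k + 1) * (of_nat (Suc k) * bessel_coeff \<mu> (Suc k)))"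
      unfolding bessel_coeff_Suc using bessel_coeff_shift[of \<mu> k] by simp
    thus ?thesis by (simp only: norm_minus_cancel norm_mult norm_of_nat) simp
  qed
  moreover have "norm (\<mu> + of_nat k + 1) * (real k + 1) * norm (bessel_coeff \<mu> (Suc k)) \<ge>
     (real k + 1 / 2) * (real k + 1) * norm (bessel_coeff \<mu> (Suc k))"
    using r by (intro mult_right_mono) auto
  ultimately have "(real k + 1 / 2) * (real k + 1) * norm (bessel_coeff \<mu> (Suc k)) \<le> norm (rGamma (\<mu> + 1)) * 4 ^ k / fact (2 * k)"
    using Suc.IH by linarith
  hence "norm (bessel_coeff \<mu> (Suc k)) \<le> norm (rGamma (\<mu> + 1)) * 4 ^ k / fact (2 * k) / ((real k + 1 / 2) * (real k + 1))"
    by (simp add: pos_le_divide_eq mult_ac)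
  also have "\<dots> = norm (rGamma (\<mu> + 1)) * 4 ^ Suc k / ((2 * real k + 2) * (2 * real k + 1) * fact (2 * k))"
  proof -
    have "(2 * real k + 2) * (2 * real k + 1) = 4 * ((real k + 1 / 2) * (real k + 1))" by (simp add: algebra_simps)
    thus ?thesis by (simp only: power_Suc) simp
  qed
  also have "(2 * real k + 2) * (2 * real k + 1) * fact (2 * k) = fact (2 * Suc k)"
    by (simp add: algebra_simps)
  finally show ?case .
qed

lemma cosh_even_series: "(\<lambda>k. x ^ (2 * k) / fact (2 * k)) sums cosh (x :: real)"
  using cosh_converges[of x] unfolding sums_even_iff by (simp add: divide_inverse mult.commute)

text \<open>Comparison with the series of cosh (2 sqrt |z|). At z = (t y / 2)^2 the exponent is |t
  y|, the growth that the decay of K has to beat.\<close>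

lemma bessel_series_bounds:
  assumes "Re \<mu> > - 1 / 2"
  shows "summable (\<lambda>k. norm (bessel_coeff \<mu> k * z ^ k))"
    and "norm (bessel_series \<mu> z) \<le> norm (rGamma (\<mu> + 1)) * exp (2 * sqrt (norm z))"
proof -
  define C where "C = norm (rGamma (\<mu> + 1))"
  define x where "x = 2 * sqrt (norm z)"
  have b: "norm (bessel_coeff \<mu> k * z ^ k) \<le> C * (x ^ (2 * k) / fact (2 * k))" for k
  proof -
    have "x ^ (2 * k) = 4 ^ k * norm z ^ k"
      by (simp add: x_def power_mult power_mult_distrib)
    moreover have "norm (bessel_coeff \<mu> k * z ^ k) \<le> C * 4 ^ k / fact (2 * k) * norm z ^ k"
      unfolding norm_mult norm_power C_def by (intro mult_right_mono norm_bessel_coeff_le assms) simp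
    ultimately show ?thesis by (simp add: field_simps)
  qed
  have s: "(\<lambda>k. C * (x ^ (2 * k) / fact (2 * k))) sums (C * cosh x)"
    by (intro sums_mult cosh_even_series)
  show sm: "summable (\<lambda>k. norm (bessel_coeff \<mu> k * z ^ k))"
    by (rule summable_comparison_test'[OF sums_summable[OF s]]) (use b in auto)
  have "norm (bessel_series \<mu> z) \<le> (\<Sum>k. norm (bessel_coeff \<mu> k * z ^ k))"
    unfolding bessel_series_def by (rule summable_norm[OF sm])
  also have "\<dots> \<le> (\<Sum>k. C * (x ^ (2 * k) / fact (2 * k)))"
    by (rule suminf_le[OF b sm sums_summable[OF s]])
  also have "\<dots> = C * cosh x" using s by (rule sums_unique[symmetric])
  also have "\<dots> \<le> C * exp x"
    using cosh_le_exp_abs[of x] by (intro mult_left_mono) (auto simp: C_def x_def)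
  finally show "norm (bessel_series \<mu> z) \<le> norm (rGamma (\<mu> + 1)) * exp (2 * sqrt (norm z))"
    unfolding C_def x_def .
qed

lemma bessel_series_sums:
  "Re \<mu> > - 1 / 2 \<Longrightarrow> (\<lambda>k. bessel_coeff \<mu> k * z ^ k) sums bessel_series \<mu> z"
  unfolding bessel_series_def
  by (rule summable_sums[OF summable_norm_cancel[OF bessel_series_bounds(1)]])

lemma bessel_series_deriv:
  assumes "Re \<mu> > - 1 / 2"
  shows "(bessel_series \<mu> has_field_derivative - bessel_series (\<mu> + 1) z) (at z)"
proof -
  have "((\<lambda>z. \<Sum>k. bessel_coeff \<mu> k * z ^ k) has_field_derivative (\<Sum>k. diffs (bessel_coeff \<mu>) k * z ^ k)) (at z)"
    by (rule termdiffs_strong_converges_everywhere) (rule sums_summable[OF bessel_series_sums[OF assms]])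
  moreover have "diffs (bessel_coeff \<mu>) k = - bessel_coeff (\<mu> + 1) k" for k
    unfolding diffs_def by (rule bessel_coeff_Suc)
  moreover have "(\<Sum>k. - bessel_coeff (\<mu> + 1) k * z ^ k) = - bessel_series (\<mu> + 1) z"
    unfolding bessel_series_def using sums_summable[OF bessel_series_sums[of "\<mu> + 1" z]] assms
    by (simp add: suminf_minus)
  ultimately show ?thesis unfolding bessel_series_def[abs_def] by simp
qed

lemma bessel_series_holomorphic: "Re \<mu> > - 1 / 2 \<Longrightarrow> bessel_series \<mu> holomorphic_on A"
  by (rule holomorphic_on_subset[of _ UNIV]) (auto simp: holomorphic_on_open intro!: exI bessel_series_deriv)

text \<open>The three-term recurrence J_\<mu> + J_(\<mu> + 2) = (2 (\<mu> + 1) / x) J_(\<mu> + 1),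
  freed of powers by z = (x / 2)^2.\<close>

lemma bessel_series_recurrence:
  assumes "Re \<mu> > - 1 / 2"
  shows "bessel_series \<mu> z = (\<mu> + 1) * bessel_series (\<mu> + 1) z - z * bessel_series (\<mu> + 2) z"
proof -
  have 1: "(\<lambda>k. (\<mu> + 1) * (bessel_coeff (\<mu> + 1) k * z ^ k)) sums ((\<mu> + 1) * bessel_series (\<mu> + 1) z)"
    using assms by (intro sums_mult bessel_series_sums) simp
  have "(\<lambda>k. z * (bessel_coeff (\<mu> + 2) k * z ^ k)) sums (z * bessel_series (\<mu> + 2) z)"
    using assms by (intro sums_mult bessel_series_sums) simp
  hence "(\<lambda>k. (case k of 0 \<Rightarrow> 0 | Suc j \<Rightarrow> bessel_coeff (\<mu> + 2) j) * z ^ k) sums (z * bessel_series (\<mu> + 2) z)"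
    by (subst sums_Suc_iff[symmetric, of "\<lambda>k. (case k of 0 \<Rightarrow> 0 | Suc j \<Rightarrow> bessel_coeff (\<mu> + 2) j) * z ^ k", simplified]) (simp add: mult_ac)
  from sums_diff[OF 1 this]
  have "(\<lambda>k. bessel_coeff \<mu> k * z ^ k) sums ((\<mu> + 1) * bessel_series (\<mu> + 1) z - z * bessel_series (\<mu> + 2) z)"
  proof (rule sums_cong[THEN iffD1, rotated])
    fix k
    have c: "(\<mu> + 1) * bessel_coeff (\<mu> + 1) k - (case k of 0 \<Rightarrow> 0 | Suc j \<Rightarrow> bessel_coeff (\<mu> + 2) j) = bessel_coeff \<mu> k"
    proof (cases k)
      case 0
      thus ?thesis using bessel_coeff_shift[of \<mu> 0] by simp
    next
      case (Suc j)
      have "bessel_coeff (\<mu> + 2) j = - of_nat k * bessel_coeff (\<mu> + 1) k"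
      proof -
        have "bessel_coeff (\<mu> + 1 + 1) j = - of_nat (Suc j) * bessel_coeff (\<mu> + 1) (Suc j)"
          unfolding mult_minus_left bessel_coeff_Suc by simp
        thus ?thesis using Suc by (simp only: add.assoc one_add_one)
      qed
      thus ?thesis using Suc bessel_coeff_shift[of \<mu> k] by (simp add: algebra_simps)
    qed
    show "(\<mu> + 1) * (bessel_coeff (\<mu> + 1) k * z ^ k) - (case k of 0 \<Rightarrow> 0 | Suc j \<Rightarrow> bessel_coeff (\<mu> + 2) j) * z ^ k = bessel_coeff \<mu> k * z ^ k"
      unfolding c[symmetric] by (simp add: algebra_simps)
  qed
  thus ?thesis using bessel_series_sums[OF assms] sums_unique2 by blast
qed

text \<open>
  Up to the factor \<open>(\<surd>z / 2) powr \<nu>\<close>, which is removed to make it entire in \<open>z\<close>, this is the classical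
  antiderivative \<open>y (a J\<^sub>\<nu>(\<surd>z y) K\<^bsub>\<nu>+1\<^esub>(a y) - \<surd>z J\<^bsub>\<nu>+1\<^esub>(\<surd>z y) K\<^sub>\<nu>(a y))\<close> of
  \<open>- (a\<^sup>2 + z) y J\<^sub>\<nu>(\<surd>z y) K\<^sub>\<nu>(a y)\<close>.
\<close>

definition lommel :: "complex \<Rightarrow> real \<Rightarrow> complex \<Rightarrow> real \<Rightarrow> complex" where
  "lommel \<nu> a z y = of_real y powr (\<nu> + 1) *
     (of_real a * bessel_series \<nu> (z * (of_real y)\<^sup>2 / 4) * bessel_K (\<nu> + 1) (a * y)
      - z * of_real y / 2 * bessel_series (\<nu> + 1) (z * (of_real y)\<^sup>2 / 4) * bessel_K \<nu> (a * y))"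

text \<open>The polynomial identity behind \<open>lommel_deriv\<close>, with w = y, i = 1 / y, n =
  \<nu> + 1, h = z / 2 and p = y powr (\<nu> + 1). The only relation used is i * w = 1: both sides
  differ by a multiple of i * w - 1.\<close>

lemma lommel_algebra:
  fixes i w p a A K0 n K1 B h :: complex
  assumes "i * w = 1"
  shows "p * ((a * (A * (- a * K0 - n * i * K1) + (- B * (h * w)) * K1)) -
      ((h * w * B) * ((n - 1) * i * K0 - a * K1) + (- 2 * h * (n * B - A) + h * B) * K0))
     + (n * i * p) * (a * A * K1 - h * w * B * K0) = - (a\<^sup>2 + 2 * h) * (p * A * K0)"
proof -
  have "p * ((a * (A * (- a * K0 - n * i * K1) + (- B * (h * w)) * K1)) -
      ((h * w * B) * ((n - 1) * i * K0 - a * K1) + (- 2 * h * (n * B - A) + h * B) * K0))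
     + (n * i * p) * (a * A * K1 - h * w * B * K0) = - (a\<^sup>2 + 2 * h) * (p * A * K0) - (2 * n - 1) * p * h * B * K0 * (i * w - 1)"
    by (simp add: algebra_simps power2_eq_square)
  thus ?thesis using assms by simp
qed

text \<open>Product rule with \<open>bessel_K_deriv\<close> and \<open>bessel_series_deriv\<close>.
  Differentiating the second series creates order \<nu> + 2 (\<open>E\<close>), which the recurrence
  removes; all terms containing \<open>B\<close> or \<open>K1\<close> then cancel.\<close>

lemma lommel_deriv:
  assumes nu: "Re \<nu> > - 1 / 2" and a: "a > 0" and y: "y > 0"
  shows "(lommel \<nu> a z has_vector_derivative
    - (of_real (a\<^sup>2) + z) * (of_real y powr (\<nu> + 1) * bessel_series \<nu> (z * (of_real y)\<^sup>2 / 4) * bessel_K \<nu> (a * y))) (at y)"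
proof -
  have y0: "complex_of_real y \<noteq> 0" "complex_of_real y \<notin> \<real>\<^sub>\<le>\<^sub>0" using y by auto
  have P: "((\<lambda>y. of_real y powr (\<nu> + 1)) has_vector_derivative ((\<nu> + 1) / of_real y * of_real y powr (\<nu> + 1))) (at y)"
  proof (rule has_vector_derivative_real_field)
    show "((\<lambda>w. w powr (\<nu> + 1)) has_field_derivative (\<nu> + 1) / of_real y * of_real y powr (\<nu> + 1)) (at (of_real y))"
      by (rule DERIV_cong[OF has_field_derivative_powr[OF y0(2)]]) (use y0 in \<open>simp add: powr_add\<close>)
  qed
  have S: "((\<lambda>y. bessel_series \<mu> (z * (of_real y)\<^sup>2 / 4)) has_vector_derivative
      (- bessel_series (\<mu> + 1) (z * (of_real y)\<^sup>2 / 4) * (z * of_real y / 2))) (at y)" if "Re \<mu> > - 1 / 2" for \<mu>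
  proof (rule has_vector_derivative_real_field)
    show "((\<lambda>w. bessel_series \<mu> (z * w\<^sup>2 / 4)) has_field_derivative
      - bessel_series (\<mu> + 1) (z * (of_real y)\<^sup>2 / 4) * (z * of_real y / 2)) (at (of_real y))"
      by (rule DERIV_chain2[OF bessel_series_deriv[OF that]]) (auto intro!: derivative_eq_intros simp: field_simps)
  qed
  have ay: "a * y > 0" using a y by simp
  have Ka: "((\<lambda>y. bessel_K \<mu> (a * y)) has_vector_derivative a *\<^sub>R D) (at y)"
    if "(bessel_K \<mu> has_vector_derivative D) (at (a * y))" for \<mu> D
  proof -
    have "((\<lambda>y. a * y) has_vector_derivative a) (at y)"
      unfolding has_real_derivative_iff_has_vector_derivative[symmetric] by (auto intro!: derivative_eq_intros)
    from vector_diff_chain_at[OF this that] show ?thesis by (simp add: o_def)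
  qed
  define K0 where "K0 = bessel_K \<nu> (a * y)"
  define K1 where "K1 = bessel_K (\<nu> + 1) (a * y)"
  define A where "A = bessel_series \<nu> (z * (of_real y)\<^sup>2 / 4)"
  define B where "B = bessel_series (\<nu> + 1) (z * (of_real y)\<^sup>2 / 4)"
  define E where "E = bessel_series (\<nu> + 2) (z * (of_real y)\<^sup>2 / 4)"
  define p where "p = complex_of_real y powr (\<nu> + 1)"
  have k0: "((\<lambda>y. bessel_K \<nu> (a * y)) has_vector_derivative (\<nu> / of_real y * K0 - of_real a * K1)) (at y)"
    by (rule has_vector_derivative_eq_rhs[OF Ka[OF bessel_K_deriv(1)[OF ay, of \<nu>]]])
       (use a y in \<open>simp add: K0_def K1_def scaleR_conv_of_real field_simps\<close>)
  have k1: "((\<lambda>y. bessel_K (\<nu> + 1) (a * y)) has_vector_derivative (- of_real a * K0 - (\<nu> + 1) / of_real y * K1)) (at y)"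
    by (rule has_vector_derivative_eq_rhs[OF Ka[OF bessel_K_deriv(2)[OF ay, of \<nu>]]])
       (use a y in \<open>simp add: K0_def K1_def scaleR_conv_of_real field_simps\<close>)
  have s0: "((\<lambda>y. bessel_series \<nu> (z * (of_real y)\<^sup>2 / 4)) has_vector_derivative (- B * (z * of_real y / 2))) (at y)"
    unfolding B_def by (rule S[OF nu])
  have s1: "((\<lambda>y. bessel_series (\<nu> + 1) (z * (of_real y)\<^sup>2 / 4)) has_vector_derivative (- E * (z * of_real y / 2))) (at y)"
  proof -
    have "\<nu> + 1 + 1 = \<nu> + 2" by simp
    moreover have "Re (\<nu> + 1) > - 1 / 2" using nu by simp
    ultimately show ?thesis using S[of "\<nu> + 1"] unfolding E_def by (simp only:)
  qed
  have rec: "z * of_real y * of_real y * E = 4 * ((\<nu> + 1) * B - A)"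
    using bessel_series_recurrence[OF nu, of "z * (of_real y)\<^sup>2 / 4"]
    unfolding A_def[symmetric] B_def[symmetric] E_def[symmetric] by (simp add: power2_eq_square field_simps)
  have l: "((\<lambda>y. z * of_real y / 2) has_vector_derivative z / 2) (at y)"
    by (rule has_vector_derivative_real_field) (auto intro!: derivative_eq_intros)
  note m = has_vector_derivative_mult
  have T1: "((\<lambda>y. of_real a * bessel_series \<nu> (z * (of_real y)\<^sup>2 / 4) * bessel_K (\<nu> + 1) (a * y)) has_vector_derivative
     (of_real a * (A * (- of_real a * K0 - (\<nu> + 1) / of_real y * K1) + (- B * (z * of_real y / 2)) * K1))) (at y)"
    using has_vector_derivative_mult_right[OF m[OF s0 k1], of "of_real a"]
    by (simp add: A_def[symmetric] K1_def[symmetric] mult.assoc)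
  have T2: "((\<lambda>y. z * of_real y / 2 * bessel_series (\<nu> + 1) (z * (of_real y)\<^sup>2 / 4) * bessel_K \<nu> (a * y)) has_vector_derivative
     ((z * of_real y / 2 * B) * (\<nu> / of_real y * K0 - of_real a * K1) + (z * of_real y / 2 * (- E * (z * of_real y / 2)) + z / 2 * B) * K0)) (at y)"
    using m[OF m[OF l s1] k0] by (simp only: B_def[symmetric] K0_def[symmetric])
  have "(lommel \<nu> a z has_vector_derivative
     (p * ((of_real a * (A * (- of_real a * K0 - (\<nu> + 1) / of_real y * K1) + (- B * (z * of_real y / 2)) * K1)) -
      ((z * of_real y / 2 * B) * (\<nu> / of_real y * K0 - of_real a * K1) + (z * of_real y / 2 * (- E * (z * of_real y / 2)) + z / 2 * B) * K0))
     + ((\<nu> + 1) / of_real y * p) * (of_real a * A * K1 - z * of_real y / 2 * B * K0))) (at y)"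
    using m[OF P has_vector_derivative_diff[OF T1 T2]]
    unfolding lommel_def[abs_def] by (simp only: p_def[symmetric] A_def[symmetric] B_def[symmetric] K0_def[symmetric] K1_def[symmetric])
  moreover have "p * ((of_real a * (A * (- of_real a * K0 - (\<nu> + 1) / of_real y * K1) + (- B * (z * of_real y / 2)) * K1)) -
      ((z * of_real y / 2 * B) * (\<nu> / of_real y * K0 - of_real a * K1) + (z * of_real y / 2 * (- E * (z * of_real y / 2)) + z / 2 * B) * K0))
     + ((\<nu> + 1) / of_real y * p) * (of_real a * A * K1 - z * of_real y / 2 * B * K0) = - (of_real (a\<^sup>2) + z) * (p * A * K0)"
  proof -
    have "z * of_real y / 2 * (- E * (z * of_real y / 2)) = - z * ((\<nu> + 1) * B - A)"
    proof -
      have "z * of_real y / 2 * (- E * (z * of_real y / 2)) = - z / 4 * (z * of_real y * of_real y * E)" by simp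
      also have "\<dots> = - z * ((\<nu> + 1) * B - A)" unfolding rec by simp
      finally show ?thesis .
    qed
    hence e5: "z / 2 * of_real y * (- E * (z / 2 * of_real y)) = - 2 * (z / 2) * ((\<nu> + 1) * B - A)" by simp
    have e1: "(\<nu> + 1) / of_real y = (\<nu> + 1) * inverse (complex_of_real y)" by (rule divide_inverse)
    have e2: "\<nu> / of_real y = (\<nu> + 1 - 1) * inverse (complex_of_real y)" by (simp add: divide_inverse)
    have e3: "z * of_real y / 2 = z / 2 * of_real y" by simp
    have e4: "of_real (a\<^sup>2) + z = (of_real a)\<^sup>2 + 2 * (z / 2)" by simp
    show ?thesis unfolding e1 e2 e3 e4 e5
      by (rule lommel_algebra) (use y0 in simp)
  qed
  ultimately show ?thesis unfolding p_def A_def K0_def by simp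
qed

text \<open>
  For \<open>z = - a\<^sup>2\<close> the derivative in lemma \<open>lommel_deriv\<close> vanishes, so the value can be read off from the
  limit \<open>y \<rightarrow> 0\<close>.
\<close>

lemma lommel_at_imaginary:
  assumes nu: "Re \<nu> > - 1 / 2" and a: "a > 0"
  shows "lommel \<nu> a (- of_real (a\<^sup>2)) 1 = of_real (2 / a) powr \<nu>"
proof -
  define z where "z = - complex_of_real (a\<^sup>2)"
  define \<sigma> where "\<sigma> = Re \<nu> + 1"
  have "(lommel \<nu> a z has_vector_derivative 0) (at y within {0<..})" if "y \<in> {0<..}" for y
    using lommel_deriv[OF nu a, of y z] that by (auto simp: z_def intro: has_vector_derivative_at_within)
  then obtain c where c: "\<And>y. y > 0 \<Longrightarrow> lommel \<nu> a z y = c"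
    using has_vector_derivative_zero_constant[of "{0<..}" "lommel \<nu> a z"] by auto
  have "\<forall>\<^sub>F y in at_right 0. lommel \<nu> a z y = c"
    using eventually_at_right_less[of 0] by eventually_elim (rule c)
  hence lim_c: "(lommel \<nu> a z \<longlongrightarrow> c) (at_right 0)"
    by (rule tendsto_eventually)
  have ay: "filterlim (\<lambda>y. a * y) (at_right 0) (at_right 0)"
  proof -
    have "((\<lambda>y. a * y) \<longlongrightarrow> 0) (at_right 0)" by (auto intro!: tendsto_eq_intros)
    thus ?thesis unfolding filterlim_at using a
      by (auto intro!: eventually_mono[OF eventually_at_right_less[of 0]])
  qed
  have K: "((\<lambda>y. of_real (a * y / 2) powr \<mu> * bessel_K \<mu> (a * y)) \<longlongrightarrow> Gamma \<mu> / 2) (at_right 0)" if "Re \<mu> > 0" for \<mu>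
    using filterlim_compose[OF bessel_K_at_0[OF that] ay] .
  have S: "((\<lambda>y. bessel_series \<mu> (z * (of_real y)\<^sup>2 / 4)) \<longlongrightarrow> rGamma (\<mu> + 1)) (at_right 0)" if "Re \<mu> > - 1 / 2" for \<mu>
  proof -
    have "isCont (bessel_series \<mu>) 0" using bessel_series_deriv[OF that] by (rule DERIV_isCont)
    moreover have "((\<lambda>y. z * (of_real y)\<^sup>2 / 4) \<longlongrightarrow> z * (of_real 0)\<^sup>2 / 4) (at_right 0)"
      by (intro tendsto_intros) simp
    ultimately have "((\<lambda>y. bessel_series \<mu> (z * (of_real y)\<^sup>2 / 4)) \<longlongrightarrow> bessel_series \<mu> 0) (at_right 0)"
      by (intro isCont_tendsto_compose[of 0 "bessel_series \<mu>"]) simp_all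
    moreover have "bessel_series \<mu> 0 = rGamma (\<mu> + 1)"
      unfolding bessel_series_def using powser_zero[of "bessel_coeff \<mu>"] by (simp add: bessel_coeff_def)
    ultimately show ?thesis by simp
  qed
  have y_split: "of_real y powr \<mu> = of_real (2 / a) powr \<mu> * of_real (a * y / 2) powr \<mu>" if "y > 0" for y and \<mu> :: complex
  proof -
    have "of_real (2 / a) powr \<mu> * of_real (a * y / 2) powr \<mu> = (of_real (2 / a) * of_real (a * y / 2)) powr \<mu>"
      using a that by (intro powr_times_real[symmetric]) auto
    also have "of_real (2 / a) * of_real (a * y / 2) = complex_of_real y"
      unfolding of_real_mult[symmetric] using a by simp
    finally show ?thesis by simp
  qed
  define T1 where "T1 y = of_real a * of_real (2 / a) powr (\<nu> + 1) * bessel_series \<nu> (z * (of_real y)\<^sup>2 / 4) *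
     (of_real (a * y / 2) powr (\<nu> + 1) * bessel_K (\<nu> + 1) (a * y))" for y
  define T2 where "T2 y = of_real y powr (\<nu> + 1) * (z * of_real y / 2 * bessel_series (\<nu> + 1) (z * (of_real y)\<^sup>2 / 4) * bessel_K \<nu> (a * y))" for y
  have T1: "(T1 \<longlongrightarrow> of_real a * of_real (2 / a) powr (\<nu> + 1) * rGamma (\<nu> + 1) * (Gamma (\<nu> + 1) / 2)) (at_right 0)"
    unfolding T1_def using nu by (intro tendsto_intros S K) auto
  \<comment> \<open>Re \<nu> may be nonpositive, so K of order \<nu> is compared with the real order
    \<sigma> = Re \<nu> + 1, which is positive and at least |Re \<nu>| since Re \<nu> > -1/2. Its
    singularity is balanced by |y powr (\<nu> + 1)| = y powr \<sigma>; a factor y remains and tends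
    to 0.\<close>
  have T2: "(T2 \<longlongrightarrow> 0) (at_right 0)"
  proof (rule Lim_null_comparison)
    define C where "C = norm z / 2 * (2 / a) powr \<sigma>"
    define N where "N y = norm (of_real (a * y / 2) powr of_real \<sigma> * bessel_K (of_real \<sigma>) (a * y))" for y
    show "\<forall>\<^sub>F y in at_right 0. norm (T2 y) \<le> C * y * norm (bessel_series (\<nu> + 1) (z * (of_real y)\<^sup>2 / 4)) * N y"
      using eventually_at_right_less[of 0]
    proof eventually_elim
      case (elim y)
      have "norm (bessel_K \<nu> (a * y)) \<le> norm (bessel_K (of_real \<sigma>) (a * y))"
        using a elim nu by (intro bessel_K_le) (auto simp: \<sigma>_def)
      moreover have "norm (of_real y powr (\<nu> + 1)) = (2 / a) powr \<sigma> * norm (of_real (a * y / 2) powr complex_of_real \<sigma>)"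
        unfolding y_split[OF elim] norm_mult using a elim by (simp add: norm_powr_real_powr \<sigma>_def)
      ultimately show ?case
        unfolding T2_def N_def C_def using elim
        by (simp add: norm_mult mult_ac mult_left_mono mult_right_mono)
    qed
    have "((\<lambda>y. C * y * norm (bessel_series (\<nu> + 1) (z * (of_real y)\<^sup>2 / 4)) * N y) \<longlongrightarrow>
        C * 0 * norm (rGamma (\<nu> + 1 + 1)) * norm (Gamma (complex_of_real \<sigma>) / 2)) (at_right 0)"
      unfolding N_def using nu by (intro tendsto_intros S K) (auto simp: \<sigma>_def)
    thus "((\<lambda>y. C * y * norm (bessel_series (\<nu> + 1) (z * (of_real y)\<^sup>2 / 4)) * N y) \<longlongrightarrow> 0) (at_right 0)" by simp
  qed
  have "((\<lambda>y. T1 y - T2 y) \<longlongrightarrow> of_real a * of_real (2 / a) powr (\<nu> + 1) * rGamma (\<nu> + 1) * (Gamma (\<nu> + 1) / 2) - 0) (at_right 0)"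
    by (intro tendsto_diff T1 T2)
  also have "of_real a * of_real (2 / a) powr (\<nu> + 1) * rGamma (\<nu> + 1) * (Gamma (\<nu> + 1) / 2) - 0 = of_real (2 / a) powr \<nu>"
  proof -
    have "\<nu> + 1 \<notin> \<int>\<^sub>\<le>\<^sub>0"
    proof
      assume "\<nu> + 1 \<in> \<int>\<^sub>\<le>\<^sub>0"
      then obtain n where "\<nu> + 1 = - of_nat n" by (rule nonpos_Ints_cases')
      hence "Re (\<nu> + 1) = - real n" by simp
      thus False using nu by simp
    qed
    hence "rGamma (\<nu> + 1) * Gamma (\<nu> + 1) = 1" by (simp add: Gamma_def rGamma_eq_zero_iff)
    hence "of_real a * of_real (2 / a) powr (\<nu> + 1) * rGamma (\<nu> + 1) * (Gamma (\<nu> + 1) / 2) = of_real (a / 2) * of_real (2 / a) powr (\<nu> + 1)"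
      by (simp add: field_simps)
    also have "\<dots> = of_real (a / 2) * (of_real (2 / a) powr \<nu> * of_real (2 / a))"
      using a by (simp add: powr_add)
    also have "\<dots> = of_real (2 / a) powr \<nu>" using a by (simp add: field_simps)
    finally show ?thesis by simp
  qed
  finally have "(lommel \<nu> a z \<longlongrightarrow> of_real (2 / a) powr \<nu>) (at_right 0)"
  proof (rule Lim_transform_eventually)
    show "\<forall>\<^sub>F y in at_right 0. T1 y - T2 y = lommel \<nu> a z y"
      using eventually_at_right_less[of 0]
    proof eventually_elim
      case (elim y)
      show ?case unfolding lommel_def T1_def T2_def right_diff_distrib y_split[OF elim, of "\<nu> + 1"] by (simp add: mult_ac)
    qed
  qed
  from tendsto_unique[OF _ lim_c this] c[of 1] show ?thesis by (simp add: z_def)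
qed

section \<open>The tail of Lommel's integral\<close>

lemma powr_le_exp:
  obtains B where "B \<ge> 0" "\<And>y::real. y \<ge> 1 \<Longrightarrow> y powr p \<le> B * exp y"
proof -
  obtain n :: nat where "p \<le> real n" using real_arch_simple by blast
  then obtain N :: nat where N: "p \<le> real N" "N > 0" by (intro that[of "Suc n"]) auto
  have "y powr p \<le> real N ^ N * exp y" if "y \<ge> 1" for y
  proof -
    have "y powr p \<le> y powr real N" using that N by (intro powr_mono) auto
    also have "\<dots> = y ^ N" using that by (simp add: powr_realpow)
    also have "\<dots> = real N ^ N * (y / real N) ^ N" using N by (simp add: power_divide)
    also have "(y / real N) ^ N \<le> (1 + y / real N) ^ N" using that N by (intro power_mono) auto
    also have "\<dots> \<le> exp y" using that N by (intro exp_ge_one_plus_x_over_n_power_n) auto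
    finally show ?thesis by (simp add: mult_left_mono)
  qed
  thus ?thesis using that[of "real N ^ N"] by auto
qed

text \<open>One exp y pays for the power of y, the other for the Bessel series with t <= 1.
  \<open>D\<close> does not depend on a or t, so one constant serves all terms of the Fourier
  series.\<close>

lemma lommel_integrand_bound:
  assumes "Re \<mu> > - 1 / 2"
  obtains D where "D \<ge> 0" "\<And>a t y. a \<ge> 1 \<Longrightarrow> 0 \<le> t \<Longrightarrow> t \<le> 1 \<Longrightarrow> y \<ge> 1 \<Longrightarrow>
    norm (of_real y powr \<rho> * bessel_series \<mu> (of_real (t\<^sup>2) * (of_real y)\<^sup>2 / 4) * bessel_K \<kappa> (a * y)) \<le> D * exp (2 * y - a * y)"
proof -
  obtain B where B: "B \<ge> 0" "\<And>y::real. y \<ge> 1 \<Longrightarrow> y powr Re \<rho> \<le> B * exp y" using powr_le_exp by blast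
  obtain M where M: "M \<ge> 0" "\<And>x. x \<ge> 1 \<Longrightarrow> norm (bessel_K \<kappa> x) \<le> M * exp (- x)" using bessel_K_exp_bound by blast
  define G where "G = norm (rGamma (\<mu> + 1))"
  have "norm (of_real y powr \<rho> * bessel_series \<mu> (of_real (t\<^sup>2) * (of_real y)\<^sup>2 / 4) * bessel_K \<kappa> (a * y)) \<le> (B * G * M) * exp (2 * y - a * y)" (is "?N \<le> _")
    if "a \<ge> 1" "0 \<le> t" "t \<le> 1" "y \<ge> 1" for a t y
  proof -
    have 1: "norm (complex_of_real y powr \<rho>) \<le> B * exp y"
      using B(2)[OF that(4)] that by (simp add: norm_powr_real_powr)
    let ?z = "complex_of_real (t\<^sup>2) * (of_real y)\<^sup>2 / 4"
    have "?z = of_real ((t * y / 2)\<^sup>2)"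
      by (simp add: power_mult_distrib power_divide)
    hence "2 * sqrt (norm (?z)) = t * y"
      using that by (simp only: norm_of_real) simp
    moreover have "t * y \<le> y" using that by (simp add: mult_left_le_one_le)
    ultimately have 2: "norm (bessel_series \<mu> (?z)) \<le> G * exp y"
      using bessel_series_bounds(2)[OF assms, of ?z] unfolding G_def
      by (smt (verit) exp_le_cancel_iff mult_left_mono norm_ge_zero)
    have "1 * 1 \<le> a * y" using that by (intro mult_mono) auto
    hence 3: "norm (bessel_K \<kappa> (a * y)) \<le> M * exp (- (a * y))" using M(2) by simp
    have "?N \<le> (B * exp y) * (G * exp y) * (M * exp (- (a * y)))"
      unfolding norm_mult using B(1) by (intro mult_mono 1 2 3 mult_nonneg_nonneg) (auto simp: G_def)
    also have "\<dots> = (B * G * M) * (exp y * exp y * exp (- (a * y)))" by simp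
    also have "exp y * exp y * exp (- (a * y)) = exp (2 * y - a * y)" by (simp flip: exp_add)
    finally show ?thesis .
  qed
  thus ?thesis using B(1) M(1) that[of "B * G * M"] by (simp add: G_def)
qed

text \<open>Fundamental theorem of calculus with the antiderivative \<open>lommel\<close>. Since a
  >= 4, the factor exp (2 y - a y) decays, so the boundary term at infinity vanishes and only the
  one at 1 remains.\<close>

lemma lommel_tail:
  assumes nu: "Re \<nu> > - 1 / 2" and a: "a \<ge> 4" and t: "0 \<le> t" "t \<le> 1"
  defines "f \<equiv> (\<lambda>y. of_real y powr (\<nu> + 1) * bessel_series \<nu> (of_real (t\<^sup>2) * (of_real y)\<^sup>2 / 4) * bessel_K \<nu> (a * y))"
  shows "set_integrable lborel {1<..} f"
    and "of_real (t\<^sup>2 + a\<^sup>2) * (LINT y:{1<..}|lborel. f y) = lommel \<nu> a (of_real (t\<^sup>2)) 1"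
proof -
  have a0: "a > 0" "a \<ge> 1" using a by auto
  have int1: "set_integrable lborel {1<..} (\<lambda>y::real. D * exp (- y))" for D :: real
    by (intro set_integrable_mult_right set_integrable_subset[OF set_integrable_exp_minus]) auto
  have S_cont: "continuous_on A (\<lambda>y. bessel_series \<nu> (of_real (t\<^sup>2) * (of_real y)\<^sup>2 / 4))" for A
    by (rule continuous_on_compose2[OF holomorphic_on_imp_continuous_on[OF bessel_series_holomorphic[OF nu, of UNIV]]])
       (auto intro!: continuous_intros)
  have f_cont: "continuous_on {0<..} f"
    unfolding f_def using a0 by (intro continuous_intros S_cont continuous_on_compose2[OF continuous_on_bessel_K]) auto
  obtain D where D: "D \<ge> 0" "\<And>y. y \<ge> 1 \<Longrightarrow> norm (f y) \<le> D * exp (2 * y - a * y)"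
    using lommel_integrand_bound[OF nu, of "\<nu> + 1" \<nu>] a0 t unfolding f_def by metis
  show int: "set_integrable lborel {1<..} f"
  proof (rule set_integrable_bound[OF int1])
    show "set_borel_measurable lborel {1<..} f"
      by (rule set_borel_measurable_continuous_greaterThan, rule continuous_on_subset[OF f_cont]) auto
    show "AE y in lborel. y \<in> {1<..} \<longrightarrow> norm (f y) \<le> norm (D * exp (- y))"
    proof (intro AE_I2 impI)
      fix y :: real assume y: "y \<in> {1<..}"
      have "3 * y \<le> a * y" using a y by (intro mult_right_mono) auto
      hence "D * exp (2 * y - a * y) \<le> D * exp (- y)" using D(1) by (intro mult_left_mono) auto
      thus "norm (f y) \<le> norm (D * exp (- y))" using D(2)[of y] y D(1) by (simp add: abs_mult)
    qed
  qed
  define F where "F = lommel \<nu> a (of_real (t\<^sup>2))"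
  have deriv: "(F has_vector_derivative - of_real (t\<^sup>2 + a\<^sup>2) * f y) (at y)" if "y > 0" for y
    using lommel_deriv[OF nu a0(1) that, of "of_real (t\<^sup>2)"] unfolding F_def f_def by (simp add: add.commute)
  have "(LBINT y=ereal 1..\<infinity>. - of_real (t\<^sup>2 + a\<^sup>2) * f y) = 0 - F 1"
  proof (rule interval_integral_FTC_integrable)
    show "(F has_vector_derivative - of_real (t\<^sup>2 + a\<^sup>2) * f y) (at y)" if "ereal 1 < ereal y" for y
      using that by (intro deriv) simp
    show "isCont (\<lambda>y. - of_real (t\<^sup>2 + a\<^sup>2) * f y) y" if "ereal 1 < ereal y" for y
      using that f_cont by (intro continuous_intros) (auto simp: continuous_on_eq_continuous_at)
    show "set_integrable lborel (einterval (ereal 1) \<infinity>) (\<lambda>y. - of_real (t\<^sup>2 + a\<^sup>2) * f y)"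
      using int by simp
    have "isCont F 1" using deriv[of 1] by (intro has_vector_derivative_continuous) simp
    thus "((F \<circ> real_of_ereal) \<longlongrightarrow> F 1) (at_right (ereal 1))"
      unfolding ereal_tendsto_simps1 by (auto simp: isCont_def filterlim_at_split)
    let ?z = "\<lambda>y. of_real (t\<^sup>2) * (of_real y)\<^sup>2 / (4 :: complex)"
    obtain D1 where D1: "D1 \<ge> 0" "\<And>y. y \<ge> 1 \<Longrightarrow> norm (of_real y powr (\<nu> + 1) * bessel_series \<nu> (?z y) * bessel_K (\<nu> + 1) (a * y)) \<le> D1 * exp (2 * y - a * y)"
      using lommel_integrand_bound[OF nu, of "\<nu> + 1" "\<nu> + 1"] a0 t by metis
    have nu1: "Re (\<nu> + 1) > - 1 / 2" using nu by simp
    obtain D2 where D2: "D2 \<ge> 0" "\<And>y. y \<ge> 1 \<Longrightarrow> norm (of_real y powr (\<nu> + 2) * bessel_series (\<nu> + 1) (?z y) * bessel_K \<nu> (a * y)) \<le> D2 * exp (2 * y - a * y)"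
      using lommel_integrand_bound[OF nu1, of "\<nu> + 2" \<nu>] a0 t by metis
    have "(F \<longlongrightarrow> 0) at_top"
    proof (rule Lim_null_comparison)
      show "\<forall>\<^sub>F y in at_top. norm (F y) \<le> (a * D1 + t\<^sup>2 / 2 * D2) * exp (- y)"
        using eventually_ge_at_top[of 1]
      proof eventually_elim
        case (elim y)
        have "F y = of_real a * (of_real y powr (\<nu> + 1) * bessel_series \<nu> (?z y) * bessel_K (\<nu> + 1) (a * y))
           - of_real (t\<^sup>2 / 2) * (of_real y powr (\<nu> + 2) * bessel_series (\<nu> + 1) (?z y) * bessel_K \<nu> (a * y))"
        proof -
          have "of_real y powr (\<nu> + 2) = of_real y powr (\<nu> + 1) * complex_of_real y"
            using elim powr_add[of "complex_of_real y" "\<nu> + 1" 1] by (simp add: add.assoc)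
          thus ?thesis unfolding F_def lommel_def by (simp add: algebra_simps)
        qed
        also have "norm \<dots> \<le> a * (D1 * exp (2 * y - a * y)) + t\<^sup>2 / 2 * (D2 * exp (2 * y - a * y))"
        proof (rule order_trans[OF norm_triangle_ineq4], rule add_mono)
          have aux: "norm (of_real r * X) \<le> r * Y" if "r \<ge> 0" "norm X \<le> Y" for r Y and X :: complex
            using that by (simp add: norm_mult mult_left_mono)
          show "norm (of_real a * (of_real y powr (\<nu> + 1) * bessel_series \<nu> (?z y) * bessel_K (\<nu> + 1) (a * y))) \<le> a * (D1 * exp (2 * y - a * y))"
            by (rule aux) (use D1(2)[OF elim] a0 in auto)
          show "norm (of_real (t\<^sup>2 / 2) * (of_real y powr (\<nu> + 2) * bessel_series (\<nu> + 1) (?z y) * bessel_K \<nu> (a * y))) \<le> t\<^sup>2 / 2 * (D2 * exp (2 * y - a * y))"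
            by (rule aux) (use D2(2)[OF elim] in auto)
        qed
        also have "\<dots> = (a * D1 + t\<^sup>2 / 2 * D2) * exp (2 * y - a * y)" by (simp add: algebra_simps)
        also have "\<dots> \<le> (a * D1 + t\<^sup>2 / 2 * D2) * exp (- y)"
        proof -
          have "3 * y \<le> a * y" using a elim by (intro mult_right_mono) auto
          thus ?thesis using D1(1) D2(1) a0 by (intro mult_left_mono) auto
        qed
        finally show ?case .
      qed
      have "((\<lambda>y::real. exp (- y)) \<longlongrightarrow> 0) at_top"
        by (rule filterlim_compose[OF exp_at_bot filterlim_uminus_at_bot_at_top])
      thus "((\<lambda>y. (a * D1 + t\<^sup>2 / 2 * D2) * exp (- y)) \<longlongrightarrow> 0) at_top" by (rule tendsto_mult_right_zero)
    qed
    thus "((F \<circ> real_of_ereal) \<longlongrightarrow> 0) (at_left \<infinity>)" by (simp add: ereal_tendsto_simps1)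
  qed simp
  hence "(LINT y:{1<..}|lborel. - of_real (t\<^sup>2 + a\<^sup>2) * f y) = - F 1"
    by (simp add: interval_lebesgue_integral_def)
  thus "of_real (t\<^sup>2 + a\<^sup>2) * (LINT y:{1<..}|lborel. f y) = lommel \<nu> a (of_real (t\<^sup>2)) 1"
    unfolding set_integral_mult_right F_def by (simp add: algebra_simps)
qed

section \<open>Fourier coefficients of cusp forms\<close>

text \<open>Invariance under z -> - 1 / z reflects (0, 1] to [1, \<infinity>), where the decay
  condition with exponent 0 is a plain bound.\<close>

lemma even_maass_cusp_form_imaginary_axis:
  assumes "even_maass_cusp_form q u"
  shows "continuous_on {0<..} (\<lambda>y. u (Complex 0 y))"
    and "\<exists>B\<ge>0. \<forall>y. 0 < y \<longrightarrow> y \<le> 1 \<longrightarrow> norm (u (Complex 0 y)) \<le> B"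
proof -
  have "C_k_on 0 upper_half_plane u" using assms by (simp add: even_maass_cusp_form_def smooth_on_def)
  hence "continuous_on upper_half_plane u" by simp
  thus "continuous_on {0<..} (\<lambda>y. u (Complex 0 y))"
    by (rule continuous_on_compose2) (auto intro!: continuous_intros simp: upper_half_plane_def Complex_eq)
  obtain B where B: "\<And>z. Im z \<ge> 1 \<Longrightarrow> norm (u z) \<le> B / Im z ^ 0"
    using assms unfolding even_maass_cusp_form_def by blast
  have B0: "B \<ge> 0" using order_trans[OF norm_ge_zero B[of \<i>]] by simp
  have "norm (u (Complex 0 y)) \<le> B" if y: "0 < y" "y \<le> 1" for y
  proof -
    have "(0::int) * 0 - (- 1) * 1 = 1 \<longrightarrow>
        (\<forall>z\<in>upper_half_plane. u ((of_int 0 * z + of_int (- 1)) / (of_int 1 * z + of_int 0)) = u z)"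
      using assms unfolding even_maass_cusp_form_def by blast
    hence "u (- 1 / Complex 0 y) = u (Complex 0 y)"
      using y by (auto simp: upper_half_plane_def)
    moreover have "- 1 / Complex 0 y = Complex 0 (1 / y)"
      using y by (simp add: complex_eq_iff Re_divide Im_divide power2_eq_square)
    ultimately show ?thesis using B[of "Complex 0 (1 / y)"] y by simp
  qed
  thus "\<exists>B\<ge>0. \<forall>y. 0 < y \<longrightarrow> y \<le> 1 \<longrightarrow> norm (u (Complex 0 y)) \<le> B" using B0 by blast
qed

section \<open>The transform phi, cut at y = 1\<close>

lemma of_real_sqrt_powr: "x > 0 \<Longrightarrow> complex_of_real (sqrt x) = of_real x powr (1 / 2)"
  using powr_of_real[of x "1 / 2"] by (simp add: powr_half_sqrt)

lemma of_real_mult_powr: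
  "x \<ge> 0 \<Longrightarrow> y \<ge> 0 \<Longrightarrow> of_real (x * y) powr z = of_real x powr z * (of_real y powr z :: complex)"
  using powr_times_real[of "of_real x" "of_real y" z] by simp

text \<open>The powers t^(1 - q), t^(q - 1/2) and t^(1/2) multiply to t. This is the purpose of the
  normalising factor in phi: what remains under the integral depends on t^2 only and is entire in
  it.\<close>

lemma phi_transform_eq:
  assumes t: "t > 0"
  shows "phi_transform q u t = of_real t * of_real 2 powr (1 / 2 - q) *
    (LINT y:{0<..}|lborel. of_real y powr q * bessel_series (q - 1 / 2) (of_real (t\<^sup>2) * (of_real y)\<^sup>2 / 4) * u (Complex 0 y))"
proof -
  have "of_real t powr (1 - q) * (bessel_J (q - 1 / 2) (of_real (t * y)) * of_real (sqrt (t * y)) * u (Complex 0 y)) =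
     of_real t * of_real 2 powr (1 / 2 - q) * (of_real y powr q * bessel_series (q - 1 / 2) (of_real (t\<^sup>2) * (of_real y)\<^sup>2 / 4) * u (Complex 0 y))"
    if y: "y > 0" for y
  proof -
    have ty0: "complex_of_real t \<noteq> 0" "complex_of_real y \<noteq> 0" using t y by auto
    have "complex_of_real (t * y) / 2 = of_real (t * (y * (1 / 2)))" by simp
    hence "(of_real (t * y) / 2) powr (q - 1 / 2) = complex_of_real (t * (y * (1 / 2))) powr (q - 1 / 2)" by (simp only:)
    also have "\<dots> = of_real t powr (q - 1 / 2) * (of_real y powr (q - 1 / 2) * of_real (1 / 2) powr (q - 1 / 2))"
      using t y by (subst of_real_mult_powr; (subst of_real_mult_powr)?; simp)
    also have "of_real (1 / 2) powr (q - 1 / 2) = of_real 2 powr (1 / 2 - q)"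
    proof -
      have "complex_of_real (1 / 2) powr (q - 1 / 2) * of_real 2 powr (q - 1 / 2) = (complex_of_real (1 / 2) * of_real 2) powr (q - 1 / 2)"
        by (rule powr_times_real[symmetric]) auto
      hence "complex_of_real (1 / 2) powr (q - 1 / 2) = inverse (of_real 2 powr (q - 1 / 2))"
        by (simp add: field_simps)
      also have "\<dots> = of_real 2 powr (- (q - 1 / 2))" by (rule powr_minus[symmetric])
      finally show ?thesis by simp
    qed
    finally have P: "(of_real (t * y) / 2) powr (q - 1 / 2) =
      of_real t powr (q - 1 / 2) * (of_real y powr (q - 1 / 2) * of_real 2 powr (1 / 2 - q))" .
    have S: "of_real (sqrt (t * y)) = of_real t powr (1 / 2) * complex_of_real y powr (1 / 2)"
      using t y by (simp add: real_sqrt_mult of_real_sqrt_powr)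
    have T: "of_real t powr (1 - q) * (of_real t powr (q - 1 / 2) * of_real t powr (1 / 2)) = complex_of_real t"
      using ty0 by (simp flip: powr_add)
    have Y: "of_real y powr (q - 1 / 2) * of_real y powr (1 / 2) = complex_of_real y powr q"
      by (simp flip: powr_add)
    have A: "(of_real (t * y) / 2)\<^sup>2 = of_real (t\<^sup>2) * (complex_of_real y)\<^sup>2 / 4"
      by (simp add: power_mult_distrib power_divide)
    show ?thesis
      unfolding bessel_J_eq P S A
      by (subst T[symmetric], subst Y[symmetric]) (simp only: mult_ac)
  qed
  hence "(LINT y:{0<..}|lborel. of_real t powr (1 - q) * (bessel_J (q - 1 / 2) (of_real (t * y)) * of_real (sqrt (t * y)) * u (Complex 0 y))) =
     (LINT y:{0<..}|lborel. of_real t * of_real 2 powr (1 / 2 - q) * (of_real y powr q * bessel_series (q - 1 / 2) (of_real (t\<^sup>2) * (of_real y)\<^sup>2 / 4) * u (Complex 0 y)))"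
    by (intro set_lebesgue_integral_cong) auto
  thus ?thesis unfolding phi_transform_def set_integral_mult_right .
qed

text \<open>Integrate the Bessel series termwise. The moments \<open>m k\<close> are bounded by
  \<open>B\<close> because |y powr q| <= 1 on (0, 1], so the resulting series in t^2 / 4 converges
  everywhere.\<close>

lemma near_zero_integral:
  fixes h :: "real \<Rightarrow> complex"
  assumes q: "Re q > 0" and h: "continuous_on {0<..} h" and B: "B \<ge> 0" "\<And>y. 0 < y \<Longrightarrow> y \<le> 1 \<Longrightarrow> norm (h y) \<le> B"
  defines "m \<equiv> (\<lambda>k. LINT y:{0<..1}|lborel. of_real y powr q * of_real (y ^ (2 * k)) * h y)"
    and "H \<equiv> (\<lambda>t y. of_real y powr q * bessel_series (q - 1 / 2) (of_real (t\<^sup>2) * (of_real y)\<^sup>2 / 4) * h y)"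
  shows "set_integrable lborel {0<..1} (H t)"
    and "(LINT y:{0<..1}|lborel. H t y) = (\<Sum>k. bessel_coeff (q - 1 / 2) k * m k * (of_real (t\<^sup>2) / 4) ^ k)"
    and "norm (m k) \<le> B"
proof -
  have nu: "Re (q - 1 / 2) > - 1 / 2" using q by simp
  define g where "g k y = of_real y powr q * of_real (y ^ (2 * k)) * h y" for k y
  have gb: "norm (g k y) \<le> B" if "y \<in> {0<..1}" for k y
  proof -
    have "y powr Re q \<le> 1 powr Re q" using that q by (intro powr_mono2) auto
    hence "norm (complex_of_real y powr q) \<le> 1" using that by (simp add: norm_powr_real_powr)
    moreover have "norm (complex_of_real (y ^ (2 * k))) \<le> 1"
      using that by (simp add: norm_power power_le_one)
    ultimately have "norm (g k y) \<le> 1 * 1 * B"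
      unfolding g_def norm_mult using B that by (intro mult_mono) auto
    thus ?thesis by simp
  qed
  have intB: "set_integrable lborel {0<..1} (\<lambda>y::real. B)" by (simp add: set_integrable_def)
  have gm: "set_borel_measurable lborel {0<..1} (g k)" for k
    unfolding set_borel_measurable_def g_def
    by (simp, rule borel_measurable_continuous_on_indicator)
       (auto intro!: continuous_intros continuous_on_subset[OF h])
  have gi: "set_integrable lborel {0<..1} (g k)" for k
    by (rule set_integrable_bound[OF intB gm]) (use gb B in auto)
  have LB: "(LINT y:{0<..1}|lborel. norm (g k y)) \<le> B" for k
  proof -
    have "(LINT y:{0<..1}|lborel. norm (g k y)) \<le> (LINT y:{0<..1::real}|lborel. B)"
      by (rule set_integral_mono[OF set_integrable_norm[OF gi] intB gb])
    also have "\<dots> = B" by (simp add: set_lebesgue_integral_def)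
    finally show ?thesis .
  qed
  show "norm (m k) \<le> B"
    unfolding m_def using set_integral_norm_bound[OF gi[of k]] LB[of k] by (simp add: g_def)
  define w where "w = complex_of_real (t\<^sup>2) / 4"
  define b where "b k = bessel_coeff (q - 1 / 2) k * w ^ k" for k
  have bs: "summable (\<lambda>k. norm (b k))" unfolding b_def by (rule bessel_series_bounds(1)[OF nu])
  define F where "F k y = indicator {0<..1} y *\<^sub>R (b k * g k y)" for k y
  have Fi: "integrable lborel (F k)" for k
    using set_integrable_mult_right[OF gi, of "b k"] by (simp add: F_def[abs_def] set_integrable_def)
  have Fb: "norm (F k y) \<le> norm (b k) * B" for k y
    using gb[of y k] B(1) by (auto simp: F_def indicator_def norm_mult intro!: mult_left_mono)
  have Fs: "AE y in lborel. summable (\<lambda>k. norm (F k y))"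
    by (intro AE_I2 summable_comparison_test'[OF summable_mult2[OF bs, of B], of 0]) (use Fb in auto)
  have FI: "summable (\<lambda>k. LINT y|lborel. norm (F k y))"
  proof (rule summable_comparison_test'[OF summable_mult2[OF bs, of B], of 0])
    fix k
    have "(LINT y|lborel. norm (F k y)) = norm (b k) * (LINT y:{0<..1}|lborel. norm (g k y))"
      unfolding set_integral_mult_right[symmetric] unfolding set_lebesgue_integral_def
      by (rule Bochner_Integration.integral_cong) (auto simp: F_def norm_mult)
    also have "\<dots> \<le> norm (b k) * B" by (intro mult_left_mono LB) auto
    finally show "norm (LINT y|lborel. norm (F k y)) \<le> norm (b k) * B" by simp
  qed
  have sumF: "(\<Sum>k. F k y) = indicator {0<..1} y *\<^sub>R H t y" for y
  proof (cases "y \<in> {0<..1}")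
    case True
    let ?z = "complex_of_real (t\<^sup>2) * (of_real y)\<^sup>2 / 4"
    have "(\<lambda>k. (of_real y powr q * h y) * (bessel_coeff (q - 1 / 2) k * ?z ^ k)) sums
       ((of_real y powr q * h y) * bessel_series (q - 1 / 2) ?z)"
      by (intro sums_mult bessel_series_sums nu)
    moreover have "(of_real y powr q * h y) * (bessel_coeff (q - 1 / 2) k * ?z ^ k) = F k y" for k
    proof -
      have "complex_of_real (y ^ (2 * k)) = ((of_real y)\<^sup>2) ^ k" unfolding of_real_power by (rule power_mult)
      thus ?thesis using True unfolding F_def b_def g_def w_def
        by (simp only: power_mult_distrib power_divide) (simp add: mult_ac)
    qed
    ultimately show ?thesis using True by (simp add: H_def sums_iff mult_ac)
  next
    case False
    thus ?thesis by (simp add: F_def)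
  qed
  show "set_integrable lborel {0<..1} (H t)"
    using integrable_suminf[OF Fi Fs FI] unfolding sumF set_integrable_def .
  have Fk: "(LINT y|lborel. F k y) = b k * m k" for k
    using set_integral_mult_right[of lborel "{0<..1}" "b k" "g k"]
    unfolding F_def m_def g_def[abs_def] set_lebesgue_integral_def by simp
  have "(LINT y:{0<..1}|lborel. H t y) = (\<Sum>k. LINT y|lborel. F k y)"
    using integral_suminf[OF Fi Fs FI] unfolding sumF set_lebesgue_integral_def .
  also have "\<dots> = (\<Sum>k. b k * m k)" by (simp only: Fk)
  finally show "(LINT y:{0<..1}|lborel. H t y) = (\<Sum>k. bessel_coeff (q - 1 / 2) k * m k * (of_real (t\<^sup>2) / 4) ^ k)"
    by (simp add: b_def w_def mult_ac)
qed

text \<open>The summands of the convergent Fourier series at \<open>x = 0\<close>, \<open>y = 1/4\<close> are bounded.\<close>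

lemma fourier_coefficients_bound:
  assumes "fourier_coefficients q u c"
  obtains C where "C \<ge> 0" "\<And>n. norm (c (Suc n)) \<le> C * exp (pi * real (Suc n))"
proof -
  define K where "K n = bessel_K (q - 1 / 2) (pi * real (Suc n) / 2)" for n
  have "(\<lambda>n. of_real (sqrt (1 / 4)) * (c (Suc n) * bessel_K (q - 1/2) (2 * pi * real (Suc n) * (1 / 4)) *
               of_real (cos (2 * pi * real (Suc n) * 0)))) sums u (Complex 0 (1 / 4))"
    using assms unfolding fourier_coefficients_def by (rule allE[of _ 0]) (auto elim!: allE[of _ "1/4"])
  hence "(\<lambda>n. of_real (1 / 2) * (c (Suc n) * K n)) sums u (Complex 0 (1 / 4))"
    by (simp add: K_def real_sqrt_divide)
  hence "summable (\<lambda>n. of_real (1 / 2) * (c (Suc n) * K n))" by (rule sums_summable)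
  hence "Bseq (\<lambda>n. of_real (1 / 2) * (c (Suc n) * K n))"
    by (intro convergent_imp_Bseq convergentI[OF summable_LIMSEQ_zero])
  then obtain b where b: "b > 0" "\<And>n. norm (of_real (1 / 2) * (c (Suc n) * K n)) \<le> b"
    by (auto simp: Bseq_def)
  obtain d X where d: "d > 0" "\<And>x. x \<ge> X \<Longrightarrow> norm (bessel_K (q - 1 / 2) x) \<ge> d * exp (- 2 * x)"
    using bessel_K_lower_bound by blast
  obtain N :: nat where N: "X \<le> real N" using real_arch_simple by blast
  have "Bseq (\<lambda>n. c (Suc (n + N)) / of_real (exp (pi * real (Suc (n + N)))))"
  proof (rule BseqI')
    fix n
    \<comment> \<open>The argument 2 pi n y at y = 1/4; the lower bound exp (- 2 x) for K becomes
      exp (- pi n), valid from \<open>N\<close> on.\<close>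
    define x where "x = pi * real (Suc (n + N)) / 2"
    have "1 * real N \<le> (pi / 2) * real (Suc (n + N))" using pi_gt3 by (intro mult_mono) auto
    hence "x \<ge> X" using N by (simp add: x_def)
    hence K: "norm (K (n + N)) \<ge> d * exp (- (pi * real (Suc (n + N))))"
      using d(2)[of x] by (simp add: K_def x_def)
    have "norm (c (Suc (n + N))) * (d * exp (- (pi * real (Suc (n + N))))) \<le> norm (c (Suc (n + N))) * norm (K (n + N))"
      by (intro mult_left_mono K) simp
    also have "\<dots> \<le> 2 * b" using b(2)[of "n + N"] by (simp add: norm_mult)
    finally show "norm (c (Suc (n + N)) / of_real (exp (pi * real (Suc (n + N))))) \<le> 2 * b / d"
      using d(1) by (simp add: norm_divide exp_minus field_simps del: of_nat_Suc)
  qed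
  hence "Bseq (\<lambda>n. c (Suc n) / of_real (exp (pi * real (Suc n))))"
    by (rule Bseq_offset[of "\<lambda>n. c (Suc n) / of_real (exp (pi * real (Suc n)))" N])
  then obtain C where C: "C > 0" "\<And>n. norm (c (Suc n) / of_real (exp (pi * real (Suc n)))) \<le> C"
    by (auto simp: Bseq_def)
  have "norm (c (Suc n)) \<le> C * exp (pi * real (Suc n))" for n
    using C(2)[of n] by (simp add: norm_divide divide_le_eq del: of_nat_Suc)
  thus ?thesis using that[of C] C(1) by auto
qed

text \<open>Termwise integration of the Fourier expansion, justified by a majorant that is a product
  of a summable term in n and an integrable function of y; each term is then Lommel's
  integral.\<close>

lemma tail_integral:
  assumes q: "Re q > 0" and c: "fourier_coefficients q u c" and t: "0 \<le> t" "t \<le> 1"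
  defines "H \<equiv> (\<lambda>y. of_real y powr q * bessel_series (q - 1 / 2) (of_real (t\<^sup>2) * (of_real y)\<^sup>2 / 4) * u (Complex 0 y))"
  shows "set_integrable lborel {1<..} H"
    and "(LINT y:{1<..}|lborel. H y) = (\<Sum>n. c (Suc n) * lommel (q - 1 / 2) (2 * pi * real (Suc n)) (of_real (t\<^sup>2)) 1 /
           of_real (t\<^sup>2 + (2 * pi * real (Suc n))\<^sup>2))"
proof -
  define \<nu> where "\<nu> = q - 1 / 2"
  have nu: "Re \<nu> > - 1 / 2" using q by (simp add: \<nu>_def)
  define a where "a n = 2 * pi * real (Suc n)" for n
  have a_ge: "a n \<ge> 4" for n
  proof -
    have "2 * pi * 1 \<le> a n" unfolding a_def by (intro mult_left_mono) auto
    thus ?thesis using pi_gt3 by simp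
  qed
  define f where "f n y = of_real y powr (\<nu> + 1) * bessel_series \<nu> (of_real (t\<^sup>2) * (of_real y)\<^sup>2 / 4) * bessel_K \<nu> (a n * y)" for n y
  have fi: "set_integrable lborel {1<..} (f n)" for n
    unfolding f_def by (rule lommel_tail(1)[OF nu a_ge t])
  obtain C where C: "C \<ge> 0" "\<And>n. norm (c (Suc n)) \<le> C * exp (pi * real (Suc n))"
    using fourier_coefficients_bound[OF c] by blast
  obtain D where D: "D \<ge> 0" "\<And>a t y. a \<ge> 1 \<Longrightarrow> 0 \<le> t \<Longrightarrow> t \<le> 1 \<Longrightarrow> y \<ge> 1 \<Longrightarrow>
    norm (of_real y powr (\<nu> + 1) * bessel_series \<nu> (of_real (t\<^sup>2) * (of_real y)\<^sup>2 / 4) * bessel_K \<nu> (a * y)) \<le> D * exp (2 * y - a * y)"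
    using lommel_integrand_bound[OF nu] by blast
  define E where "E n = C * D * exp (- (real (Suc n) / 2))" for n
  have E: "summable E"
  proof -
    have "summable (\<lambda>n. (exp (- (1 / 2))) ^ Suc n :: real)"
      by (subst summable_Suc_iff, rule summable_geometric) simp
    hence "summable (\<lambda>n. C * D * (exp (- (1 / 2))) ^ Suc n)" by (rule summable_mult)
    thus ?thesis unfolding E_def exp_of_nat_mult[symmetric] by (simp add: algebra_simps)
  qed
  have bound: "norm (c (Suc n) * f n y) \<le> E n * exp (- (1 / 2) * y)" if y: "y > 1" for n y
  proof -
    define N where "N = real (Suc n)"
    have N: "N \<ge> 1" by (simp add: N_def)
    have "norm (c (Suc n) * f n y) \<le> (C * exp (pi * N)) * (D * exp (2 * y - a n * y))"
      unfolding norm_mult[of "c (Suc n)"] f_def N_def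
    proof (rule mult_mono[OF C(2) D(2)])
      show "0 \<le> C * exp (pi * real (Suc n))" using C(1) by simp
    qed (use a_ge[of n] y t in auto)
    also have "\<dots> = C * D * exp (pi * N + 2 * y - a n * y)" by (simp add: exp_add exp_diff)
    \<comment> \<open>With a n = 2 pi N and N, y >= 1: pi N <= pi N y, so the left side is at most 2
      y - 3 N y <= - N y, and N y is at least both N and y.\<close>
    also have "pi * N + 2 * y - a n * y \<le> - (N / 2) - y / 2"
    proof -
      have "pi * N * 1 \<le> pi * N * y" using y N by (intro mult_left_mono) auto
      hence 1: "pi * N \<le> pi * (N * y)" by (simp add: mult.assoc)
      have 2: "3 * (N * y) \<le> pi * (N * y)" using y N pi_gt3 by (intro mult_right_mono) auto
      have 3: "1 * y \<le> N * y" using y N by (intro mult_right_mono) auto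
      have 4: "N * 1 \<le> N * y" using y N by (intro mult_left_mono) auto
      have "a n * y = 2 * (pi * (N * y))" by (simp add: a_def N_def)
      thus ?thesis using 1 2 3 4 by linarith
    qed
    hence "C * D * exp (pi * N + 2 * y - a n * y) \<le> C * D * exp (- (N / 2) - y / 2)"
      using C(1) D(1) by (intro mult_left_mono) auto
    also have "\<dots> = E n * exp (- (1 / 2) * y)"
    proof -
      have "exp (- (N / 2) - y / 2) = exp (- (N / 2)) * exp (- (1 / 2) * y)" by (simp flip: exp_add)
      thus ?thesis by (simp only: E_def N_def mult.assoc)
    qed
    finally show ?thesis .
  qed
  define F where "F n y = indicator {1<..} y *\<^sub>R (c (Suc n) * f n y)" for n y
  have Fi: "integrable lborel (F n)" for n
    using set_integrable_mult_right[OF fi, of "c (Suc n)"] by (simp add: F_def[abs_def] set_integrable_def)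
  have Fb: "norm (F n y) \<le> E n * (indicator {1<..} y *\<^sub>R exp (- (1 / 2) * y))" for n y
    using bound[of y n] by (auto simp: F_def indicator_def)
  have Fs: "AE y in lborel. summable (\<lambda>n. norm (F n y))"
    by (intro AE_I2, rule summable_comparison_test'[OF summable_mult2[OF E], of 0]) (use Fb in auto)
  have ei: "integrable lborel (\<lambda>y::real. indicator {1<..} y *\<^sub>R exp (- (1 / 2) * y))"
    using set_integrable_subset[OF set_integrable_exp_mult_minus[of "1 / 2"], of "{1<..}"]
    by (simp add: set_integrable_def)
  have FI: "summable (\<lambda>n. LINT y|lborel. norm (F n y))"
  proof (rule summable_comparison_test'[OF summable_mult2[OF E], of 0])
    fix n
    have "(LINT y|lborel. norm (F n y)) \<le> (LINT y|lborel. E n * (indicator {1<..} y *\<^sub>R exp (- (1 / 2) * y)))"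
      by (rule integral_mono[OF integrable_norm[OF Fi] _ Fb]) (intro integrable_mult_right ei)
    thus "norm (LINT y|lborel. norm (F n y)) \<le> E n * (LINT y|lborel. indicator {1<..} y *\<^sub>R exp (- (1 / 2) * (y::real)))"
      by simp
  qed
  have sumF: "(\<Sum>n. F n y) = indicator {1<..} y *\<^sub>R H y" for y
  proof (cases "y > 1")
    case True
    hence y: "y > 0" by simp
    let ?p = "of_real y powr q * bessel_series \<nu> (of_real (t\<^sup>2) * (of_real y)\<^sup>2 / 4)"
    have "(\<lambda>n. of_real (sqrt y) * (c (Suc n) * bessel_K (q - 1/2) (2 * pi * real (Suc n) * y) *
               of_real (cos (2 * pi * real (Suc n) * 0)))) sums u (Complex 0 y)"
      using c y unfolding fourier_coefficients_def by blast
    from sums_mult[OF this, of ?p] have "(\<lambda>n. ?p * (of_real (sqrt y) * (c (Suc n) * bessel_K \<nu> (a n * y)))) sums (?p * u (Complex 0 y))"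
      by (simp add: a_def \<nu>_def)
    moreover have "?p * (of_real (sqrt y) * (c (Suc n) * bessel_K \<nu> (a n * y))) = F n y" for n
    proof -
      have "of_real y powr q * of_real (sqrt y) = complex_of_real y powr (\<nu> + 1)"
        unfolding of_real_sqrt_powr[OF y] powr_add[symmetric] by (simp add: \<nu>_def add.commute)
      thus ?thesis using True by (simp add: F_def f_def mult_ac)
    qed
    ultimately show ?thesis using True by (simp add: H_def \<nu>_def sums_iff)
  next
    case False
    thus ?thesis by (simp add: F_def)
  qed
  show "set_integrable lborel {1<..} H"
    using integrable_suminf[OF Fi Fs FI] unfolding sumF set_integrable_def .
  have Fn: "(LINT y|lborel. F n y) = c (Suc n) * lommel \<nu> (a n) (of_real (t\<^sup>2)) 1 / of_real (t\<^sup>2 + (a n)\<^sup>2)" for n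
  proof -
    have "(LINT y|lborel. F n y) = c (Suc n) * (LINT y:{1<..}|lborel. f n y)"
      using set_integral_mult_right[of lborel "{1<..}" "c (Suc n)" "f n"]
      unfolding F_def set_lebesgue_integral_def by simp
    moreover have "of_real (t\<^sup>2 + (a n)\<^sup>2) * (LINT y:{1<..}|lborel. f n y) = lommel \<nu> (a n) (of_real (t\<^sup>2)) 1"
      unfolding f_def by (rule lommel_tail(2)[OF nu a_ge t])
    moreover have "complex_of_real (t\<^sup>2 + (a n)\<^sup>2) \<noteq> 0"
      unfolding of_real_eq_0_iff using a_ge[of n] by (simp add: sum_power2_eq_zero_iff)
    ultimately show ?thesis by (metis nonzero_mult_div_cancel_left times_divide_eq_right)
  qed
  have "(LINT y:{1<..}|lborel. H y) = (\<Sum>n. LINT y|lborel. F n y)"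
    using integral_suminf[OF Fi Fs FI] unfolding sumF set_lebesgue_integral_def .
  thus "(LINT y:{1<..}|lborel. H y) = (\<Sum>n. c (Suc n) * lommel (q - 1 / 2) (2 * pi * real (Suc n)) (of_real (t\<^sup>2)) 1 /
           of_real (t\<^sup>2 + (2 * pi * real (Suc n))\<^sup>2))"
    unfolding Fn unfolding \<nu>_def a_def .
qed

section \<open>The power series of the associated sequence\<close>

lemma norm_rGamma_shift_le:
  assumes "Re z > 0"
  shows "norm (rGamma (z + 1 + of_nat k)) \<le> norm (rGamma (z + 1)) / fact k"
proof (induction k)
  case (Suc k)
  have "real (Suc k) \<le> norm (z + 1 + of_nat k)"
    using complex_Re_le_cmod[of "z + 1 + of_nat k"] assms by simp
  hence "real (Suc k) * norm (rGamma (z + 1 + of_nat (Suc k))) \<le> norm (z + 1 + of_nat k) * norm (rGamma (z + 1 + of_nat (Suc k)))"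
    by (rule mult_right_mono) simp
  also have "\<dots> = norm (rGamma (z + 1 + of_nat k))"
    unfolding norm_mult[symmetric] using rGamma_plus1[of "z + 1 + of_nat k"] by (simp add: add_ac)
  also note Suc.IH
  finally show ?case by (simp add: field_simps del: of_nat_Suc)
qed simp

text \<open>The root condition gives |a n| <= 2^n eventually, any base above 1 being possible, and 1
  / Gamma (n + 2 q) is O(1 / (n - 1)!). Hence comparison with the exponential series.\<close>

lemma associated_series_summable:
  assumes q: "Re q > 0" and a: "limsup (\<lambda>n. ereal (root n (norm (a n)))) \<le> 1"
  shows "summable (\<lambda>n. (- 1) ^ n * a n / Gamma (of_nat n + 2 * q) * z ^ n)"
proof -
  have "limsup (\<lambda>n. ereal (root n (norm (a n)))) < 2"
    by (rule le_less_trans[OF a]) simp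
  from Limsup_lessD[OF this] have "\<forall>\<^sub>F n in sequentially. ereal (root n (norm (a n))) < 2" .
  hence ev: "\<forall>\<^sub>F n in sequentially. norm (a n) \<le> 2 ^ n"
    using eventually_gt_at_top[of 0]
  proof eventually_elim
    case (elim n)
    have "root n (norm (a n)) ^ n \<le> 2 ^ n" using elim by (intro power_mono) auto
    thus ?case using elim(2) by simp
  qed
  define R where "R = norm (rGamma (2 * q + 1))"
  have "\<forall>\<^sub>F n in sequentially. norm ((- 1) ^ Suc n * a (Suc n) / Gamma (of_nat (Suc n) + 2 * q) * z ^ Suc n) \<le> 2 * R * norm z * ((2 * norm z) ^ n /\<^sub>R fact n)"
    using ev[THEN eventually_all_ge_at_top]
  proof eventually_elim
    case (elim n)
    hence an: "norm (a (Suc n)) \<le> 2 ^ Suc n" by (meson le_SucI order_refl)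
    have "norm (rGamma (2 * q + 1 + of_nat n)) \<le> R / fact n"
      unfolding R_def by (rule norm_rGamma_shift_le) (use q in simp)
    moreover have "2 * q + 1 + of_nat n = of_nat (Suc n) + 2 * q" by simp
    ultimately have G: "norm (rGamma (of_nat (Suc n) + 2 * q)) \<le> R / fact n" by (simp only:)
    have "norm ((- 1) ^ Suc n * a (Suc n) / Gamma (of_nat (Suc n) + 2 * q) * z ^ Suc n) =
        norm (a (Suc n)) * norm (rGamma (of_nat (Suc n) + 2 * q)) * norm z ^ Suc n"
      unfolding divide_inverse rGamma_inverse_Gamma[symmetric] norm_mult norm_power by simp
    also have "\<dots> \<le> 2 ^ Suc n * (R / fact n) * norm z ^ Suc n"
      by (intro mult_mono an G mult_nonneg_nonneg) (auto simp: R_def)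
    also have "\<dots> = 2 * R * norm z * ((2 * norm z) ^ n /\<^sub>R fact n)"
      by (simp add: power_mult_distrib divide_inverse)
    finally show ?case .
  qed
  hence "summable (\<lambda>n. (- 1) ^ Suc n * a (Suc n) / Gamma (of_nat (Suc n) + 2 * q) * z ^ Suc n)"
    by (rule summable_comparison_test_ev) (intro summable_mult summable_exp_generic)
  thus ?thesis by (subst (asm) summable_Suc_iff)
qed

lemma power_series_holomorphic:
  fixes b :: "nat \<Rightarrow> complex"
  assumes "\<And>z. summable (\<lambda>n. b n * z ^ n)"
  shows "(\<lambda>z. \<Sum>n. b n * z ^ n) holomorphic_on A"
  by (rule holomorphic_on_subset[of _ UNIV])
     (auto simp: holomorphic_on_open intro!: exI termdiffs_strong_converges_everywhere assms)

text \<open>Identity theorem with accumulation point 1/2. It carries the formula for phi, available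
  for real t in (0, 1), to the nodes on the imaginary axis.\<close>

lemma entire_eq_if_eq_on_unit_interval:
  assumes "f holomorphic_on UNIV" "g holomorphic_on UNIV"
    and "\<And>t. 0 < t \<Longrightarrow> t < 1 \<Longrightarrow> f (of_real t) = g (of_real t)"
  shows "f z = g z"
proof -
  have "complex_of_real (1 / 2) islimpt (complex_of_real ` {0<..<1})"
    unfolding islimpt_approachable
  proof (intro allI impI)
    fix e :: real assume e: "e > 0"
    define d where "d = min (e / 2) (1 / 4)"
    have d: "0 < d" "d < 1 / 2" "d < e" using e by (auto simp: d_def)
    have "dist (complex_of_real (1 / 2 + d)) (of_real (1 / 2)) = d"
      unfolding dist_of_real using d by (simp add: dist_real_def)
    moreover have "complex_of_real (1 / 2 + d) \<noteq> of_real (1 / 2)"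
      unfolding of_real_eq_iff using d by simp
    moreover have "complex_of_real (1 / 2 + d) \<in> complex_of_real ` {0<..<1}" using d by (intro imageI) auto
    ultimately show "\<exists>x'\<in>complex_of_real ` {0<..<1}. x' \<noteq> of_real (1 / 2) \<and> dist x' (of_real (1 / 2)) < e"
      using d(3) by metis
  qed
  moreover have "(\<lambda>z. f z - g z) holomorphic_on UNIV" by (intro holomorphic_intros assms)
  moreover have "f z - g z = 0" if "z \<in> complex_of_real ` {0<..<1}" for z
    using that assms(3) by auto
  ultimately have "f z - g z = 0"
    using analytic_continuation[of "\<lambda>z. f z - g z" UNIV "complex_of_real ` {0<..<1}" "complex_of_real (1 / 2)" z]
    by (metis UNIV_I connected_UNIV open_UNIV subset_UNIV)
  thus ?thesis by simp
qed

lemma lommel_one: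
  "lommel \<nu> a z 1 = of_real a * bessel_series \<nu> (z / 4) * bessel_K (\<nu> + 1) a - z / 2 * bessel_series (\<nu> + 1) (z / 4) * bessel_K \<nu> a"
  by (simp add: lommel_def)

lemma lommel_holomorphic:
  assumes "Re \<nu> > - 1 / 2"
  shows "(\<lambda>z. lommel \<nu> a (z\<^sup>2) 1) holomorphic_on UNIV"
proof -
  have S: "(\<lambda>z. bessel_series \<mu> (z\<^sup>2 / 4)) holomorphic_on UNIV" if "Re \<mu> > - 1 / 2" for \<mu>
  proof -
    have "(\<lambda>z::complex. z\<^sup>2 / 4) holomorphic_on UNIV" by (intro holomorphic_intros) auto
    from holomorphic_on_compose[OF this bessel_series_holomorphic[OF that]] show ?thesis by (simp add: o_def)
  qed
  show ?thesis unfolding lommel_one using assms by (intro holomorphic_intros S) auto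
qed

text \<open>At y = 1 the factor exp (- 2 pi n) of K beats exp (pi n) from the coefficients, with
  room for the linear factor 2 pi n in \<open>lommel\<close>. The weights are thus bounded uniformly
  in n on each disc.\<close>

lemma fourier_lommel_bound:
  assumes q: "Re q > 0" and c: "fourier_coefficients q u c"
  shows "\<exists>M. summable (\<lambda>n. M n / (real (Suc n))\<^sup>2) \<and> (\<forall>n z. norm z \<le> R \<longrightarrow>
     norm (c (Suc n) * lommel (q - 1 / 2) (2 * pi * real (Suc n)) (z\<^sup>2) 1) \<le> M n)"
proof -
  define \<nu> where "\<nu> = q - 1 / 2"
  have nu: "Re \<nu> > - 1 / 2" "Re (\<nu> + 1) > - 1 / 2" using q by (simp_all add: \<nu>_def)
  obtain C where C: "C \<ge> 0" "\<And>n. norm (c (Suc n)) \<le> C * exp (pi * real (Suc n))"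
    using fourier_coefficients_bound[OF c] by blast
  obtain M0 where M0: "M0 \<ge> 0" "\<And>x. x \<ge> 1 \<Longrightarrow> norm (bessel_K \<nu> x) \<le> M0 * exp (- x)" using bessel_K_exp_bound by blast
  obtain M1 where M1: "M1 \<ge> 0" "\<And>x. x \<ge> 1 \<Longrightarrow> norm (bessel_K (\<nu> + 1) x) \<le> M1 * exp (- x)" using bessel_K_exp_bound by blast
  define S where "S \<mu> = norm (rGamma (\<mu> + 1)) * exp R" for \<mu> :: complex
  have S0: "S \<mu> \<ge> 0" for \<mu> by (simp add: S_def)
  have S: "norm (bessel_series \<mu> (z\<^sup>2 / 4)) \<le> S \<mu>" if "norm z \<le> R" "Re \<mu> > - 1 / 2" for \<mu> z
  proof -
    have "norm (z\<^sup>2 / 4) = (norm z / 2)\<^sup>2" by (simp add: norm_divide norm_power power_divide)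
    hence "2 * sqrt (norm (z\<^sup>2 / 4)) = norm z" by simp
    hence "norm (bessel_series \<mu> (z\<^sup>2 / 4)) \<le> norm (rGamma (\<mu> + 1)) * exp (norm z)"
      using bessel_series_bounds(2)[OF that(2), of "z\<^sup>2 / 4"] by simp
    also have "\<dots> \<le> S \<mu>" unfolding S_def using that by (intro mult_left_mono) auto
    finally show ?thesis .
  qed
  define K where "K = C * (2 * S \<nu> * M1 + R\<^sup>2 / 2 * S (\<nu> + 1) * M0)"
  have "norm (c (Suc n) * lommel \<nu> (2 * pi * real (Suc n)) (z\<^sup>2) 1) \<le> K" if z: "norm z \<le> R" for n z
  proof -
    define x where "x = pi * real (Suc n)"
    have "3 * 1 \<le> pi * real (Suc n)" using pi_gt3 by (intro mult_mono) auto
    hence x: "x \<ge> 1" unfolding x_def by simp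
    have "x \<le> exp x" using exp_ge_add_one_self[of x] by linarith
    hence xe: "x * exp (- x) \<le> 1" "exp (- x) \<le> 1"
      using x by (simp_all add: exp_minus field_simps)
    have a: "2 * pi * real (Suc n) = 2 * x" by (simp add: x_def)
    have z2: "norm (z\<^sup>2 / 2) \<le> R\<^sup>2 / 2"
      using power_mono[OF z norm_ge_zero, of 2] by (simp add: norm_divide norm_power)
    have "norm (lommel \<nu> (2 * x) (z\<^sup>2) 1) \<le> 2 * x * S \<nu> * (M1 * exp (- (2 * x))) + R\<^sup>2 / 2 * S (\<nu> + 1) * (M0 * exp (- (2 * x)))"
      unfolding lommel_one
    proof (rule order_trans[OF norm_triangle_ineq4], rule add_mono)
      show "norm (of_real (2 * x) * bessel_series \<nu> (z\<^sup>2 / 4) * bessel_K (\<nu> + 1) (2 * x)) \<le> 2 * x * S \<nu> * (M1 * exp (- (2 * x)))"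
        unfolding norm_mult using x S[OF z nu(1)] M1(2)[of "2 * x"] S0[of \<nu>] by (intro mult_mono) auto
      show "norm (z\<^sup>2 / 2 * bessel_series (\<nu> + 1) (z\<^sup>2 / 4) * bessel_K \<nu> (2 * x)) \<le> R\<^sup>2 / 2 * S (\<nu> + 1) * (M0 * exp (- (2 * x)))"
        unfolding norm_mult using x S[OF z nu(2)] M0(2)[of "2 * x"] S0[of "\<nu> + 1"] z2 by (intro mult_mono) auto
    qed
    hence "norm (c (Suc n) * lommel \<nu> (2 * x) (z\<^sup>2) 1) \<le> (C * exp x) * (2 * x * S \<nu> * (M1 * exp (- (2 * x))) + R\<^sup>2 / 2 * S (\<nu> + 1) * (M0 * exp (- (2 * x))))"
      unfolding norm_mult using C(2)[of n] C(1) by (intro mult_mono) (auto simp: x_def)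
    also have "\<dots> = C * (exp x * exp (- (2 * x))) * (2 * S \<nu> * M1 * x + R\<^sup>2 / 2 * S (\<nu> + 1) * M0)"
      by (simp add: algebra_simps)
    also have "exp x * exp (- (2 * x)) = exp (- x)" by (simp flip: exp_add)
    also have "C * exp (- x) * (2 * S \<nu> * M1 * x + R\<^sup>2 / 2 * S (\<nu> + 1) * M0) = C * (2 * S \<nu> * M1 * (x * exp (- x)) + R\<^sup>2 / 2 * S (\<nu> + 1) * M0 * exp (- x))"
      by (simp add: algebra_simps)
    also have "\<dots> \<le> C * (2 * S \<nu> * M1 * 1 + R\<^sup>2 / 2 * S (\<nu> + 1) * M0 * 1)"
      using C(1) S0 M0(1) M1(1) by (intro mult_left_mono add_mono xe mult_nonneg_nonneg) auto
    finally show ?thesis unfolding a K_def by simp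
  qed
  moreover have "summable (\<lambda>n. K / (real (Suc n))\<^sup>2)"
    using summable_mult[OF summable_inverse_squares, of K] by simp
  ultimately show ?thesis unfolding \<nu>_def by (intro exI[of _ "\<lambda>_. K"]) auto
qed

text \<open>\<open>F\<close> is (exp t - 1) * phi and \<open>G\<close> is the same function computed
  from the two pieces of the integral. They agree on (0, 1), hence everywhere, and are compared at
  the nodes.\<close>

lemma fourier_coefficient_formula:
  assumes q: "Re q > 0" and u: "even_maass_cusp_form q u" and c: "fourier_coefficients q u c"
    and a: "associated_sequence q u a" and n: "n \<ge> 1"
  defines "s \<equiv> (\<lambda>k. (-1) ^ Suc k * a (2 * Suc k) / Gamma (of_nat (2 * Suc k) + 2 * q) * of_real (2 * pi * real n) ^ (2 * Suc k))"
  shows "summable s" and "c n = of_real (2 * pi) powr (q - 1/2) * (2 * of_nat n powr (q - 1/2) * suminf s)"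
proof -
  define \<nu> where "\<nu> = q - 1 / 2"
  have nu: "Re \<nu> > - 1 / 2" using q by (simp add: \<nu>_def)
  define b where "b k = (- 1) ^ k * a k / Gamma (of_nat k + 2 * q)" for k
  have b0: "b 0 = 0" using a by (simp add: b_def associated_sequence_def)
  have bs: "summable (\<lambda>k. b k * z ^ k)" for z
    unfolding b_def using a q by (intro associated_series_summable) (auto simp: associated_sequence_def)
  define F where "F z = (\<Sum>k. b k * z ^ k)" for z
  have F: "(\<lambda>k. b k * z ^ k) sums F z" for z unfolding F_def by (rule summable_sums[OF bs])
  have F_holo: "F holomorphic_on UNIV" unfolding F_def by (rule power_series_holomorphic[OF bs])
  define h where "h y = u (Complex 0 y)" for y
  have h_cont: "continuous_on {0<..} h"
    unfolding h_def by (rule even_maass_cusp_form_imaginary_axis(1)[OF u])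
  obtain B where B: "B \<ge> 0" "\<And>y. 0 < y \<Longrightarrow> y \<le> 1 \<Longrightarrow> norm (h y) \<le> B"
    using even_maass_cusp_form_imaginary_axis(2)[OF u] unfolding h_def by blast
  define m where "m k = (LINT y:{0<..1}|lborel. of_real y powr q * of_real (y ^ (2 * k)) * h y)" for k
  define e where "e w = (\<Sum>k. bessel_coeff \<nu> k * m k * w ^ k)" for w
  have "summable (\<lambda>k. bessel_coeff \<nu> k * m k * w ^ k)" for w
  proof (rule summable_comparison_test'[OF summable_mult2[OF bessel_series_bounds(1)[OF nu, of w], of B], of 0])
    fix k
    have "norm (bessel_coeff \<nu> k * w ^ k * m k) \<le> norm (bessel_coeff \<nu> k * w ^ k) * B"
      unfolding norm_mult[of "bessel_coeff \<nu> k * w ^ k"] m_def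
      by (rule mult_left_mono[OF near_zero_integral(3)[OF q h_cont B] norm_ge_zero])
    thus "norm (bessel_coeff \<nu> k * m k * w ^ k) \<le> norm (bessel_coeff \<nu> k * w ^ k) * B" by (simp add: mult_ac)
  qed
  hence e_holo: "e holomorphic_on UNIV" unfolding e_def by (rule power_series_holomorphic)
  define w where "w k z = c (Suc k) * lommel \<nu> (2 * pi * real (Suc k)) (z\<^sup>2) 1" for k z
  have w_holo: "w k holomorphic_on UNIV" for k
    unfolding w_def by (intro holomorphic_intros lommel_holomorphic nu)
  note w_bound = fourier_lommel_bound[OF q c, folded \<nu>_def, folded w_def]
  define W where "W z = (\<Sum>k. w k z * exp_kernel (Suc k) z)" for z
  have W_holo: "W holomorphic_on UNIV" unfolding W_def by (rule exp_kernel_series_holomorphic[OF w_holo w_bound])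
  \<comment> \<open>(exp z - 1) * z times the integral: \<open>e\<close> is the part over (0, 1],
    \<open>W\<close> the tail. The kernel has numerator 2 z (exp z - 1), hence
    \<open>W z / 2\<close>.\<close>
  define G where "G z = of_real 2 powr (- \<nu>) * ((exp z - 1) * z * e (z\<^sup>2 / 4) + W z / 2)" for z
  have "(\<lambda>z. e (z\<^sup>2 / 4)) holomorphic_on UNIV"
  proof -
    have "(\<lambda>z::complex. z\<^sup>2 / 4) holomorphic_on UNIV" by (intro holomorphic_intros) auto
    from holomorphic_on_compose[OF this holomorphic_on_subset[OF e_holo]] show ?thesis by (simp add: o_def)
  qed
  hence G_holo: "G holomorphic_on UNIV" unfolding G_def by (intro holomorphic_intros W_holo) auto
  have FG: "F (of_real t) = G (of_real t)" if t: "0 < t" "t < 1" for t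
  proof -
    define H where "H y = of_real y powr q * bessel_series \<nu> (of_real (t\<^sup>2) * (of_real y)\<^sup>2 / 4) * h y" for y
    have et: "exp t - 1 > 0" using t by simp
    have "phi_transform q u t = of_real (exp (- t) / (1 - exp (- t))) *
        (\<Sum>n. (-1) ^ Suc n * a (Suc n) * of_real t ^ Suc n / Gamma (of_nat (Suc n) + 2 * q))"
      using a t unfolding associated_sequence_def by blast
    also have "(\<Sum>n. (-1) ^ Suc n * a (Suc n) * of_real t ^ Suc n / Gamma (of_nat (Suc n) + 2 * q)) = (\<Sum>n. b (Suc n) * of_real t ^ Suc n)"
      by (simp add: b_def)
    also have "\<dots> = F (of_real t)"
      unfolding F_def using suminf_split_head[OF bs, of "of_real t"] b0 by simp
    also have "exp (- t) / (1 - exp (- t)) = 1 / (exp t - 1)" using et by (simp add: exp_minus field_simps)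
    finally have 1: "F (of_real t) = of_real (exp t - 1) * phi_transform q u t" using et by simp
    have i1: "set_integrable lborel {0<..1} H" "(LINT y:{0<..1}|lborel. H y) = e ((of_real t)\<^sup>2 / 4)"
      using near_zero_integral(1,2)[OF q h_cont B, of t] unfolding H_def e_def m_def \<nu>_def by simp_all
    have i2: "set_integrable lborel {1<..} H" "(LINT y:{1<..}|lborel. H y) =
       (\<Sum>k. w k (of_real t) / of_real (t\<^sup>2 + (2 * pi * real (Suc k))\<^sup>2))"
      using tail_integral[OF q c, of t] t unfolding H_def w_def \<nu>_def h_def by simp_all
    have "(LINT y:{0<..1} \<union> {1<..}|lborel. H y) = e ((of_real t)\<^sup>2 / 4) + (\<Sum>k. w k (of_real t) / of_real (t\<^sup>2 + (2 * pi * real (Suc k))\<^sup>2))"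
      unfolding i1(2)[symmetric] i2(2)[symmetric] by (rule set_integral_Un[OF _ i1(1) i2(1)]) auto
    moreover have "{0<..1} \<union> {1<..} = {0::real<..}" by auto
    ultimately have 2: "phi_transform q u t = of_real t * of_real 2 powr (- \<nu>) * (e ((of_real t)\<^sup>2 / 4) + (\<Sum>k. w k (of_real t) / of_real (t\<^sup>2 + (2 * pi * real (Suc k))\<^sup>2)))"
      using phi_transform_eq[OF t(1), of q u] unfolding H_def h_def \<nu>_def by simp
    have "(exp (of_real t) - 1) * of_real t * (\<Sum>k. w k (of_real t) / of_real (t\<^sup>2 + (2 * pi * real (Suc k))\<^sup>2)) = W (of_real t) / 2"
    proof -
      have kern: "w k (of_real t) * exp_kernel (Suc k) (of_real t) = (2 * of_real t * (exp (of_real t) - 1)) * (w k (of_real t) / of_real (t\<^sup>2 + (2 * pi * real (Suc k))\<^sup>2))" for k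
      proof -
        have "t\<^sup>2 + (2 * pi * real (Suc k))\<^sup>2 \<noteq> 0" using t by (simp add: sum_power2_eq_zero_iff)
        hence "complex_of_real (t\<^sup>2 + (2 * pi * real (Suc k))\<^sup>2) \<noteq> 0" by (subst of_real_eq_0_iff)
        hence "(of_real t)\<^sup>2 + complex_of_real ((2 * pi * real (Suc k))\<^sup>2) \<noteq> 0" by simp
        from exp_kernel_nonpole[OF this] show ?thesis by simp
      qed
      have nz: "2 * of_real t * (exp (of_real t) - 1) \<noteq> (0 :: complex)"
      proof -
        have "complex_of_real (2 * t * (exp t - 1)) \<noteq> 0" by (subst of_real_eq_0_iff) (use t et in simp)
        thus ?thesis by (simp add: exp_of_real)
      qed
      have "summable (\<lambda>k. w k (of_real t) * exp_kernel (Suc k) (of_real t))"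
        by (rule exp_kernel_series_summable[OF w_holo w_bound])
      hence "summable (\<lambda>k. w k (of_real t) / of_real (t\<^sup>2 + (2 * pi * real (Suc k))\<^sup>2))"
        unfolding kern by (rule summable_mult_D[OF _ nz])
      from suminf_mult[OF this, of "2 * of_real t * (exp (of_real t) - 1)"]
      have "W (of_real t) = (2 * of_real t * (exp (of_real t) - 1)) * (\<Sum>k. w k (of_real t) / of_real (t\<^sup>2 + (2 * pi * real (Suc k))\<^sup>2))"
        unfolding W_def kern .
      thus ?thesis by simp
    qed
    hence "G (of_real t) = of_real 2 powr (- \<nu>) * ((exp (of_real t) - 1) * of_real t * e ((of_real t)\<^sup>2 / 4) +
       (exp (of_real t) - 1) * of_real t * (\<Sum>k. w k (of_real t) / of_real (t\<^sup>2 + (2 * pi * real (Suc k))\<^sup>2)))"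
      unfolding G_def by (simp only:)
    moreover have "complex_of_real (exp t - 1) = exp (of_real t) - 1" by (simp add: exp_of_real)
    ultimately show ?thesis unfolding 1 2 distrib_left[symmetric] by (simp only: mult_ac)
  qed
  have F_eq_G: "F z = G z" for z by (rule entire_eq_if_eq_on_unit_interval[OF F_holo G_holo FG])
  define x where "x = 2 * pi * real n"
  have x: "x > 0" using n by (simp add: x_def)
  \<comment> \<open>At a node exp z = 1 removes the part over (0, 1], and z^2 = - x^2 is the
    argument of \<open>lommel_at_imaginary\<close>. The value is the same for both signs, so it is
    also the value of the even part.\<close>
  have val: "F z = c n / 2 * of_real x powr (- \<nu>)" if z: "z = of_real r * \<i> * of_real x" "r = 1 \<or> r = - 1" for z and r :: real
  proof -
    have z2: "z\<^sup>2 = - of_real (x\<^sup>2)" using z by (auto simp: power_mult_distrib)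
    have "exp z = 1"
      using z exp_two_pi_i_nat[of n] by (auto simp: x_def exp_minus mult_ac)
    moreover have "W z = w (n - 1) z"
      unfolding W_def z(1) x_def by (rule exp_kernel_series_at_pole) (use n z in auto)
    moreover have "w (n - 1) z = c n * of_real (2 / x) powr \<nu>"
      using n lommel_at_imaginary[OF nu x] by (simp add: w_def z2 x_def)
    moreover have "of_real 2 powr (- \<nu>) * of_real (2 / x) powr \<nu> = of_real x powr (- \<nu>)"
    proof -
      have "complex_of_real 2 powr \<nu> = of_real (2 / x) powr \<nu> * of_real x powr \<nu>"
        using of_real_mult_powr[of "2 / x" x \<nu>] x by simp
      thus ?thesis using x by (simp add: powr_minus field_simps)
    qed
    ultimately show ?thesis unfolding F_eq_G G_def by (simp add: mult_ac)
  qed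
  have "s sums ((F (\<i> * of_real x) + F (- \<i> * of_real x)) / 2)"
    using power_series_even_part[of b F x, OF F b0] by (simp add: s_def b_def x_def)
  also have "(F (\<i> * of_real x) + F (- \<i> * of_real x)) / 2 = c n / 2 * of_real x powr (- \<nu>)"
    using val[of "\<i> * of_real x" 1] val[of "- \<i> * of_real x" "- 1"] by simp
  finally have s: "s sums (c n / 2 * of_real x powr (- \<nu>))" .
  thus "summable s" by (rule sums_summable)
  have "of_real x powr \<nu> = of_real (2 * pi) powr \<nu> * of_real (real n) powr \<nu>"
    unfolding x_def by (rule of_real_mult_powr) auto
  moreover have "c n = of_real x powr \<nu> * (2 * suminf s)"
    unfolding sums_unique[OF s, symmetric] using x by (simp add: powr_minus)
  ultimately show "c n = of_real (2 * pi) powr (q - 1/2) * (2 * of_nat n powr (q - 1/2) * suminf s)"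
    unfolding \<nu>_def by simp
qed

theorem theoremB:
  fixes q :: complex
  assumes "Re q > 0"
  shows
    "(\<exists>C :: complex. C \<noteq> 0 \<and>
        (\<forall>(u :: complex \<Rightarrow> complex) (c :: nat \<Rightarrow> complex) (a :: nat \<Rightarrow> complex).
           even_maass_cusp_form q u \<longrightarrow> fourier_coefficients q u c \<longrightarrow>
           associated_sequence q u a \<longrightarrow>
           (\<forall>n::nat. n \<ge> 1 \<longrightarrow>
              summable (\<lambda>k. (-1) ^ Suc k * a (2 * Suc k) / Gamma (of_nat (2 * Suc k) + 2 * q) *
                            of_real (2 * pi * real n) ^ (2 * Suc k)) \<and>
              c n = C * (2 * of_nat n powr (q - 1/2) *
                (\<Sum>k. (-1) ^ Suc k * a (2 * Suc k) / Gamma (of_nat (2 * Suc k) + 2 * q) *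
                      of_real (2 * pi * real n) ^ (2 * Suc k)))))) \<and>
     (\<forall>n::nat. n \<ge> 1 \<longrightarrow>
        summable (\<lambda>k. (-1) ^ Suc k * A_tilde (2 * Suc k) q / fact (2 * Suc k) *
                      of_real (2 * pi * real n) ^ (2 * Suc k)) \<and>
        divisor_sigma (2 * q - 1) n = of_nat n powr (2 * q - 1) *
          (\<Sum>k. (-1) ^ Suc k * A_tilde (2 * Suc k) q / fact (2 * Suc k) *
                of_real (2 * pi * real n) ^ (2 * Suc k)))"
proof (intro conjI exI[of _ "complex_of_real (2 * pi) powr (q - 1 / 2)"] allI impI)
  show "complex_of_real (2 * pi) powr (q - 1 / 2) \<noteq> 0" by simp
qed (use fourier_coefficient_formula[OF assms] divisor_sigma_series[OF assms] in \<open>blast+\<close>)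

end
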